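(* Let $n\to\infty$, $p=p_n$ and $\kappa=\kappa_n>0$ with $\kappa<p/2$ and $p/n^{2/3}\to\infty$. Denote by $\mu_n$ the Watson distribution on $\mathbb{S}^{p-1}$ with concentration parameter $\kappa$ (and arbitrary location). Assume that $$\frac{n\kappa^2}{p\,(p/2-\kappa)^2}\to\tau\in(0,\infty).$$ Let $X,Y$ be two i.i.d. random points on $\mathbb{S}^{p-1}$ (drawn from the measure indicated by the subscript of $\mathbb{P}$). Then for any $u\in\mathbb{R}$, $$n\Big[\mathbb{P}_{\mu_n}\big(\sqrt p\,X^\top Y\le u\big)-\mathbb{P}_{\mu_0}\big(\sqrt p\,X^\top Y\le u\big)\Big]\to\frac{-\tau}{2\sqrt{2\pi}}\,u\exp(-u^2/2).$$ In particular, $$n\cdot d(\mu_n,\mu_0)\to\frac{\tau}{2\sqrt{2e\pi}} .$$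
   Context: $\mathbb{S}^{p-1}=\{x\in\mathbb{R}^p:\|x\|_2=1\}$ and $\mu_0$ is the uniform distribution on it. The Watson distribution with concentration $\kappa>0$ and location $\theta\in\mathbb{S}^{p-1}$ has density proportional to $x\mapsto\exp(\kappa\,(x^\top\theta)^2)$ with respect to $\mu_0$. For probability measures $\mu,\nu$ on $\mathbb{S}^{p-1}$, $$d(\mu,\nu)=\sup_{t\in[-1,1]}\big|\mathbb{P}_\mu(X_1^\top Y_1\le t)-\mathbb{P}_\nu(X^\top Y\le t)\big|,$$ where $X_1,Y_1$ are drawn independently from $\mu$ and $X,Y$ independently from $\nu$. *)

theory Defs
  imports "HOL-Probability.Probability"
begin

text \<open>
  The dimension varies with the sample size, so a point of Euclidean $p$-space is a function in
  \<^term>\<open>{..<p} \<rightarrow>\<^sub>E (UNIV :: real set)\<close>, whose Euclidean norm is \<^term>\<open>L2_set x {..<p}\<close>.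
\<close>

definition dot :: "nat \<Rightarrow> (nat \<Rightarrow> real) \<Rightarrow> (nat \<Rightarrow> real) \<Rightarrow> real" where
  "dot p x y = (\<Sum>i<p. x i * y i)"

definition unit_sphere :: "nat \<Rightarrow> (nat \<Rightarrow> real) set" where
  "unit_sphere p = {x \<in> {..<p} \<rightarrow>\<^sub>E UNIV. L2_set x {..<p} = 1}"

definition unit_ball :: "nat \<Rightarrow> (nat \<Rightarrow> real) set" where
  "unit_ball p = {x \<in> {..<p} \<rightarrow>\<^sub>E UNIV. L2_set x {..<p} \<le> 1}"

definition normalise :: "nat \<Rightarrow> (nat \<Rightarrow> real) \<Rightarrow> nat \<Rightarrow> real" where
  "normalise p x = (\<lambda>i\<in>{..<p}. x i / L2_set x {..<p})"

text \<open>
  Normalised surface measure: the mass of a Borel set $A$ of the sphere is the proportion of the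
  volume of the unit ball taken up by the cone over $A$ with apex $0$. The apex itself, where
  \<^const>\<open>normalise\<close> does not yield a point of the sphere, is a null set for \<open>p \<ge> 1\<close>; restricting
  to the sphere discards it.
\<close>

definition uniform_sphere :: "nat \<Rightarrow> (nat \<Rightarrow> real) measure" where
  "uniform_sphere p =
     restrict_space
       (distr (uniform_measure (\<Pi>\<^sub>M i\<in>{..<p}. lborel) (unit_ball p))
              (\<Pi>\<^sub>M i\<in>{..<p}. borel) (normalise p))
       (unit_sphere p)"

definition watson :: "nat \<Rightarrow> real \<Rightarrow> (nat \<Rightarrow> real) \<Rightarrow> (nat \<Rightarrow> real) measure" where
  "watson p \<kappa> \<theta> =
     density (uniform_sphere p)
       (\<lambda>x. ennreal (exp (\<kappa> * (dot p x \<theta>)\<^sup>2) /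
                     (LINT y|uniform_sphere p. exp (\<kappa> * (dot p y \<theta>)\<^sup>2))))"

definition dot_dist ::
    "nat \<Rightarrow> (nat \<Rightarrow> real) measure \<Rightarrow> (nat \<Rightarrow> real) measure \<Rightarrow> real" where
  "dot_dist p M N =
     (SUP t\<in>{-1..1}. \<bar>\<P>(z in M \<Otimes>\<^sub>M M. dot p (fst z) (snd z) \<le> t)
                     - \<P>(z in N \<Otimes>\<^sub>M N. dot p (fst z) (snd z) \<le> t)\<bar>)"

lemma measurable_L2_set_lborel [measurable]: "(\<lambda>x. L2_set x {..<p}) \<in> borel_measurable (\<Pi>\<^sub>M i\<in>{..<p}. lborel)"
  unfolding L2_set_def by measurable

lemma measurable_L2_set_borel [measurable]: "(\<lambda>x. L2_set x {..<p}) \<in> borel_measurable (\<Pi>\<^sub>M i\<in>{..<p}. borel)"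
  unfolding L2_set_def by measurable

lemma sets_unit_ball: "unit_ball p \<in> sets (\<Pi>\<^sub>M i\<in>{..<p}. lborel)"
proof -
  have "unit_ball p = {x \<in> space (\<Pi>\<^sub>M i\<in>{..<p}. lborel). L2_set x {..<p} \<le> 1}"
    by (simp add: unit_ball_def space_PiM)
  then show ?thesis by simp
qed

lemma sets_unit_sphere: "unit_sphere p \<in> sets (\<Pi>\<^sub>M i\<in>{..<p}. borel)"
proof -
  have "unit_sphere p = {x \<in> space (\<Pi>\<^sub>M i\<in>{..<p}. borel). L2_set x {..<p} = 1}"
    by (simp add: unit_sphere_def space_PiM)
  then show ?thesis by simp
qed

lemma measurable_normalise: "normalise p \<in> (\<Pi>\<^sub>M i\<in>{..<p}. lborel) \<rightarrow>\<^sub>M (\<Pi>\<^sub>M i\<in>{..<p}. borel)"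
  unfolding normalise_def by measurable

lemma emeasure_unit_ball_finite: "emeasure (\<Pi>\<^sub>M i\<in>{..<p}. lborel) (unit_ball p) \<noteq> \<infinity>"
proof -
  interpret L: product_sigma_finite "\<lambda>_::nat. lborel :: real measure" by standard
  have "unit_ball p \<subseteq> (\<Pi>\<^sub>E i\<in>{..<p}. {-1..1})"
  proof
    fix x assume x: "x \<in> unit_ball p"
    show "x \<in> (\<Pi>\<^sub>E i\<in>{..<p}. {-1..1})"
    proof (rule PiE_I)
      fix i assume "i \<in> {..<p}"
      then have "\<bar>x i\<bar> \<le> L2_set (\<lambda>i. \<bar>x i\<bar>) {..<p}" by (intro member_le_L2_set) auto
      also have "\<dots> \<le> 1" using x by (simp add: unit_ball_def L2_set_def)
      finally show "x i \<in> {-1..1}" by auto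
    qed (use x in \<open>auto simp: unit_ball_def PiE_def extensional_def\<close>)
  qed
  then have "emeasure (\<Pi>\<^sub>M i\<in>{..<p}. lborel) (unit_ball p)
      \<le> emeasure (\<Pi>\<^sub>M i\<in>{..<p}. lborel) (\<Pi>\<^sub>E i\<in>{..<p}. {-1..1::real})"
    by (intro emeasure_mono) (auto intro!: sets_PiM_I_finite)
  also have "\<dots> = (\<Prod>i\<in>{..<p}. emeasure lborel {-1..1::real})"
    by (subst L.emeasure_PiM) auto
  also have "\<dots> < \<infinity>" by (simp add: power_eq_top_ennreal flip: less_top)
  finally show ?thesis by simp
qed

lemma emeasure_unit_ball_nonzero: "emeasure (\<Pi>\<^sub>M i\<in>{..<p}. lborel) (unit_ball p) \<noteq> 0"
proof -
  interpret L: product_sigma_finite "\<lambda>_::nat. lborel :: real measure" by standard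
  define c where "c = 1 / real (Suc p)"
  have c: "c > 0" by (simp add: c_def)
  have "(\<Pi>\<^sub>E i\<in>{..<p}. {-c..c}) \<subseteq> unit_ball p"
  proof
    fix x assume x: "x \<in> (\<Pi>\<^sub>E i\<in>{..<p}. {-c..c})"
    have "L2_set x {..<p} \<le> (\<Sum>i<p. \<bar>x i\<bar>)" by (rule L2_set_le_sum_abs)
    also have "\<dots> \<le> (\<Sum>i<p. c)" using x by (intro sum_mono) (auto simp: PiE_def Pi_def abs_le_iff)
    also have "\<dots> \<le> 1" by (simp add: c_def)
    finally show "x \<in> unit_ball p" using x by (auto simp: unit_ball_def)
  qed
  then have "emeasure (\<Pi>\<^sub>M i\<in>{..<p}. lborel) (\<Pi>\<^sub>E i\<in>{..<p}. {-c..c}) \<le> emeasure (\<Pi>\<^sub>M i\<in>{..<p}. lborel) (unit_ball p)"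
    by (intro emeasure_mono sets_unit_ball)
  moreover have "emeasure (\<Pi>\<^sub>M i\<in>{..<p}. lborel) (\<Pi>\<^sub>E i\<in>{..<p}. {-c..c}) = (\<Prod>i\<in>{..<p}. emeasure lborel {-c..c})"
    by (subst L.emeasure_PiM) auto
  moreover have "\<dots> \<noteq> 0" using c by simp
  ultimately show ?thesis by auto
qed

lemma prob_space_uniform_sphere:
  assumes "p \<ge> 1" shows "prob_space (uniform_sphere p)"
proof -
  interpret L: product_sigma_finite "\<lambda>_::nat. lborel :: real measure" by standard
  let ?M = "\<Pi>\<^sub>M i\<in>{..<p}. (lborel::real measure)"
  let ?U = "uniform_measure ?M (unit_ball p)"
  interpret U: prob_space ?U
    by (rule prob_space_uniform_measure[OF emeasure_unit_ball_nonzero emeasure_unit_ball_finite])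
  have nm: "normalise p \<in> ?U \<rightarrow>\<^sub>M (\<Pi>\<^sub>M i\<in>{..<p}. borel)"
    using measurable_normalise by simp
  let ?D = "distr ?U (\<Pi>\<^sub>M i\<in>{..<p}. borel) (normalise p)"
  let ?z = "\<Pi>\<^sub>E i\<in>{..<p}. {0::real}"
  have z: "emeasure ?M ?z = 0"
    using assms by (subst L.emeasure_PiM) auto
  have "AE x in ?M. x \<notin> ?z"
    by (intro AE_not_in null_setsI z sets_PiM_I_finite) simp_all
  then have "AE x in ?U. x \<notin> ?z"
    by (intro AE_uniform_measureI sets_unit_ball) auto
  moreover have "AE x in ?U. x \<in> space ?U" by (rule AE_space)
  ultimately have ae: "AE x in ?U. normalise p x \<in> unit_sphere p"
  proof eventually_elim
    case (elim x)
    then have "\<exists>i<p. x i \<noteq> 0"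
      by (auto simp: space_PiM PiE_def intro!: extensionalityI[of x "{..<p}"])
    then have "L2_set x {..<p} \<noteq> 0" by (auto simp: L2_set_eq_0_iff)
    moreover have "L2_set (normalise p x) {..<p} = L2_set (\<lambda>i. (1 / L2_set x {..<p}) * x i) {..<p}"
      by (intro L2_set_cong) (auto simp: normalise_def)
    moreover have "\<dots> = (1 / L2_set x {..<p}) * L2_set x {..<p}"
      by (rule L2_set_right_distrib [symmetric]) (simp add: L2_set_nonneg)
    ultimately have "L2_set (normalise p x) {..<p} = 1"
      by simp
    then show ?case by (auto simp: unit_sphere_def normalise_def)
  qed
  interpret D: prob_space ?D by (rule U.prob_space_distr[OF nm])
  have "AE x in ?D. x \<in> unit_sphere p"
    using ae sets_unit_sphere[of p]
    by (subst AE_distr_iff[OF nm]) (auto simp: unit_sphere_def space_PiM)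
  then have "emeasure ?D (unit_sphere p) = 1"
    using sets_unit_sphere[of p] by (intro D.emeasure_eq_1_AE) auto
  then show ?thesis unfolding uniform_sphere_def
    using sets_unit_sphere[of p] by (intro prob_space_restrict_space) auto
qed

lemma space_uniform_sphere: "space (uniform_sphere p) = unit_sphere p"
  using sets.sets_into_space[OF sets_unit_sphere[of p]]
  by (auto simp: uniform_sphere_def space_restrict_space)

lemma measurable_dot_left [measurable]: "(\<lambda>x. dot p x \<theta>) \<in> borel_measurable (uniform_sphere p)"
proof -
  have "(\<lambda>x. dot p x \<theta>) \<in> borel_measurable (\<Pi>\<^sub>M i\<in>{..<p}. borel)"
    unfolding dot_def by measurable
  then show ?thesis unfolding uniform_sphere_def by (intro measurable_restrict_space1) auto
qed

lemma prob_space_watson: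
  assumes "p \<ge> 1" "\<kappa> \<ge> 0" "\<theta> \<in> unit_sphere p" shows "prob_space (watson p \<kappa> \<theta>)"
proof -
  interpret prob_space "uniform_sphere p" by (rule prob_space_uniform_sphere) fact
  let ?f = "\<lambda>x. exp (\<kappa> * (dot p x \<theta>)\<^sup>2)"
  have b: "?f x \<le> exp (\<kappa> * 1)" if "x \<in> unit_sphere p" for x
  proof -
    have "\<bar>dot p x \<theta>\<bar> \<le> (\<Sum>i<p. \<bar>x i\<bar> * \<bar>\<theta> i\<bar>)"
      unfolding dot_def by (rule order_trans[OF sum_abs]) (simp add: abs_mult)
    also have "\<dots> \<le> L2_set x {..<p} * L2_set \<theta> {..<p}" by (rule L2_set_mult_ineq)
    also have "\<dots> = 1" using that assms by (simp add: unit_sphere_def)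
    finally have "(dot p x \<theta>)\<^sup>2 \<le> 1" by (simp add: abs_square_le_1)
    then show ?thesis using assms by (simp add: mult_left_le)
  qed
  have int: "integrable (uniform_sphere p) ?f"
    by (rule integrable_const_bound[where B = "exp (\<kappa> * 1)"]) (use b in \<open>auto simp: space_uniform_sphere\<close>)
  have pos: "(LINT y|uniform_sphere p. ?f y) \<ge> 1"
    using assms int by (intro integral_ge_const) auto
  have "(\<integral>\<^sup>+x. ennreal (?f x / (LINT y|uniform_sphere p. ?f y)) \<partial>uniform_sphere p) = 1"
    using pos int by (subst nn_integral_eq_integral) auto
  then show ?thesis unfolding watson_def
    by (intro prob_spaceI) (simp add: emeasure_density cong: nn_integral_cong)
qed

end

(*
  By rotation invariance the location theta may be averaged out, so under the Watson distribution the
  law of W = X.Y has a density with respect to its uniform law which is proportional to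
    E exp (kappa ((x.theta)^2 + (y.theta)^2)) = E [exp (kappa R) cosh (kappa W D)],
  where theta is now uniform, R = theta_0^2 + theta_1^2 and D = theta_0^2 - theta_1^2. This is an even
  function a_0 + a_1 W^2 + rest of W with non-negative coefficients. Against W^2 - 1/p the density of
  the uniform law integrates in closed form, to a multiple of t (1 - t^2)^((p-1)/2); this term gives
  both limits. The rest contributes at most E rest / a_0 = O(1/n^2), uniformly in t: the moments of W
  are at most those of a normal variable with variance 1/p, and sqrt (1 - R) has density
  (p-2) c^(p-3), so that a_0, a_1 and E rest become one-dimensional integrals.
*)
theory Submission
  imports Defs "HOL-Real_Asymp.Real_Asymp"
begin

text \<open>The natural scale is \<open>l = p / 2 - \<kappa>\<close>. The density of R is
  proportional to (1 - r)^(p/2 - 2), so the weight exp (\<kappa> R) makes R roughly exponential with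
  rate \<open>l\<close>: its k-th moment is about k! / l^k, and a_1 / (p a_0) is about s / 2 with s
  = \<kappa>^2 / (p l^2). The hypothesis says that n s tends to \<tau>, so n times the weight of the
  W^2 term tends to \<tau> / 2. The next term is of the order \<kappa>^4 E W^4 E R^4, that is
  \<kappa>^4 / (p^2 l^4) = s^2, which explains the size of the rest. The obstacle is the range of
  regimes: \<kappa> is of smaller order than p when p is small against n, and close to p / 2, with
  \<open>l\<close> far smaller than p, when p is large against n. Hence all estimates are
  inequalities with explicit constants at fixed p and \<kappa>, and limits are taken only at the
  end, where s tending to 0 and p tending to infinity force 1 / l and \<kappa> / l^2 to 0 in every
  regime.\<close>

section \<open>Reflections preserve Lebesgue measure\<close>

abbreviation lebesgue_on_coords :: "nat set \<Rightarrow> (nat \<Rightarrow> real) measure" where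
  "lebesgue_on_coords I \<equiv> \<Pi>\<^sub>M i\<in>I. lborel"

interpretation lborel_prod: product_sigma_finite "\<lambda>_::nat. lborel :: real measure"
  by standard

lemma sets_lebesgue_on_coords: "sets (lebesgue_on_coords I) = sets (\<Pi>\<^sub>M i\<in>I. borel)"
  by (intro sets_PiM_cong) auto

lemma measurable_coords_into:
  assumes "\<And>i. i \<in> I \<Longrightarrow> (\<lambda>x. f x i) \<in> borel_measurable M" "\<And>x. x \<in> space M \<Longrightarrow> f x \<in> extensional I"
  shows "f \<in> M \<rightarrow>\<^sub>M lebesgue_on_coords I"
  using assms by (intro measurable_PiM_single') (auto simp: PiE_def)

lemma measurable_coord_upd:
  assumes [measurable]: "h \<in> borel_measurable (lebesgue_on_coords I)" and k: "k \<in> I"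
  shows "(\<lambda>x. x(k := h x)) \<in> lebesgue_on_coords I \<rightarrow>\<^sub>M lebesgue_on_coords I"
proof (rule measurable_coords_into)
  fix i assume [measurable]: "i \<in> I"
  show "(\<lambda>x. (x(k := h x)) i) \<in> borel_measurable (lebesgue_on_coords I)"
    by (cases "i = k") simp_all
qed (use k in \<open>auto simp: space_PiM PiE_def extensional_def\<close>)

text \<open>By Fubini the coordinate \<open>k\<close> is integrated first, and there
  \<open>f\<close> is a constant shift because it ignores that coordinate; what remains is the
  affine substitution on the line. With \<open>c = 1\<close> this is a shear, with
  \<open>f = 0\<close> a scaling or a sign change, and the linear maps below are composed of such
  steps.\<close>

lemma nn_integral_coord_affine:
  fixes f :: "(nat \<Rightarrow> real) \<Rightarrow> real" and g :: "(nat \<Rightarrow> real) \<Rightarrow> ennreal"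
  assumes I: "finite I" "k \<in> I" and c: "c \<noteq> 0"
    and [measurable]: "f \<in> borel_measurable (lebesgue_on_coords I)" "g \<in> borel_measurable (lebesgue_on_coords I)"
    and f: "\<And>x y. f (x(k := y)) = f x"
  shows "(\<integral>\<^sup>+x. g x \<partial>lebesgue_on_coords I)
           = ennreal \<bar>c\<bar> * (\<integral>\<^sup>+x. g (x(k := f x + c * x k)) \<partial>lebesgue_on_coords I)"
proof -
  define J where "J = I - {k}"
  have J: "finite J" "k \<notin> J" "I = insert k J" using I by (auto simp: J_def)
  have [measurable]: "(\<lambda>x. x k) \<in> borel_measurable (lebesgue_on_coords I)"
    using I by measurable
  have [measurable]: "(\<lambda>x. x(k := f x + c * x k)) \<in> lebesgue_on_coords I \<rightarrow>\<^sub>M lebesgue_on_coords I"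
    using I by (intro measurable_coord_upd) measurable
  have g2: "(\<lambda>x. g (x(k := f x + c * x k))) \<in> borel_measurable (lebesgue_on_coords (insert k J))"
    unfolding J(3)[symmetric] by measurable
  have g1: "g \<in> borel_measurable (lebesgue_on_coords (insert k J))"
    unfolding J(3)[symmetric] by measurable
  have "(\<integral>\<^sup>+x. g x \<partial>lebesgue_on_coords I) = (\<integral>\<^sup>+x. (\<integral>\<^sup>+y. g (x(k := y)) \<partial>lborel) \<partial>lebesgue_on_coords J)"
    unfolding J(3) by (rule lborel_prod.product_nn_integral_insert[OF J(1,2) g1])
  also have "\<dots> = (\<integral>\<^sup>+x. ennreal \<bar>c\<bar> * (\<integral>\<^sup>+y. g (x(k := f x + c * y)) \<partial>lborel) \<partial>lebesgue_on_coords J)"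
  proof (intro nn_integral_cong)
    fix x assume x: "x \<in> space (lebesgue_on_coords J)"
    have "(\<lambda>y. x(k := y)) \<in> lborel \<rightarrow>\<^sub>M lebesgue_on_coords (insert k J)"
      by (intro measurable_fun_upd[where J=J]) (use x in auto)
    then have "(\<lambda>y. g (x(k := y))) \<in> borel_measurable lborel"
      using g1 by measurable
    then have "(\<lambda>y. g (x(k := y))) \<in> borel_measurable borel" by simp
    from nn_integral_real_affine[OF this c, of "f x"]
    show "(\<integral>\<^sup>+y. g (x(k := y)) \<partial>lborel) = ennreal \<bar>c\<bar> * (\<integral>\<^sup>+y. g (x(k := f x + c * y)) \<partial>lborel)" .
  qed
  \<comment> \<open>The integrand has to depend on \<open>x(k := y)\<close> only before the product
    formula can be read backwards; \<open>f (x(k := y)) = f x\<close> allows this.\<close>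
  also have "\<dots> = (\<integral>\<^sup>+x. (\<integral>\<^sup>+y. ennreal \<bar>c\<bar> * g ((x(k := y))(k := f (x(k := y)) + c * (x(k := y)) k)) \<partial>lborel) \<partial>lebesgue_on_coords J)"
  proof (intro nn_integral_cong)
    fix x assume x: "x \<in> space (lebesgue_on_coords J)"
    have "(\<lambda>y. x(k := y)) \<in> lborel \<rightarrow>\<^sub>M lebesgue_on_coords (insert k J)"
      by (intro measurable_fun_upd[where J=J]) (use x in auto)
    then have "(\<lambda>y. g ((x(k := y))(k := f (x(k := y)) + c * (x(k := y)) k))) \<in> borel_measurable lborel"
      by (rule measurable_compose[OF _ g2])
    then show "ennreal \<bar>c\<bar> * (\<integral>\<^sup>+y. g (x(k := f x + c * y)) \<partial>lborel) =
       (\<integral>\<^sup>+y. ennreal \<bar>c\<bar> * g ((x(k := y))(k := f (x(k := y)) + c * (x(k := y)) k)) \<partial>lborel)"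
      by (subst nn_integral_cmult) (simp_all add: f)
  qed
  also have "\<dots> = (\<integral>\<^sup>+x. ennreal \<bar>c\<bar> * g (x(k := f x + c * x k)) \<partial>lebesgue_on_coords I)"
    unfolding J(3) using g2
    by (subst lborel_prod.product_nn_integral_insert[OF J(1,2)]) auto
  also have "\<dots> = ennreal \<bar>c\<bar> * (\<integral>\<^sup>+x. g (x(k := f x + c * x k)) \<partial>lebesgue_on_coords I)"
    by (intro nn_integral_cmult) measurable
  finally show ?thesis .
qed

text \<open>All shears are driven by the coordinate \<open>k\<close>, which none of them changes, so
  they can be applied one coordinate at a time.\<close>

lemma nn_integral_shears:
  fixes a :: "nat \<Rightarrow> real" and g :: "(nat \<Rightarrow> real) \<Rightarrow> ennreal"
  assumes I: "finite I" "k \<in> I" and S: "S \<subseteq> I - {k}"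
    and g: "g \<in> borel_measurable (lebesgue_on_coords I)"
  shows "(\<integral>\<^sup>+x. g (\<lambda>j. if j \<in> S then x j + a j * x k else x j) \<partial>lebesgue_on_coords I)
           = (\<integral>\<^sup>+x. g x \<partial>lebesgue_on_coords I)"
proof -
  have "finite S" using I S finite_subset by blast
  then show ?thesis using S
  proof (induction S)
    case empty then show ?case by simp
  next
    case (insert i S)
    let ?T = "\<lambda>S x. (\<lambda>j. if j \<in> S then x j + a j * x k else x j)"
    have i: "i \<in> I" "i \<noteq> k" "i \<notin> S" "k \<notin> S" using insert by auto
    have xm [measurable]: "(\<lambda>x. x j) \<in> borel_measurable (lebesgue_on_coords I)" if "j \<in> I" for j
      using that by measurable
    have T: "?T S \<in> lebesgue_on_coords I \<rightarrow>\<^sub>M lebesgue_on_coords I"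
    proof (rule measurable_coords_into)
      fix j assume "j \<in> I"
      then show "(\<lambda>x. ?T S x j) \<in> borel_measurable (lebesgue_on_coords I)"
        using I by (cases "j \<in> S") (auto intro!: borel_measurable_add borel_measurable_times xm)
    next
      fix x assume "x \<in> space (lebesgue_on_coords I)"
      then show "?T S x \<in> extensional I"
        using insert.prems by (auto simp: space_PiM PiE_def extensional_def)
    qed
    have "(\<integral>\<^sup>+x. g (?T (insert i S) x) \<partial>lebesgue_on_coords I)
        = (\<integral>\<^sup>+x. g (?T S (x(i := a i * x k + 1 * x i))) \<partial>lebesgue_on_coords I)"
      using i by (intro nn_integral_cong arg_cong[where f=g]) (auto simp: fun_eq_iff)
    also have "\<dots> = (\<integral>\<^sup>+x. g (?T S x) \<partial>lebesgue_on_coords I)"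
      using measurable_compose[OF T g]
      by (subst nn_integral_coord_affine[OF I(1) i(1), of 1 "\<lambda>x. a i * x k" "\<lambda>x. g (?T S x)"])
         (use I i in \<open>auto intro!: borel_measurable_times xm\<close>)
    also have "\<dots> = (\<integral>\<^sup>+x. g x \<partial>lebesgue_on_coords I)" using insert by simp
    finally show ?case .
  qed
qed

text \<open>If \<open>v\<close> vanishes on \<open>{..<p}\<close>, division by zero makes this the identity.\<close>

definition householder :: "nat \<Rightarrow> (nat \<Rightarrow> real) \<Rightarrow> (nat \<Rightarrow> real) \<Rightarrow> nat \<Rightarrow> real" where
  "householder p v x = (\<lambda>i\<in>{..<p}. x i - 2 * dot p v x / dot p v v * v i)"

lemma dot_commute: "dot p x y = dot p y x"
  by (simp add: dot_def mult.commute)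

lemma dot_diff_scaled_left: "dot p (\<lambda>i. x i - c * y i) z = dot p x z - c * dot p y z"
  by (simp add: dot_def sum_subtractf sum_distrib_left algebra_simps)

lemma dot_diff_scaled_right: "dot p z (\<lambda>i. x i - c * y i) = dot p z x - c * dot p z y"
  by (simp add: dot_def sum_subtractf sum_distrib_left algebra_simps)

lemma dot_cong: "(\<And>i. i < p \<Longrightarrow> x i = x' i) \<Longrightarrow> (\<And>i. i < p \<Longrightarrow> y i = y' i) \<Longrightarrow> dot p x y = dot p x' y'"
  by (simp add: dot_def)

lemma dot_self_eq_0_iff: "dot p v v = 0 \<longleftrightarrow> (\<forall>i<p. v i = 0)"
  by (auto simp: dot_def sum_nonneg_eq_0_iff)

lemma L2_set_eq_sqrt_dot: "L2_set x {..<p} = sqrt (dot p x x)"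
  by (simp add: L2_set_def dot_def power2_eq_square)

lemma dot_householder:
  "dot p (householder p v x) (householder p v y) = dot p x y"
proof (cases "dot p v v = 0")
  case True
  then show ?thesis by (intro dot_cong) (auto simp: householder_def)
next
  case False
  let ?a = "2 * dot p v x / dot p v v" and ?b = "2 * dot p v y / dot p v v"
  have "dot p (householder p v x) (householder p v y) = dot p (\<lambda>i. x i - ?a * v i) (\<lambda>i. y i - ?b * v i)"
    by (intro dot_cong) (auto simp: householder_def)
  also have "\<dots> = dot p x y - ?b * dot p v x - ?a * (dot p v y - ?b * dot p v v)"
    unfolding dot_diff_scaled_left dot_diff_scaled_right by (simp add: dot_commute[of p x v])
  also have "\<dots> = dot p x y" using False by (simp add: field_simps)
  finally show ?thesis .
qed

lemma measurable_householder [measurable]: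
  "householder p v \<in> lebesgue_on_coords {..<p} \<rightarrow>\<^sub>M lebesgue_on_coords {..<p}"
  by (rule measurable_coords_into) (auto simp: householder_def dot_def)

lemma nn_integral_householder:
  assumes g: "g \<in> borel_measurable (lebesgue_on_coords {..<p})"
  shows "(\<integral>\<^sup>+x. g (householder p v x) \<partial>lebesgue_on_coords {..<p}) = (\<integral>\<^sup>+x. g x \<partial>lebesgue_on_coords {..<p})"
    (is "?lhs = ?rhs")
proof (cases "dot p v v = 0")
  case True
  then show ?thesis
    by (intro nn_integral_cong arg_cong[where f=g])
       (auto simp: householder_def space_PiM PiE_def extensional_def fun_eq_iff)
next
  case False
  then obtain k where k: "k < p" "v k \<noteq> 0" by (auto simp: dot_self_eq_0_iff)
  let ?L = "lebesgue_on_coords {..<p}"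
  define J where "J = {..<p} - {k}"
  have J: "{..<p} = insert k J" "finite J" "k \<notin> J" using k by (auto simp: J_def)
  define f where "f x = (\<Sum>i\<in>J. v i * x i)" for x :: "nat \<Rightarrow> real"
  have dot_v: "dot p v x = f x + v k * x k" for x
    unfolding dot_def f_def J(1) using J by simp
  \<comment> \<open>In the coordinates where \<open>x k\<close> is replaced by \<open>dot p v x\<close>, the reflection is a sign change
    of that coordinate followed by shears.\<close>
  define A where "A x = x(k := f x + v k * x k)" for x
  define A' where "A' z = z(k := (- f z / v k) + (1 / v k) * z k)" for z
  define B where "B z = (\<lambda>j. if j \<in> J then z j + (2 * v j / dot p v v) * z k else z j)" for z
  have xm: "(\<lambda>x. x j) \<in> borel_measurable ?L" if "j < p" for j
    using measurable_component_singleton[of j "{..<p}" "\<lambda>_. lborel"] that by simp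
  have f_upd: "f (x(k := y)) = f x" for x y
    unfolding f_def using J by (intro sum.cong) auto
  have fm [measurable]: "f \<in> borel_measurable ?L"
    unfolding f_def by (intro borel_measurable_sum borel_measurable_times borel_measurable_const xm) (simp add: J_def)
  have A'A: "A' (A x) = x" for x using k by (auto simp: A_def A'_def f_upd fun_eq_iff field_simps)
  have upd_m: "(\<lambda>x. x(k := h x)) \<in> ?L \<rightarrow>\<^sub>M ?L" if [measurable]: "h \<in> borel_measurable ?L" for h
    using k by (intro measurable_coord_upd that) simp
  have A'm: "A' \<in> ?L \<rightarrow>\<^sub>M ?L" unfolding A'_def
    using k by (intro upd_m) (auto intro!: borel_measurable_add borel_measurable_times borel_measurable_divide fm xm)
  have Am: "A \<in> ?L \<rightarrow>\<^sub>M ?L" unfolding A_def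
    using k by (intro upd_m) (auto intro!: borel_measurable_add borel_measurable_times borel_measurable_divide fm xm)
  have Bm: "B \<in> ?L \<rightarrow>\<^sub>M ?L"
  proof (rule measurable_coords_into)
    fix j assume "j \<in> {..<p}"
    then show "(\<lambda>x. B x j) \<in> borel_measurable ?L"
      unfolding B_def using k by (cases "j \<in> J") (auto intro!: borel_measurable_add borel_measurable_times xm)
  qed (auto simp: B_def space_PiM PiE_def extensional_def J_def)
  have key: "A (householder p v x) = B ((A x)(k := 0 + (-1) * A x k))" if x: "x \<in> space ?L" for x
  proof
    fix j
    have "dot p v (householder p v x) = dot p v (\<lambda>i. x i - 2 * dot p v x / dot p v v * v i)"
      by (intro dot_cong) (auto simp: householder_def)
    also have "\<dots> = - dot p v x"
      unfolding dot_diff_scaled_right using False by simp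
    finally have 1: "dot p v (householder p v x) = - dot p v x" .
    have "j = k \<or> j \<in> J \<or> j \<ge> p" by (auto simp: J_def)
    then consider "j = k" | "j \<in> J" | "j \<ge> p" by blast
    then show "A (householder p v x) j = B ((A x)(k := 0 + (-1) * A x k)) j"
    proof cases
      case 1
      then show ?thesis using \<open>dot p v (householder p v x) = - dot p v x\<close> J
        by (simp add: A_def B_def dot_v)
    next
      case 2
      then have "j < p" "j \<noteq> k" by (auto simp: J_def)
      with 2 show ?thesis
        by (simp add: A_def B_def householder_def) (simp add: dot_v add_divide_distrib diff_divide_distrib algebra_simps)
    next
      case 3
      then have "j \<noteq> k" "j \<notin> J" using k by (auto simp: J_def)
      with 3 x show ?thesis
        by (simp add: A_def B_def householder_def space_PiM PiE_def extensional_def)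
    qed
  qed
  let ?g = "\<lambda>z. g (A' z)"
  have gm: "?g \<in> borel_measurable ?L" by (rule measurable_compose[OF A'm g])
  have gB: "(\<lambda>z. ?g (B z)) \<in> borel_measurable ?L" by (rule measurable_compose[OF Bm gm])
  have gS: "(\<lambda>z. ?g (B (z(k := 0 + (-1) * z k)))) \<in> borel_measurable ?L"
    using k by (intro measurable_compose[OF _ gB] upd_m)
       (auto intro!: borel_measurable_add borel_measurable_times xm)
  \<comment> \<open>\<open>A\<close> is not volume preserving: it stretches the coordinate
    \<open>k\<close> by \<open>v k\<close>. The factor appears once on entering and once on leaving
    these coordinates and cancels at the end; the sign change and the shears contribute
    none.\<close>
  have "ennreal \<bar>v k\<bar> * ?lhs = ennreal \<bar>v k\<bar> * (\<integral>\<^sup>+x. ?g (B ((A x)(k := 0 + (-1) * A x k))) \<partial>?L)"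
    by (intro arg_cong2[where f="(*)"] nn_integral_cong refl) (metis key A'A)
  also have "\<dots> = (\<integral>\<^sup>+x. ?g (B (x(k := 0 + (-1) * x k))) \<partial>?L)"
    unfolding A_def
    by (subst nn_integral_coord_affine[OF _ _ k(2) fm gS f_upd]) (use k in auto)
  also have "\<dots> = (\<integral>\<^sup>+x. ?g (B x) \<partial>?L)"
    by (subst nn_integral_coord_affine[OF _ _ _ _ gB, of k "-1" "\<lambda>_. 0"]) (use k in auto)
  also have "\<dots> = (\<integral>\<^sup>+x. ?g x \<partial>?L)"
    unfolding B_def by (rule nn_integral_shears) (use k gm in \<open>auto simp: J_def\<close>)
  also have "\<dots> = ennreal \<bar>v k\<bar> * (\<integral>\<^sup>+x. ?g (A x) \<partial>?L)"
    unfolding A_def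
    by (subst nn_integral_coord_affine[OF _ _ k(2) fm gm f_upd]) (use k in auto)
  also have "(\<integral>\<^sup>+x. ?g (A x) \<partial>?L) = ?rhs" by (simp add: A'A)
  finally show ?thesis
    using k by (simp add: ennreal_mult_cancel_left)
qed

section \<open>Rotation invariance of the uniform distribution\<close>

lemma sets_uniform_sphere_iff:
  "A \<in> sets (uniform_sphere p) \<longleftrightarrow> A \<in> sets (\<Pi>\<^sub>M i\<in>{..<p}. borel) \<and> A \<subseteq> unit_sphere p"
  unfolding uniform_sphere_def
  by (subst sets_restrict_space_iff) (use sets_unit_sphere[of p] in \<open>auto simp: sets.Int_space_eq2\<close>)

lemma measurable_into_uniform_sphere:
  assumes "f \<in> M \<rightarrow>\<^sub>M (\<Pi>\<^sub>M i\<in>{..<p}. borel)" "\<And>x. x \<in> space M \<Longrightarrow> f x \<in> unit_sphere p"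
  shows "f \<in> M \<rightarrow>\<^sub>M uniform_sphere p"
  using assms unfolding uniform_sphere_def
  by (intro measurable_restrict_space2) auto

lemma measurable_from_uniform_sphere:
  assumes "f \<in> (\<Pi>\<^sub>M i\<in>{..<p}. borel) \<rightarrow>\<^sub>M N"
  shows "f \<in> uniform_sphere p \<rightarrow>\<^sub>M N"
  using assms unfolding uniform_sphere_def by (intro measurable_restrict_space1) auto

lemma measurable_uniform_sphere_component:
  assumes "f \<in> M \<rightarrow>\<^sub>M uniform_sphere p" "i < p"
  shows "(\<lambda>x. f x i) \<in> borel_measurable M"
proof -
  have "(\<lambda>x. x i) \<in> borel_measurable (\<Pi>\<^sub>M i\<in>{..<p}. borel)"
    using assms(2) by simp
  from measurable_compose[OF assms(1) measurable_from_uniform_sphere[OF this]] show ?thesis .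
qed

lemma measurable_dot [measurable (raw)]:
  assumes "f \<in> M \<rightarrow>\<^sub>M uniform_sphere p" "g \<in> M \<rightarrow>\<^sub>M uniform_sphere p"
  shows "(\<lambda>x. dot p (f x) (g x)) \<in> borel_measurable M"
  unfolding dot_def
  by (intro borel_measurable_sum borel_measurable_times measurable_uniform_sphere_component[OF assms(1)]
        measurable_uniform_sphere_component[OF assms(2)]) auto

lemma unit_sphere_iff: "x \<in> unit_sphere p \<longleftrightarrow> x \<in> extensional {..<p} \<and> dot p x x = 1"
  by (auto simp: unit_sphere_def L2_set_eq_sqrt_dot PiE_def)

lemma unit_ball_iff: "x \<in> unit_ball p \<longleftrightarrow> x \<in> extensional {..<p} \<and> dot p x x \<le> 1"
  by (auto simp: unit_ball_def L2_set_eq_sqrt_dot PiE_def)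

lemma abs_dot_le_1:
  assumes "x \<in> unit_sphere p" "y \<in> unit_sphere p"
  shows "\<bar>dot p x y\<bar> \<le> 1"
proof -
  have "\<bar>dot p x y\<bar> \<le> (\<Sum>i<p. \<bar>x i\<bar> * \<bar>y i\<bar>)"
    unfolding dot_def by (rule order_trans[OF sum_abs]) (simp add: abs_mult)
  also have "\<dots> \<le> L2_set x {..<p} * L2_set y {..<p}" by (rule L2_set_mult_ineq)
  also have "\<dots> = 1" using assms by (simp add: unit_sphere_def)
  finally show ?thesis .
qed

text \<open>Integrals over the sphere become Lebesgue integrals over the ball, where reflections and
  slices are available. The indicator of the sphere excludes only the apex of the cones, where
  \<open>normalise\<close> returns zeros.\<close>

lemma nn_integral_uniform_sphere:
  assumes [measurable]: "g \<in> borel_measurable (\<Pi>\<^sub>M i\<in>{..<p}. borel)"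
  shows "(\<integral>\<^sup>+z. g z \<partial>uniform_sphere p) =
    (\<integral>\<^sup>+x. g (normalise p x) * indicator (unit_sphere p) (normalise p x) * indicator (unit_ball p) x
       \<partial>lebesgue_on_coords {..<p}) / emeasure (lebesgue_on_coords {..<p}) (unit_ball p)"
proof -
  note [measurable] = sets_unit_sphere sets_unit_ball measurable_normalise
  show ?thesis unfolding uniform_sphere_def
    by (subst nn_integral_restrict_space)
       (use sets_unit_sphere[of p] in \<open>auto simp: sets.Int_space_eq2 nn_integral_distr nn_integral_uniform_measure\<close>)
qed

lemma dot_scaled_right: "dot p v (\<lambda>i. x i / c) = dot p v x / c"
  by (simp add: dot_def sum_divide_distrib)

lemma normalise_householder:
  "normalise p (householder p v x) = householder p v (normalise p x)"
proof -
  have n: "L2_set (householder p v x) {..<p} = L2_set x {..<p}"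
    by (simp add: L2_set_eq_sqrt_dot dot_householder)
  have "dot p v (normalise p x) = dot p v (\<lambda>i. x i / L2_set x {..<p})"
    by (intro dot_cong) (auto simp: normalise_def)
  then have d: "dot p v (normalise p x) = dot p v x / L2_set x {..<p}"
    by (simp add: dot_scaled_right)
  show ?thesis
  proof
    fix i
    show "normalise p (householder p v x) i = householder p v (normalise p x) i"
      unfolding normalise_def[of p "householder p v x"] n householder_def[of p v "normalise p x"] d
      by (simp add: normalise_def householder_def diff_divide_distrib)
  qed
qed

lemma householder_in_unit_sphere: "householder p v x \<in> unit_sphere p \<longleftrightarrow> dot p x x = 1"
  by (auto simp: unit_sphere_iff dot_householder) (auto simp: householder_def)

lemma householder_in_unit_ball: "householder p v x \<in> unit_ball p \<longleftrightarrow> dot p x x \<le> 1"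
  by (auto simp: unit_ball_iff dot_householder) (auto simp: householder_def)

lemma measurable_householder_sphere [measurable]:
  "householder p v \<in> uniform_sphere p \<rightarrow>\<^sub>M uniform_sphere p"
proof (rule measurable_into_uniform_sphere)
  have "householder p v \<in> (\<Pi>\<^sub>M i\<in>{..<p}. borel) \<rightarrow>\<^sub>M (\<Pi>\<^sub>M i\<in>{..<p}. borel)"
    using measurable_householder[of p v]
      measurable_cong_sets[OF sets_lebesgue_on_coords[of "{..<p}"] sets_lebesgue_on_coords[of "{..<p}"]] by simp
  then show "householder p v \<in> uniform_sphere p \<rightarrow>\<^sub>M (\<Pi>\<^sub>M i\<in>{..<p}. borel)"
    by (rule measurable_from_uniform_sphere)
next
  fix x assume "x \<in> space (uniform_sphere p)"
  then show "householder p v x \<in> unit_sphere p"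
    unfolding householder_in_unit_sphere by (simp add: space_uniform_sphere unit_sphere_iff)
qed

text \<open>A reflection preserves Lebesgue measure and the ball and commutes with
  \<open>normalise\<close>, so the cone over a preimage is the preimage of the cone.\<close>

lemma distr_uniform_sphere_householder:
  "distr (uniform_sphere p) (uniform_sphere p) (householder p v) = uniform_sphere p"
proof (rule measure_eqI)
  fix A assume "A \<in> sets (distr (uniform_sphere p) (uniform_sphere p) (householder p v))"
  then have A: "A \<in> sets (uniform_sphere p)" by simp
  then have AB [measurable]: "A \<in> sets (\<Pi>\<^sub>M i\<in>{..<p}. borel)" by (simp add: sets_uniform_sphere_iff)
  have H: "householder p v \<in> (\<Pi>\<^sub>M i\<in>{..<p}. borel) \<rightarrow>\<^sub>M (\<Pi>\<^sub>M i\<in>{..<p}. borel)"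
    using measurable_householder[of p v]
      measurable_cong_sets[OF sets_lebesgue_on_coords[of "{..<p}"] sets_lebesgue_on_coords[of "{..<p}"]] by simp
  let ?L = "lebesgue_on_coords {..<p}"
  let ?g = "\<lambda>x. indicator A (normalise p x) * indicator (unit_sphere p) (normalise p x) * indicator (unit_ball p) x :: ennreal"
  note [measurable] = sets_unit_sphere sets_unit_ball measurable_normalise H
  have gm: "?g \<in> borel_measurable ?L" by measurable
  have "emeasure (distr (uniform_sphere p) (uniform_sphere p) (householder p v)) A
      = (\<integral>\<^sup>+z. indicator A (householder p v z) \<partial>uniform_sphere p)"
    using A by (simp add: nn_integral_distr flip: nn_integral_indicator)
  also have "\<dots> = (\<integral>\<^sup>+x. ?g (householder p v x) \<partial>?L) / emeasure ?L (unit_ball p)"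
  proof -
    have "indicator A (householder p v (normalise p x)) * indicator (unit_sphere p) (normalise p x) * indicator (unit_ball p) x
        = ?g (householder p v x)" if "x \<in> space ?L" for x
    proof -
      have "householder p v (normalise p x) \<in> unit_sphere p \<longleftrightarrow> normalise p x \<in> unit_sphere p"
        unfolding householder_in_unit_sphere by (simp add: unit_sphere_iff) (simp add: normalise_def)
      moreover have "householder p v x \<in> unit_ball p \<longleftrightarrow> x \<in> unit_ball p"
        unfolding householder_in_unit_ball using that by (auto simp: unit_ball_iff space_PiM PiE_def)
      ultimately show ?thesis by (simp add: normalise_householder indicator_def)
    qed
    then show ?thesis
      by (subst nn_integral_uniform_sphere) (auto intro!: arg_cong2[where f="(/)"] nn_integral_cong)
  qed
  also have "\<dots> = (\<integral>\<^sup>+x. ?g x \<partial>?L) / emeasure ?L (unit_ball p)"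
    by (subst nn_integral_householder[OF gm]) simp
  also have "\<dots> = emeasure (uniform_sphere p) A"
    using A by (subst nn_integral_uniform_sphere[symmetric]) auto
  finally show "emeasure (distr (uniform_sphere p) (uniform_sphere p) (householder p v)) A
      = emeasure (uniform_sphere p) A" .
qed simp

text \<open>Two vectors of equal length are exchanged by the reflection whose normal is their
  difference. The factor \<open>1\<close> gives this difference the shape expected by the
  bilinearity rules. For \<open>u = u'\<close> the normal is zero and \<open>householder\<close>
  degenerates to the identity, which is still right.\<close>

lemma householder_swap:
  assumes "u \<in> unit_sphere p" "u' \<in> unit_sphere p"
  shows "householder p (\<lambda>i. u i - 1 * u' i) u = u'"
proof
  fix i
  have 1: "dot p (\<lambda>i. u i - 1 * u' i) u = 1 - dot p u u'"
    using assms unfolding dot_diff_scaled_left by (simp add: unit_sphere_iff dot_commute[of p u' u])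
  have 2: "dot p (\<lambda>i. u i - 1 * u' i) (\<lambda>i. u i - 1 * u' i) = 2 * (1 - dot p u u')"
    using assms unfolding dot_diff_scaled_left dot_diff_scaled_right
    by (simp add: unit_sphere_iff dot_commute[of p u' u])
  show "householder p (\<lambda>i. u i - 1 * u' i) u i = u' i"
  proof (cases "i < p")
    case True
    show ?thesis
    proof (cases "dot p u u' = 1")
      case True
      with 2 have "\<forall>i<p. u i - 1 * u' i = 0" using dot_self_eq_0_iff by fastforce
      with \<open>i < p\<close> show ?thesis by (simp add: householder_def)
    next
      case False
      then have "2 * (1 - dot p u u') / (2 * (1 - dot p u u')) = 1" by simp
      then show ?thesis using \<open>i < p\<close> by (simp add: householder_def 1[simplified] 2[simplified])
    qed
  next
    case False
    then show ?thesis using assms by (simp add: householder_def unit_sphere_iff extensional_def)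
  qed
qed

lemma householder_fixes:
  assumes "x \<in> extensional {..<p}" "dot p v x = 0"
  shows "householder p v x = x"
  using assms by (auto simp: householder_def extensional_def)

text \<open>The second reflection fixes \<open>u'\<close>, because \<open>u\<close> and \<open>v\<close> have the same scalar product as
  \<open>u'\<close> and \<open>v'\<close>.\<close>

lemma obtain_rotation:
  assumes uv: "u \<in> unit_sphere p" "v \<in> unit_sphere p" "u' \<in> unit_sphere p" "v' \<in> unit_sphere p"
    and eq: "dot p u v = dot p u' v'"
  obtains Q where "Q \<in> uniform_sphere p \<rightarrow>\<^sub>M uniform_sphere p"
    "distr (uniform_sphere p) (uniform_sphere p) Q = uniform_sphere p"
    "\<And>x y. dot p (Q x) (Q y) = dot p x y" "Q u = u'" "Q v = v'"
proof -
  define H where "H = householder p (\<lambda>i. u i - 1 * u' i)"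
  define w where "w = H v"
  define K where "K = householder p (\<lambda>i. w i - 1 * v' i)"
  have H: "H u = u'" unfolding H_def by (rule householder_swap) fact+
  have w: "w \<in> unit_sphere p"
    using uv by (simp add: w_def H_def householder_in_unit_sphere) (simp add: unit_sphere_iff)
  have K: "K w = v'" unfolding K_def by (rule householder_swap) fact+
  have "dot p w u' = dot p v u"
    unfolding w_def H[symmetric] by (simp add: H_def dot_householder)
  then have "dot p (\<lambda>i. w i - 1 * v' i) u' = 0"
    unfolding dot_diff_scaled_left using eq by (simp add: dot_commute)
  then have K': "K u' = u'" unfolding K_def using uv
    by (intro householder_fixes) (auto simp: unit_sphere_iff)
  have m: "H \<in> uniform_sphere p \<rightarrow>\<^sub>M uniform_sphere p" "K \<in> uniform_sphere p \<rightarrow>\<^sub>M uniform_sphere p"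
    by (auto simp: H_def K_def)
  show ?thesis
  proof (rule that[of "K \<circ> H"])
    show "K \<circ> H \<in> uniform_sphere p \<rightarrow>\<^sub>M uniform_sphere p" using m by (rule measurable_comp)
    show "distr (uniform_sphere p) (uniform_sphere p) (K \<circ> H) = uniform_sphere p"
      unfolding distr_distr[OF m(2,1), symmetric] by (simp add: H_def K_def distr_uniform_sphere_householder)
  qed (simp_all add: H K' w_def[symmetric] K, simp add: H_def K_def dot_householder)
qed

text \<open>A rotation carrying \<open>(u, v)\<close> to \<open>(u', v')\<close> leaves the uniform
  law unchanged, so the joint law of two scalar products depends on the directions only through the
  angle between them.\<close>

lemma nn_integral_sphere_pair:
  fixes f :: "real \<times> real \<Rightarrow> ennreal"
  assumes [measurable]: "f \<in> borel_measurable (borel \<Otimes>\<^sub>M borel)"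
    and uv: "u \<in> unit_sphere p" "v \<in> unit_sphere p" "u' \<in> unit_sphere p" "v' \<in> unit_sphere p"
    and eq: "dot p u v = dot p u' v'"
  shows "(\<integral>\<^sup>+z. f (dot p z u, dot p z v) \<partial>uniform_sphere p) = (\<integral>\<^sup>+z. f (dot p z u', dot p z v') \<partial>uniform_sphere p)"
proof -
  obtain Q where Q [measurable]: "Q \<in> uniform_sphere p \<rightarrow>\<^sub>M uniform_sphere p"
    "distr (uniform_sphere p) (uniform_sphere p) Q = uniform_sphere p"
    "\<And>x y. dot p (Q x) (Q y) = dot p x y" "Q u = u'" "Q v = v'"
    using obtain_rotation[OF uv eq] by metis
  have "(\<integral>\<^sup>+z. f (dot p z u', dot p z v') \<partial>uniform_sphere p)
      = (\<integral>\<^sup>+z. f (dot p z u', dot p z v') \<partial>distr (uniform_sphere p) (uniform_sphere p) Q)"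
    by (simp add: Q)
  also have "\<dots> = (\<integral>\<^sup>+z. f (dot p (Q z) u', dot p (Q z) v') \<partial>uniform_sphere p)"
    by (subst nn_integral_distr) auto
  also have "\<dots> = (\<integral>\<^sup>+z. f (dot p z u, dot p z v) \<partial>uniform_sphere p)"
    unfolding Q(4,5)[symmetric] Q(3) ..
  finally show ?thesis ..
qed

definition plane_vector :: "nat \<Rightarrow> real \<Rightarrow> real \<Rightarrow> nat \<Rightarrow> real" where
  "plane_vector p a b = (\<lambda>i\<in>{..<p}. if i = 0 then a else if i = 1 then b else 0)"

lemma dot_plane_vector: "2 \<le> p \<Longrightarrow> dot p x (plane_vector p a b) = a * x 0 + b * x 1"
proof -
  assume p: "2 \<le> p"
  have "dot p x (plane_vector p a b) = (\<Sum>i\<in>{0,1}. x i * plane_vector p a b i)"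
    unfolding dot_def using p by (intro sum.mono_neutral_right) (auto simp: plane_vector_def)
  then show ?thesis using p by (simp add: plane_vector_def)
qed

lemma plane_vector_in_unit_sphere: "2 \<le> p \<Longrightarrow> a\<^sup>2 + b\<^sup>2 = 1 \<Longrightarrow> plane_vector p a b \<in> unit_sphere p"
  by (auto simp: unit_sphere_iff dot_plane_vector) (auto simp: plane_vector_def power2_eq_square)


lemma emeasure_Collect_eq_nn_integral:
  assumes "f \<in> M \<rightarrow>\<^sub>M N" "S \<in> sets N"
  shows "emeasure M {x \<in> space M. f x \<in> S} = (\<integral>\<^sup>+x. indicator S (f x) \<partial>M)"
proof -
  have "{x \<in> space M. f x \<in> S} \<in> sets M"
    using measurable_sets[OF assms] by (simp add: vimage_def Int_def conj_commute)
  then have "emeasure M {x \<in> space M. f x \<in> S} = (\<integral>\<^sup>+x. indicator {x \<in> space M. f x \<in> S} x \<partial>M)"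
    by simp
  also have "\<dots> = (\<integral>\<^sup>+x. indicator S (f x) \<partial>M)"
    by (intro nn_integral_cong) (auto split: split_indicator)
  finally show ?thesis .
qed

section \<open>Averaging out the location of the Watson distribution\<close>

locale sphere_dim =
  fixes p :: nat
  assumes p_ge_2: "2 \<le> p"
begin

abbreviation "\<sigma> \<equiv> uniform_sphere p"

sublocale prob_space \<sigma>
  using p_ge_2 by (intro prob_space_uniform_sphere) simp

sublocale sigma_pair: pair_sigma_finite \<sigma> \<sigma>
  by standard

lemma measurable_component [measurable]:
  "(\<lambda>z. z 0) \<in> borel_measurable \<sigma>" "(\<lambda>z. z (Suc 0)) \<in> borel_measurable \<sigma>"
  using p_ge_2 measurable_uniform_sphere_component[OF measurable_ident_sets[OF refl], of _ p] by auto

text \<open>Already for fixed \<open>x\<close> the inner integral is that of the first coordinate,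
  so the outer one runs over a constant.\<close>

lemma nn_integral_dot_dot:
  assumes [measurable]: "k \<in> borel_measurable borel"
  shows "(\<integral>\<^sup>+x. \<integral>\<^sup>+y. k (dot p x y) \<partial>\<sigma> \<partial>\<sigma>) = (\<integral>\<^sup>+z. k (z 0) \<partial>\<sigma>)"
proof -
  let ?e = "plane_vector p 1 0"
  have e: "?e \<in> unit_sphere p" using p_ge_2 by (simp add: plane_vector_in_unit_sphere)
  have "(\<integral>\<^sup>+y. k (dot p x y) \<partial>\<sigma>) = (\<integral>\<^sup>+z. k (z 0) \<partial>\<sigma>)" if "x \<in> space \<sigma>" for x
  proof -
    have x: "x \<in> unit_sphere p" using that by (simp add: space_uniform_sphere)
    have "(\<integral>\<^sup>+y. k (dot p x y) \<partial>\<sigma>) = (\<integral>\<^sup>+y. (k \<circ> fst) (dot p y x, dot p y x) \<partial>\<sigma>)"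
      by (simp add: dot_commute)
    also have "\<dots> = (\<integral>\<^sup>+y. (k \<circ> fst) (dot p y ?e, dot p y ?e) \<partial>\<sigma>)"
      using x e by (intro nn_integral_sphere_pair) (auto simp: unit_sphere_iff)
    also have "\<dots> = (\<integral>\<^sup>+y. k (y 0) \<partial>\<sigma>)"
      using p_ge_2 by (simp add: dot_plane_vector)
    finally show ?thesis .
  qed
  then show ?thesis by (simp add: emeasure_space_1 cong: nn_integral_cong)
qed

text \<open>The integral of \<open>e (dot p z x) * e (dot p z y)\<close> over \<open>z\<close>, as a function of \<open>w = dot p x y\<close>:
  \<open>x\<close> and \<open>y\<close> may be rotated to the plane vectors with coordinates
  \<open>sqrt ((1 + w) / 2)\<close> and \<open>\<plusminus> sqrt ((1 - w) / 2)\<close>.\<close>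

definition mixing :: "(real \<Rightarrow> ennreal) \<Rightarrow> real \<Rightarrow> ennreal" where
  "mixing e w = (\<integral>\<^sup>+z. e (sqrt ((1 + w) / 2) * z 0 + sqrt ((1 - w) / 2) * z 1)
                     * e (sqrt ((1 + w) / 2) * z 0 - sqrt ((1 - w) / 2) * z 1) \<partial>\<sigma>)"

lemma measurable_mixing [measurable]:
  assumes [measurable]: "e \<in> borel_measurable borel"
  shows "mixing e \<in> borel_measurable borel"
  unfolding mixing_def One_nat_def by measurable

lemma mixing_dot:
  assumes [measurable]: "e \<in> borel_measurable borel" and xy: "x \<in> unit_sphere p" "y \<in> unit_sphere p"
  shows "(\<integral>\<^sup>+z. e (dot p z x) * e (dot p z y) \<partial>\<sigma>) = mixing e (dot p x y)"
proof -
  define w where "w = dot p x y"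
  have w: "\<bar>w\<bar> \<le> 1" unfolding w_def using xy by (rule abs_dot_le_1)
  let ?a = "sqrt ((1 + w) / 2)" and ?b = "sqrt ((1 - w) / 2)"
  have ab: "?a\<^sup>2 = (1 + w) / 2" "?b\<^sup>2 = (1 - w) / 2" using w by auto
  let ?f = "\<lambda>(s, t). e s * e t"
  have "(\<integral>\<^sup>+z. ?f (dot p z x, dot p z y) \<partial>\<sigma>)
      = (\<integral>\<^sup>+z. ?f (dot p z (plane_vector p ?a ?b), dot p z (plane_vector p ?a (- ?b))) \<partial>\<sigma>)"
  proof (rule nn_integral_sphere_pair[OF _ xy])
    show "plane_vector p ?a ?b \<in> unit_sphere p" "plane_vector p ?a (- ?b) \<in> unit_sphere p"
      using p_ge_2 ab by (auto intro!: plane_vector_in_unit_sphere simp: power2_minus field_simps)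
    have "dot p (plane_vector p ?a ?b) (plane_vector p ?a (- ?b)) = ?a\<^sup>2 - ?b\<^sup>2"
      using p_ge_2 by (simp add: dot_plane_vector) (simp add: plane_vector_def power2_eq_square)
    also have "\<dots> = w" unfolding ab by (simp add: field_simps)
    finally show "dot p x y = dot p (plane_vector p ?a ?b) (plane_vector p ?a (- ?b))"
      by (simp add: w_def)
  qed measurable
  then show ?thesis
    unfolding w_def[symmetric] mixing_def using p_ge_2 by (simp add: dot_plane_vector)
qed

text \<open>The left side is constant in \<theta>, since one rotation can be applied to
  \<open>x\<close> and \<open>y\<close> together. It therefore equals its average over uniform
  \<theta>, and once Fubini has moved that average inside, only \<open>mixing\<close> at
  \<open>dot p x y\<close> remains.\<close>

lemma nn_integral_tilted_dot:
  assumes [measurable]: "h \<in> borel_measurable borel" "e \<in> borel_measurable borel"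
    and \<theta>: "\<theta> \<in> unit_sphere p"
  shows "(\<integral>\<^sup>+x. \<integral>\<^sup>+y. h (dot p x y) * (e (dot p x \<theta>) * e (dot p y \<theta>)) \<partial>\<sigma> \<partial>\<sigma>)
       = (\<integral>\<^sup>+z. h (z 0) * mixing e (z 0) \<partial>\<sigma>)"
proof -
  define \<Psi> where "\<Psi> \<theta> x y = h (dot p x y) * (e (dot p x \<theta>) * e (dot p y \<theta>))" for \<theta> x y
  define I where "I \<theta> = (\<integral>\<^sup>+x. \<integral>\<^sup>+y. \<Psi> \<theta> x y \<partial>\<sigma> \<partial>\<sigma>)" for \<theta>
  have [measurable]: "(\<lambda>x. \<Psi> (f x) (g x) (k x)) \<in> borel_measurable M"
    if [measurable]: "f \<in> M \<rightarrow>\<^sub>M \<sigma>" "g \<in> M \<rightarrow>\<^sub>M \<sigma>" "k \<in> M \<rightarrow>\<^sub>M \<sigma>" for f g k and M :: "'z measure"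
    unfolding \<Psi>_def by measurable
  have I_const: "I \<theta>' = I \<theta>" if \<theta>': "\<theta>' \<in> unit_sphere p" for \<theta>'
  proof -
    obtain Q where Q [measurable]: "Q \<in> \<sigma> \<rightarrow>\<^sub>M \<sigma>" "distr \<sigma> \<sigma> Q = \<sigma>"
      "\<And>x y. dot p (Q x) (Q y) = dot p x y" "Q \<theta>' = \<theta>"
      using obtain_rotation[of \<theta>' p \<theta>' \<theta> \<theta>] \<theta> \<theta>' by (metis unit_sphere_iff)
    have [measurable]: "\<theta> \<in> space \<sigma>" "\<theta>' \<in> space \<sigma>" using \<theta> \<theta>' by (auto simp: space_uniform_sphere)
    have Q_int: "(\<integral>\<^sup>+x. f x \<partial>\<sigma>) = (\<integral>\<^sup>+x. f (Q x) \<partial>\<sigma>)" if "f \<in> borel_measurable \<sigma>" for f :: "_ \<Rightarrow> ennreal"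
      using nn_integral_distr[OF Q(1), of f] that by (simp add: Q)
    have "I \<theta> = (\<integral>\<^sup>+x. \<integral>\<^sup>+y. \<Psi> \<theta> x (Q y) \<partial>\<sigma> \<partial>\<sigma>)"
      unfolding I_def by (intro nn_integral_cong Q_int) measurable
    also have "\<dots> = (\<integral>\<^sup>+x. \<integral>\<^sup>+y. \<Psi> \<theta> (Q x) (Q y) \<partial>\<sigma> \<partial>\<sigma>)"
      by (intro Q_int) measurable
    also have "\<dots> = I \<theta>'"
      unfolding I_def \<Psi>_def Q(3) Q(4)[symmetric] ..
    finally show ?thesis ..
  qed
  have "I \<theta> = (\<integral>\<^sup>+\<theta>'. I \<theta>' \<partial>\<sigma>)"
  proof -
    have "(\<integral>\<^sup>+\<theta>'. I \<theta>' \<partial>\<sigma>) = (\<integral>\<^sup>+\<theta>'. I \<theta> \<partial>\<sigma>)"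
      by (intro nn_integral_cong I_const) (simp add: space_uniform_sphere)
    then show ?thesis by (simp add: emeasure_space_1)
  qed
  also have "\<dots> = (\<integral>\<^sup>+x. \<integral>\<^sup>+\<theta>'. \<integral>\<^sup>+y. \<Psi> \<theta>' x y \<partial>\<sigma> \<partial>\<sigma> \<partial>\<sigma>)"
    unfolding I_def by (rule sigma_pair.Fubini') measurable
  also have "\<dots> = (\<integral>\<^sup>+x. \<integral>\<^sup>+y. \<integral>\<^sup>+\<theta>'. \<Psi> \<theta>' x y \<partial>\<sigma> \<partial>\<sigma> \<partial>\<sigma>)"
    by (intro nn_integral_cong sigma_pair.Fubini') measurable
  also have "\<dots> = (\<integral>\<^sup>+x. \<integral>\<^sup>+y. h (dot p x y) * mixing e (dot p x y) \<partial>\<sigma> \<partial>\<sigma>)"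
  proof (intro nn_integral_cong)
    fix x y assume [measurable]: "x \<in> space \<sigma>" "y \<in> space \<sigma>"
    then have xy: "x \<in> unit_sphere p" "y \<in> unit_sphere p" by (auto simp: space_uniform_sphere)
    have "(\<integral>\<^sup>+\<theta>'. \<Psi> \<theta>' x y \<partial>\<sigma>) = h (dot p x y) * (\<integral>\<^sup>+\<theta>'. e (dot p \<theta>' x) * e (dot p \<theta>' y) \<partial>\<sigma>)"
      unfolding \<Psi>_def by (subst nn_integral_cmult[symmetric]) (auto simp: dot_commute)
    then show "(\<integral>\<^sup>+\<theta>'. \<Psi> \<theta>' x y \<partial>\<sigma>) = h (dot p x y) * mixing e (dot p x y)"
      using xy by (simp add: mixing_dot)
  qed
  also have "\<dots> = (\<integral>\<^sup>+z. h (z 0) * mixing e (z 0) \<partial>\<sigma>)"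
    by (rule nn_integral_dot_dot) measurable
  finally show ?thesis unfolding I_def \<Psi>_def .
qed


lemma prob_uniform_dot:
  assumes [measurable]: "S \<in> sets borel"
  shows "\<P>(z in \<sigma> \<Otimes>\<^sub>M \<sigma>. dot p (fst z) (snd z) \<in> S) = \<P>(z in \<sigma>. z 0 \<in> S)"
proof -
  have "emeasure (\<sigma> \<Otimes>\<^sub>M \<sigma>) {z \<in> space (\<sigma> \<Otimes>\<^sub>M \<sigma>). dot p (fst z) (snd z) \<in> S}
      = (\<integral>\<^sup>+z. indicator S (dot p (fst z) (snd z)) \<partial>(\<sigma> \<Otimes>\<^sub>M \<sigma>))"
    by (rule emeasure_Collect_eq_nn_integral) measurable
  also have "\<dots> = (\<integral>\<^sup>+x. \<integral>\<^sup>+y. indicator S (dot p x y) \<partial>\<sigma> \<partial>\<sigma>)"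
    by (subst nn_integral_fst[symmetric]) auto
  also have "\<dots> = (\<integral>\<^sup>+z. indicator S (z 0) \<partial>\<sigma>)"
    by (rule nn_integral_dot_dot) auto
  also have "\<dots> = emeasure \<sigma> {z \<in> space \<sigma>. z 0 \<in> S}"
    by (rule emeasure_Collect_eq_nn_integral[symmetric]) measurable
  finally show ?thesis by (simp add: measure_def)
qed

lemma coords_in_disc: "z \<in> space \<sigma> \<Longrightarrow> (z 0)\<^sup>2 + (z 1)\<^sup>2 \<le> 1"
proof -
  assume "z \<in> space \<sigma>"
  then have "(\<Sum>i<p. (z i)\<^sup>2) = 1"
    by (simp add: space_uniform_sphere unit_sphere_iff dot_def power2_eq_square)
  moreover have "(\<Sum>i\<in>{0,1}. (z i)\<^sup>2) \<le> (\<Sum>i<p. (z i)\<^sup>2)"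
    using p_ge_2 by (intro sum_mono2) auto
  ultimately show ?thesis by simp
qed

lemma abs_coord_le_1: "z \<in> space \<sigma> \<Longrightarrow> \<bar>z 0\<bar> \<le> 1"
  using coords_in_disc[of z] by (simp add: abs_square_le_1[symmetric]) (smt (verit) zero_le_power2)

text \<open>The substitution is a reflection of the coordinate plane. It is used with
  \<open>a = 0\<close>, \<open>b = 1\<close>, which exchanges the coordinates, and with both equal
  to \<open>1 / sqrt 2\<close>, which turns the difference of the squared coordinates into twice
  their product.\<close>

lemma integral_rotate_coords:
  fixes f :: "real \<Rightarrow> real \<Rightarrow> real"
  assumes ab: "a\<^sup>2 + b\<^sup>2 = 1" and f [measurable]: "case_prod f \<in> borel_measurable (borel \<Otimes>\<^sub>M borel)"
  shows "(LINT z|\<sigma>. f (z 0) (z 1)) = (LINT z|\<sigma>. f (a * z 0 + b * z 1) (b * z 0 - a * z 1))"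
proof -
  let ?X = "\<lambda>z::nat \<Rightarrow> real. (z 0, z (Suc 0))"
  let ?Y = "\<lambda>z::nat \<Rightarrow> real. (a * z 0 + b * z (Suc 0), b * z 0 - a * z (Suc 0))"
  have "distr \<sigma> (borel \<Otimes>\<^sub>M borel) ?X = distr \<sigma> (borel \<Otimes>\<^sub>M borel) ?Y" (is "?M = ?N")
  proof (rule measure_eqI)
    fix A assume "A \<in> sets ?M"
    then have A [measurable]: "A \<in> sets (borel \<Otimes>\<^sub>M borel)" by simp
    have "emeasure ?M A = (\<integral>\<^sup>+x. indicator A x \<partial>?M)" by simp
    also have "\<dots> = (\<integral>\<^sup>+z. indicator A (dot p z (plane_vector p 1 0), dot p z (plane_vector p 0 1)) \<partial>\<sigma>)"
      using p_ge_2 by (subst nn_integral_distr) (auto simp: dot_plane_vector)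
    also have "\<dots> = (\<integral>\<^sup>+z. indicator A (dot p z (plane_vector p a b), dot p z (plane_vector p b (- a))) \<partial>\<sigma>)"
      using p_ge_2 ab
      by (intro nn_integral_sphere_pair)
         (auto intro!: plane_vector_in_unit_sphere simp: dot_plane_vector, auto simp: plane_vector_def)
    also have "\<dots> = (\<integral>\<^sup>+x. indicator A x \<partial>?N)"
      using p_ge_2 by (subst nn_integral_distr) (auto simp: dot_plane_vector)
    also have "\<dots> = emeasure ?N A" by simp
    finally show "emeasure ?M A = emeasure ?N A" .
  qed simp
  then have "(LINT x|?M. case_prod f x) = (LINT x|?N. case_prod f x)" by simp
  then show ?thesis by (simp add: integral_distr)
qed

text \<open>Up to its normalising constant, the likelihood ratio of the scalar product at
  \<open>w\<close>. The hyperbolic cosine makes it visibly even in \<open>w\<close>.\<close>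

definition tilt :: "real \<Rightarrow> real \<Rightarrow> real" where
  "tilt \<kappa> w = (LINT z|\<sigma>. exp (\<kappa> * ((z 0)\<^sup>2 + (z 1)\<^sup>2)) * cosh (\<kappa> * w * ((z 0)\<^sup>2 - (z 1)\<^sup>2)))"

text \<open>The squares of the two linear forms add up to R + w D, with R and D the sum and the
  difference of the squared coordinates. Exchanging the coordinates changes the sign of D, so the
  integral with \<open>w\<close> equals that with \<open>- w\<close>; their mean gives the
  hyperbolic cosine.\<close>

lemma mixing_eq_tilt:
  assumes w: "\<bar>w\<bar> \<le> 1" and \<kappa>: "0 \<le> \<kappa>"
  shows "mixing (\<lambda>t. ennreal (exp (\<kappa> * t\<^sup>2))) w = ennreal (tilt \<kappa> w)"
proof -
  let ?R = "\<lambda>z::nat \<Rightarrow> real. (z 0)\<^sup>2 + (z 1)\<^sup>2" and ?D = "\<lambda>z::nat \<Rightarrow> real. (z 0)\<^sup>2 - (z 1)\<^sup>2"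
  have "(sqrt ((1 + w) / 2) * s + sqrt ((1 - w) / 2) * t)\<^sup>2 + (sqrt ((1 + w) / 2) * s - sqrt ((1 - w) / 2) * t)\<^sup>2
      = 2 * ((sqrt ((1 + w) / 2))\<^sup>2 * s\<^sup>2 + (sqrt ((1 - w) / 2))\<^sup>2 * t\<^sup>2)" for s t
    by (simp add: power2_eq_square algebra_simps)
  then have *: "(sqrt ((1 + w) / 2) * s + sqrt ((1 - w) / 2) * t)\<^sup>2 + (sqrt ((1 + w) / 2) * s - sqrt ((1 - w) / 2) * t)\<^sup>2
      = (s\<^sup>2 + t\<^sup>2) + w * (s\<^sup>2 - t\<^sup>2)" for s t
    using w by (simp add: algebra_simps add_divide_distrib diff_divide_distrib)
  have e: "ennreal (exp (\<kappa> * (sqrt ((1 + w) / 2) * s + sqrt ((1 - w) / 2) * t)\<^sup>2))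
      * ennreal (exp (\<kappa> * (sqrt ((1 + w) / 2) * s - sqrt ((1 - w) / 2) * t)\<^sup>2))
      = ennreal (exp (\<kappa> * (s\<^sup>2 + t\<^sup>2) + \<kappa> * w * (s\<^sup>2 - t\<^sup>2)))" for s t
  proof -
    have "exp (\<kappa> * (sqrt ((1 + w) / 2) * s + sqrt ((1 - w) / 2) * t)\<^sup>2)
        * exp (\<kappa> * (sqrt ((1 + w) / 2) * s - sqrt ((1 - w) / 2) * t)\<^sup>2)
        = exp (\<kappa> * ((s\<^sup>2 + t\<^sup>2) + w * (s\<^sup>2 - t\<^sup>2)))"
      unfolding *[symmetric] by (simp only: exp_add distrib_left)
    also have "\<kappa> * ((s\<^sup>2 + t\<^sup>2) + w * (s\<^sup>2 - t\<^sup>2)) = \<kappa> * (s\<^sup>2 + t\<^sup>2) + \<kappa> * w * (s\<^sup>2 - t\<^sup>2)"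
      by (simp only: distrib_left mult.assoc)
    finally show ?thesis by (subst ennreal_mult[symmetric]) simp_all
  qed
  have bound: "\<bar>\<kappa> * x * ?D z\<bar> \<le> \<kappa>" if "z \<in> space \<sigma>" "\<bar>x\<bar> \<le> 1" for z x
  proof -
    have "\<bar>?D z\<bar> \<le> 1"
      using coords_in_disc[OF that(1)] zero_le_power2[of "z 0"] zero_le_power2[of "z 1"] by linarith
    then have "\<bar>x * ?D z\<bar> \<le> 1 * 1"
      unfolding abs_mult using that by (intro mult_mono) auto
    then show ?thesis using \<kappa> by (simp add: abs_mult mult.assoc mult_left_le)
  qed
  have Rb: "\<kappa> * ?R z \<le> \<kappa>" if "z \<in> space \<sigma>" for z
    using coords_in_disc[OF that] \<kappa> by (simp add: mult_left_le)
  have int: "integrable \<sigma> (\<lambda>z. exp (\<kappa> * ?R z + \<kappa> * x * ?D z))" if x: "\<bar>x\<bar> \<le> 1" for x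
  proof (rule integrable_const_bound[where B="exp (2 * \<kappa>)"])
    show "AE z in \<sigma>. norm (exp (\<kappa> * ?R z + \<kappa> * x * ?D z)) \<le> exp (2 * \<kappa>)"
      using bound[OF _ x] Rb by (intro AE_I2) (fastforce simp: abs_le_iff)
  qed simp
  let ?E = "\<lambda>x. LINT z|\<sigma>. exp (\<kappa> * ?R z + \<kappa> * x * ?D z)"
  have swap: "?E w = ?E (- w)"
    by (subst integral_rotate_coords[of 0 1 "\<lambda>s t. exp (\<kappa> * (s\<^sup>2 + t\<^sup>2) + \<kappa> * w * (s\<^sup>2 - t\<^sup>2))"])
       (auto simp: algebra_simps)
  have "tilt \<kappa> w = (LINT z|\<sigma>. (exp (\<kappa> * ?R z + \<kappa> * w * ?D z) + exp (\<kappa> * ?R z + \<kappa> * (- w) * ?D z)) / 2)"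
  proof -
    have "exp a * cosh b = (exp (a + b) + exp (a + - b)) / 2" for a b :: real
      unfolding exp_add cosh_def by (simp add: field_simps)
    note * = this
    show ?thesis unfolding tilt_def * by simp
  qed
  also have "\<dots> = (?E w + ?E (- w)) / 2"
    using int[of w] int[of "- w"] w by (subst integral_divide_zero, subst Bochner_Integration.integral_add) auto
  also have "\<dots> = ?E w" using swap by simp
  finally have t: "tilt \<kappa> w = ?E w" .
  show ?thesis unfolding mixing_def e t
    using int[OF w] by (intro nn_integral_eq_integral) auto
qed

lemma prob_watson_dot:
  assumes \<kappa>: "0 \<le> \<kappa>" and \<theta>: "\<theta> \<in> unit_sphere p" and S [measurable]: "S \<in> sets borel"
  shows "\<P>(z in watson p \<kappa> \<theta> \<Otimes>\<^sub>M watson p \<kappa> \<theta>. dot p (fst z) (snd z) \<in> S)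
       = (LINT z|\<sigma>. indicator S (z 0) * tilt \<kappa> (z 0)) / (LINT z|\<sigma>. tilt \<kappa> (z 0))"
proof -
  let ?\<mu> = "watson p \<kappa> \<theta>"
  interpret \<mu>: prob_space ?\<mu>
    using p_ge_2 \<kappa> \<theta> by (intro prob_space_watson) auto
  interpret \<mu>\<mu>: pair_prob_space ?\<mu> ?\<mu> by standard
  define c where "c = inverse (LINT y|\<sigma>. exp (\<kappa> * (dot p y \<theta>)\<^sup>2))"
  define e where "e t = ennreal (exp (\<kappa> * t\<^sup>2))" for t :: real
  have [measurable]: "e \<in> borel_measurable borel" unfolding e_def by measurable
  have [measurable]: "\<theta> \<in> space \<sigma>" using \<theta> by (simp add: space_uniform_sphere)
  have c: "0 \<le> c" unfolding c_def by simp
  have \<mu>: "?\<mu> = density \<sigma> (\<lambda>x. ennreal c * e (dot p x \<theta>))"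
    unfolding watson_def c_def[symmetric] divide_inverse e_def using c
    by (subst ennreal_mult[symmetric]) (auto simp: mult.commute)
  have sets_\<mu> [measurable_cong]: "sets ?\<mu> = sets \<sigma>" by (simp add: watson_def)
  have emeasure_eq: "emeasure (?\<mu> \<Otimes>\<^sub>M ?\<mu>) {z \<in> space (?\<mu> \<Otimes>\<^sub>M ?\<mu>). dot p (fst z) (snd z) \<in> S}
      = ennreal c * (ennreal c * (\<integral>\<^sup>+z. indicator S (z 0) * mixing e (z 0) \<partial>\<sigma>))"
    if [measurable]: "S \<in> sets borel" for S
  proof -
    have "emeasure (?\<mu> \<Otimes>\<^sub>M ?\<mu>) {z \<in> space (?\<mu> \<Otimes>\<^sub>M ?\<mu>). dot p (fst z) (snd z) \<in> S}
      = (\<integral>\<^sup>+z. indicator S (dot p (fst z) (snd z)) \<partial>(?\<mu> \<Otimes>\<^sub>M ?\<mu>))"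
      by (rule emeasure_Collect_eq_nn_integral) measurable
    also have "\<dots> = (\<integral>\<^sup>+x. \<integral>\<^sup>+y. indicator S (dot p x y) \<partial>?\<mu> \<partial>?\<mu>)"
      by (subst \<mu>.nn_integral_fst[symmetric]) auto
    also have "\<dots> = (\<integral>\<^sup>+x. (ennreal c * e (dot p x \<theta>)) *
        (\<integral>\<^sup>+y. (ennreal c * e (dot p y \<theta>)) * indicator S (dot p x y) \<partial>\<sigma>) \<partial>\<sigma>)"
    proof -
      have "(\<integral>\<^sup>+y. indicator S (dot p x y) \<partial>?\<mu>)
          = (\<integral>\<^sup>+y. (ennreal c * e (dot p y \<theta>)) * indicator S (dot p x y) \<partial>\<sigma>)" if [measurable]: "x \<in> space \<sigma>" for x
        unfolding \<mu> by (subst nn_integral_density) auto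
      then have "(\<integral>\<^sup>+x. \<integral>\<^sup>+y. indicator S (dot p x y) \<partial>?\<mu> \<partial>?\<mu>)
          = (\<integral>\<^sup>+x. \<integral>\<^sup>+y. (ennreal c * e (dot p y \<theta>)) * indicator S (dot p x y) \<partial>\<sigma> \<partial>?\<mu>)"
        by (intro nn_integral_cong) (simp add: sets_eq_imp_space_eq[OF sets_\<mu>])
      then show ?thesis unfolding \<mu> by (simp add: nn_integral_density)
    qed
    also have "\<dots> = (\<integral>\<^sup>+x. ennreal c * (ennreal c *
        (\<integral>\<^sup>+y. indicator S (dot p x y) * (e (dot p x \<theta>) * e (dot p y \<theta>)) \<partial>\<sigma>)) \<partial>\<sigma>)"
      by (intro nn_integral_cong) (simp flip: nn_integral_cmult add: ac_simps)
    also have "\<dots> = ennreal c * (ennreal c *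
        (\<integral>\<^sup>+x. \<integral>\<^sup>+y. indicator S (dot p x y) * (e (dot p x \<theta>) * e (dot p y \<theta>)) \<partial>\<sigma> \<partial>\<sigma>))"
      by (simp add: nn_integral_cmult)
    also have "\<dots> = ennreal c * (ennreal c * (\<integral>\<^sup>+z. indicator S (z 0) * mixing e (z 0) \<partial>\<sigma>))"
      by (subst nn_integral_tilted_dot) (use \<theta> in auto)
    finally show ?thesis .
  qed
  have tilt_nonneg: "0 \<le> tilt \<kappa> w" for w
    unfolding tilt_def by (intro Bochner_Integration.integral_nonneg) (simp add: cosh_def)
  have [measurable]: "tilt \<kappa> \<in> borel_measurable borel"
    unfolding tilt_def One_nat_def cosh_def by measurable
  have tilt_le: "tilt \<kappa> w \<le> exp \<kappa> * exp \<kappa>" if "\<bar>w\<bar> \<le> 1" for w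
  proof -
    have "mixing e w \<le> (\<integral>\<^sup>+z. ennreal (exp \<kappa> * exp \<kappa>) \<partial>\<sigma>)"
      unfolding mixing_def
    proof (intro nn_integral_mono)
      fix z assume z: "z \<in> space \<sigma>"
      let ?s = "sqrt ((1 + w) / 2)" and ?t = "sqrt ((1 - w) / 2)"
      have st: "?s\<^sup>2 + ?t\<^sup>2 = 1" using that by (simp add: field_simps)
      \<comment> \<open>The second linear form completes the first to a rotated pair of coordinates,
        so each square is at most \<open>(z 0)\<^sup>2 + (z 1)\<^sup>2\<close>.\<close>
      have "(?s * z 0 + ?t * z 1)\<^sup>2 + (?t * z 0 - ?s * z 1)\<^sup>2 = (?s\<^sup>2 + ?t\<^sup>2) * ((z 0)\<^sup>2 + (z 1)\<^sup>2)"
        "(?s * z 0 - ?t * z 1)\<^sup>2 + (?t * z 0 + ?s * z 1)\<^sup>2 = (?s\<^sup>2 + ?t\<^sup>2) * ((z 0)\<^sup>2 + (z 1)\<^sup>2)"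
        by (simp_all only: power2_eq_square algebra_simps)
      note * = this[unfolded st mult_1]
      have "(?s * z 0 + ?t * z 1)\<^sup>2 \<le> 1"
        using *(1) coords_in_disc[OF z] zero_le_power2[of "?t * z 0 - ?s * z 1"] by linarith
      moreover have "(?s * z 0 - ?t * z 1)\<^sup>2 \<le> 1"
        using *(2) coords_in_disc[OF z] zero_le_power2[of "?t * z 0 + ?s * z 1"] by linarith
      ultimately show "e (?s * z 0 + ?t * z 1) * e (?s * z 0 - ?t * z 1) \<le> ennreal (exp \<kappa> * exp \<kappa>)"
        unfolding e_def using \<kappa>
        by (subst ennreal_mult[symmetric]) (auto intro!: ennreal_leI mult_mono simp: mult_left_le)
    qed
    then have "ennreal (tilt \<kappa> w) \<le> ennreal (exp \<kappa> * exp \<kappa>)"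
      using mixing_eq_tilt[OF that \<kappa>] by (simp add: e_def[abs_def] emeasure_space_1)
    then show ?thesis by simp
  qed
  have int: "integrable \<sigma> (\<lambda>z. indicator S (z 0) * tilt \<kappa> (z 0))" if [measurable]: "S \<in> sets borel" for S
    by (rule integrable_const_bound[where B="exp \<kappa> * exp \<kappa>"])
       (use tilt_le abs_coord_le_1 tilt_nonneg in \<open>auto intro!: AE_I2 split: split_indicator\<close>)
  have prob_eq: "\<P>(z in ?\<mu> \<Otimes>\<^sub>M ?\<mu>. dot p (fst z) (snd z) \<in> S)
      = c * (c * (LINT z|\<sigma>. indicator S (z 0) * tilt \<kappa> (z 0)))" if [measurable]: "S \<in> sets borel" for S
  proof -
    have "(\<integral>\<^sup>+z. indicator S (z 0) * mixing e (z 0) \<partial>\<sigma>)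
        = (\<integral>\<^sup>+z. ennreal (indicator S (z 0) * tilt \<kappa> (z 0)) \<partial>\<sigma>)"
      using abs_coord_le_1 mixing_eq_tilt[OF _ \<kappa>] tilt_nonneg
      by (intro nn_integral_cong) (auto simp: e_def[abs_def] split: split_indicator)
    also have "\<dots> = ennreal (LINT z|\<sigma>. indicator S (z 0) * tilt \<kappa> (z 0))"
      using int[OF that] tilt_nonneg by (intro nn_integral_eq_integral) auto
    finally have "emeasure (?\<mu> \<Otimes>\<^sub>M ?\<mu>) {z \<in> space (?\<mu> \<Otimes>\<^sub>M ?\<mu>). dot p (fst z) (snd z) \<in> S}
        = ennreal (c * (c * (LINT z|\<sigma>. indicator S (z 0) * tilt \<kappa> (z 0))))"
      using c tilt_nonneg by (simp add: emeasure_eq[OF that] ennreal_mult Bochner_Integration.integral_nonneg)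
    then show ?thesis
      using c tilt_nonneg by (simp add: measure_def Bochner_Integration.integral_nonneg)
  qed
  \<comment> \<open>The normalising constant of the Watson density is never evaluated: the case
    \<open>S = UNIV\<close> has probability one and determines \<open>c * c\<close>.\<close>
  have "c * (c * (LINT z|\<sigma>. tilt \<kappa> (z 0))) = 1"
    using prob_eq[of UNIV] \<mu>\<mu>.prob_space by simp
  moreover from this have "(LINT z|\<sigma>. tilt \<kappa> (z 0)) \<noteq> 0" by auto
  ultimately have "c * c = inverse (LINT z|\<sigma>. tilt \<kappa> (z 0))" by (simp add: field_simps)
  then show ?thesis by (simp add: prob_eq[OF S] divide_inverse mult.assoc[symmetric] mult.commute)
qed

end

section \<open>The law of one coordinate\<close>

lemma nn_integral_scale:
  fixes g :: "(nat \<Rightarrow> real) \<Rightarrow> ennreal"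
  assumes I: "finite I" and S: "S \<subseteq> I" and c: "0 < c"
    and g: "g \<in> borel_measurable (lebesgue_on_coords I)"
  shows "(\<integral>\<^sup>+x. g x \<partial>lebesgue_on_coords I)
       = ennreal (c ^ card S) * (\<integral>\<^sup>+x. g (\<lambda>j. if j \<in> S then c * x j else x j) \<partial>lebesgue_on_coords I)"
proof -
  have "finite S" using I S finite_subset by blast
  then show ?thesis using S
  proof (induction S)
    case empty then show ?case by simp
  next
    case (insert i S)
    let ?T = "\<lambda>S x. (\<lambda>j. if j \<in> S then c * x j else x j)"
    have i: "i \<in> I" "i \<notin> S" using insert by auto
    have T: "?T S \<in> lebesgue_on_coords I \<rightarrow>\<^sub>M lebesgue_on_coords I"
    proof (rule measurable_coords_into)
      fix j assume "j \<in> I"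
      then have "(\<lambda>x. x j) \<in> borel_measurable (lebesgue_on_coords I)"
        using measurable_component_singleton[of j I "\<lambda>_. lborel"] by simp
      then show "(\<lambda>x. ?T S x j) \<in> borel_measurable (lebesgue_on_coords I)"
        by (cases "j \<in> S") auto
    next
      fix x assume "x \<in> space (lebesgue_on_coords I)"
      then show "?T S x \<in> extensional I"
        using insert.prems by (auto simp: space_PiM PiE_def extensional_def)
    qed
    have "(\<integral>\<^sup>+x. g x \<partial>lebesgue_on_coords I) = ennreal (c ^ card S) * (\<integral>\<^sup>+x. g (?T S x) \<partial>lebesgue_on_coords I)"
      using insert by simp
    also have "(\<integral>\<^sup>+x. g (?T S x) \<partial>lebesgue_on_coords I)
        = ennreal c * (\<integral>\<^sup>+x. g (?T S (x(i := 0 + c * x i))) \<partial>lebesgue_on_coords I)"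
      using nn_integral_coord_affine[OF I i(1), of c "\<lambda>_. 0" "\<lambda>x. g (?T S x)"] measurable_compose[OF T g] c
      by simp
    also have "(\<integral>\<^sup>+x. g (?T S (x(i := 0 + c * x i))) \<partial>lebesgue_on_coords I)
        = (\<integral>\<^sup>+x. g (?T (insert i S) x) \<partial>lebesgue_on_coords I)"
      using i by (intro nn_integral_cong arg_cong[where f=g]) (auto simp: fun_eq_iff)
    finally show ?case
      using insert c by (simp add: ennreal_mult mult.assoc[symmetric] mult.commute)
  qed
qed

lemma nn_integral_scale_all:
  fixes g :: "(nat \<Rightarrow> real) \<Rightarrow> ennreal"
  assumes I: "finite I" and c: "0 < c" and g: "g \<in> borel_measurable (lebesgue_on_coords I)"
  shows "(\<integral>\<^sup>+x. g x \<partial>lebesgue_on_coords I)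
       = ennreal (c ^ card I) * (\<integral>\<^sup>+x. g (\<lambda>j\<in>I. c * x j) \<partial>lebesgue_on_coords I)"
proof -
  have "(\<integral>\<^sup>+x. g (\<lambda>j. if j \<in> I then c * x j else x j) \<partial>lebesgue_on_coords I)
      = (\<integral>\<^sup>+x. g (\<lambda>j\<in>I. c * x j) \<partial>lebesgue_on_coords I)"
    by (intro nn_integral_cong arg_cong[where f=g]) (auto simp: space_PiM PiE_def extensional_def fun_eq_iff)
  then show ?thesis by (subst nn_integral_scale[OF I subset_refl c g]) simp
qed

text \<open>Discards the slices of radius zero, on which a substitution by the radius would break
  down.\<close>

lemma AE_sum_squares_pos:
  assumes "finite I" "I \<noteq> {}"
  shows "AE x in lebesgue_on_coords I. 0 < (\<Sum>i\<in>I. (x i)\<^sup>2)"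
proof -
  have "emeasure (lebesgue_on_coords I) (\<Pi>\<^sub>E i\<in>I. {0}) = 0"
    using assms by (subst lborel_prod.emeasure_PiM) (auto simp: card_gt_0_iff)
  then have "AE x in lebesgue_on_coords I. x \<notin> (\<Pi>\<^sub>E i\<in>I. {0})"
    using assms by (intro AE_not_in null_setsI sets_PiM_I_finite) auto
  moreover have "AE x in lebesgue_on_coords I. x \<in> space (lebesgue_on_coords I)" by (rule AE_space)
  ultimately show ?thesis
  proof eventually_elim
    case (elim x)
    then obtain i where "i \<in> I" "x i \<noteq> 0"
      unfolding space_PiM PiE_iff by auto
    then have "(\<Sum>i\<in>I. (x i)\<^sup>2) \<noteq> 0" using assms by (auto simp: sum_nonneg_eq_0_iff)
    moreover have "0 \<le> (\<Sum>i\<in>I. (x i)\<^sup>2)" by (intro sum_nonneg) auto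
    ultimately show ?case by simp
  qed
qed

text \<open>In the coordinate \<open>s = w / sqrt (1 - w\<^sup>2)\<close> the density of a coordinate of a uniform point
  is proportional to a power of \<open>cos_of_tan s = sqrt (1 - w\<^sup>2)\<close>.\<close>

definition cos_of_tan :: "real \<Rightarrow> real" where
  "cos_of_tan s = 1 / sqrt (1 + s\<^sup>2)"

lemma measurable_cos_of_tan [measurable]: "cos_of_tan \<in> borel_measurable borel"
  unfolding cos_of_tan_def by measurable

lemma one_plus_square_pos: "0 < 1 + (s::real)\<^sup>2"
  by (rule add_pos_nonneg) auto

lemma cos_of_tan_pos: "0 < cos_of_tan s"
  using one_plus_square_pos by (simp add: cos_of_tan_def)

lemma cos_of_tan_le_1: "cos_of_tan s \<le> 1"
  using one_plus_square_pos[of s] by (simp add: cos_of_tan_def pos_divide_le_eq real_le_rsqrt)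

lemma cos_of_tan_square: "(cos_of_tan s)\<^sup>2 = 1 / (1 + s\<^sup>2)"
  using one_plus_square_pos[of s] by (simp add: cos_of_tan_def power_divide)

lemma sin_of_tan_square: "(s * cos_of_tan s)\<^sup>2 = 1 - (cos_of_tan s)\<^sup>2"
  using one_plus_square_pos[of s] by (simp add: cos_of_tan_square power_mult_distrib field_simps)

lemma normalise_in_unit_sphere:
  "normalise p x \<in> unit_sphere p \<longleftrightarrow> 0 < (\<Sum>i<p. (x i)\<^sup>2)"
proof -
  have nn: "0 \<le> (\<Sum>i<p. (x i)\<^sup>2)" by (intro sum_nonneg) auto
  have "dot p (normalise p x) (normalise p x) = (\<Sum>i<p. (x i / L2_set x {..<p})\<^sup>2)"
    by (simp add: dot_def normalise_def power2_eq_square)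
  also have "\<dots> = (\<Sum>i<p. (x i)\<^sup>2) / (\<Sum>i<p. (x i)\<^sup>2)"
    unfolding power_divide sum_divide_distrib[symmetric] using nn by (simp add: L2_set_def)
  finally show ?thesis
    using nn by (auto simp: unit_sphere_iff normalise_def)
qed

text \<open>Let r be the norm of the coordinates other than the first. The substitution x 0 = r s
  makes the normalised coordinate \<open>s * cos_of_tan s\<close>, independent of r, and turns the
  ball into the condition r \<le> \<open>cos_of_tan s\<close>. After Fubini the integral over the
  other coordinates is homogeneous in \<open>cos_of_tan s\<close>, which gives the power; the
  constant is left open and later fixed by total mass one.\<close>

lemma nn_integral_sphere_slice:
  assumes p: "2 \<le> p"
  shows "\<exists>K. \<forall>F \<in> borel_measurable borel. (\<integral>\<^sup>+z. F (z 0) \<partial>uniform_sphere p)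
        = K * (\<integral>\<^sup>+s. F (s * cos_of_tan s) * ennreal (cos_of_tan s ^ p) \<partial>lborel)"
proof (intro exI ballI)
  fix F :: "real \<Rightarrow> ennreal" assume F [measurable]: "F \<in> borel_measurable borel"
  define J where "J = {1..<p}"
  have J: "finite J" "0 \<notin> J" "{..<p} = insert 0 J" "J \<noteq> {}" "card J = p - 1" using p by (auto simp: J_def)
  let ?L = "lebesgue_on_coords {..<p}" and ?LJ = "lebesgue_on_coords J"
  define N where "N x = (\<Sum>i\<in>J. (x i)\<^sup>2)" for x :: "nat \<Rightarrow> real"
  have xm: "(\<lambda>x. x j) \<in> borel_measurable (lebesgue_on_coords I)" if "j \<in> I" for j I
    using measurable_component_singleton[of j I "\<lambda>_. lborel"] that by simp
  have Nm: "N \<in> borel_measurable (lebesgue_on_coords I)" if "J \<subseteq> I" for I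
    unfolding N_def using that by (intro borel_measurable_sum borel_measurable_power xm) auto
  note [measurable] = Nm[OF subset_refl]
  have N_nn: "0 \<le> N x" for x unfolding N_def by (intro sum_nonneg) auto
  define f :: "real \<Rightarrow> real \<Rightarrow> ennreal" where
    "f y n = F (y / sqrt (y\<^sup>2 + n)) * indicator {0<..1} (y\<^sup>2 + n)" for y n
  have [measurable]: "case_prod f \<in> borel_measurable (borel \<Otimes>\<^sub>M borel)"
    unfolding f_def by measurable
  have f_m: "(\<lambda>s. f (r * s) n) \<in> borel_measurable lborel" for r n by measurable
  have sum_split: "(\<Sum>i<p. (x i)\<^sup>2) = (x 0)\<^sup>2 + N x" for x :: "nat \<Rightarrow> real"
    unfolding N_def J(3) using J by simp
  have z0: "(\<lambda>z. z 0) \<in> borel_measurable (\<Pi>\<^sub>M i\<in>{..<p}. borel)" using p by simp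
  \<comment> \<open>\<open>H\<close> collects the integral over the other p - 1 coordinates. The
    factor \<open>sqrt (N x)\<close> is the Jacobian of the substitution and raises the degree of
    homogeneity from p - 1 to p.\<close>
  define H :: "real \<Rightarrow> ennreal" where
    "H c = (\<integral>\<^sup>+x. ennreal (sqrt (N x)) * indicator {..c} (sqrt (N x)) \<partial>?LJ)" for c
  have H: "H c = ennreal (c ^ p) * H 1" if c: "0 < c" for c
  proof -
    have Nc: "sqrt (N (\<lambda>j\<in>J. c * x j)) = c * sqrt (N x)" for x
    proof -
      have "N (\<lambda>j\<in>J. c * x j) = c\<^sup>2 * N x"
        by (simp add: N_def sum_distrib_left power_mult_distrib)
      then show ?thesis using c by (simp add: real_sqrt_mult)
    qed
    have "H c = ennreal (c ^ card J) *
        (\<integral>\<^sup>+x. ennreal (c * sqrt (N x)) * indicator {..c} (c * sqrt (N x)) \<partial>?LJ)"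
      unfolding H_def by (subst nn_integral_scale_all[OF J(1) c]) (simp_all add: Nc)
    also have "(\<integral>\<^sup>+x. ennreal (c * sqrt (N x)) * indicator {..c} (c * sqrt (N x)) \<partial>?LJ)
        = (\<integral>\<^sup>+x. ennreal c * (ennreal (sqrt (N x)) * indicator {..1} (sqrt (N x))) \<partial>?LJ)"
      using c N_nn by (intro nn_integral_cong) (auto simp: ennreal_mult mult.assoc split: split_indicator)
    also have "\<dots> = ennreal c * H 1"
      unfolding H_def by (rule nn_integral_cmult) measurable
    finally show ?thesis
      using c p by (simp add: J(5) mult.assoc[symmetric] ennreal_mult[symmetric] power_Suc2[symmetric] del: power_Suc)
  qed
  have "(\<integral>\<^sup>+x. F (normalise p x 0) * indicator (unit_sphere p) (normalise p x) * indicator (unit_ball p) x \<partial>?L)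
      = (\<integral>\<^sup>+x. f (x 0) (N x) \<partial>?L)"
  proof (intro nn_integral_cong)
    fix x assume "x \<in> space ?L"
    then have "x \<in> extensional {..<p}" by (simp add: space_PiM PiE_def)
    then have "x \<in> unit_ball p \<longleftrightarrow> (x 0)\<^sup>2 + N x \<le> 1"
      by (simp add: unit_ball_def PiE_def L2_set_def sum_split)
    moreover have "normalise p x 0 = x 0 / sqrt ((x 0)\<^sup>2 + N x)"
      using p by (simp add: normalise_def L2_set_def sum_split)
    moreover have "normalise p x \<in> unit_sphere p \<longleftrightarrow> 0 < (x 0)\<^sup>2 + N x"
      by (simp add: normalise_in_unit_sphere sum_split)
    ultimately show "F (normalise p x 0) * indicator (unit_sphere p) (normalise p x) * indicator (unit_ball p) x = f (x 0) (N x)"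
      by (simp add: f_def indicator_def)
  qed
  also have "\<dots> = (\<integral>\<^sup>+x. \<integral>\<^sup>+y. f y (N x) \<partial>lborel \<partial>?LJ)"
  proof -
    note [measurable] = xm[OF insertI1, of 0 J] Nm[OF subset_insertI, of 0]
    have "N (x(0 := y)) = N x" for x y unfolding N_def using J by (intro sum.cong) auto
    then show ?thesis unfolding J(3)
      by (subst lborel_prod.product_nn_integral_insert[OF J(1,2)]) auto
  qed
  also have "\<dots> = (\<integral>\<^sup>+x. \<integral>\<^sup>+s. F (s * cos_of_tan s) * (ennreal (sqrt (N x)) * indicator {..cos_of_tan s} (sqrt (N x))) \<partial>lborel \<partial>?LJ)"
  proof (rule nn_integral_cong_AE, use AE_sum_squares_pos[OF J(1,4)] in eventually_elim)
    fix x :: "nat \<Rightarrow> real" assume "0 < (\<Sum>i\<in>J. (x i)\<^sup>2)"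
    then have N: "0 < N x" by (simp add: N_def)
    let ?r = "sqrt (N x)"
    have r: "0 < ?r" "?r\<^sup>2 = N x" using N by auto
    have "(\<integral>\<^sup>+y. f y (N x) \<partial>lborel) = ennreal ?r * (\<integral>\<^sup>+s. f (?r * s) (N x) \<partial>lborel)"
      using nn_integral_real_affine[of "\<lambda>y. f y (N x)" ?r 0] r by simp
    also have "\<dots> = (\<integral>\<^sup>+s. ennreal ?r * f (?r * s) (N x) \<partial>lborel)"
      by (rule nn_integral_cmult[symmetric]) (rule f_m)
    also have "\<dots> = (\<integral>\<^sup>+s. F (s * cos_of_tan s) * (ennreal ?r * indicator {..cos_of_tan s} ?r) \<partial>lborel)"
    proof (intro nn_integral_cong)
      fix s :: real
      have 1: "(?r * s)\<^sup>2 + N x = ?r\<^sup>2 * (1 + s\<^sup>2)" using r(2) by (simp add: power_mult_distrib algebra_simps)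
      have 2: "sqrt ((?r * s)\<^sup>2 + N x) = ?r * sqrt (1 + s\<^sup>2)" unfolding 1 using r by (simp add: real_sqrt_mult)
      have 3: "0 < (?r * s)\<^sup>2 + N x" using N by (intro add_nonneg_pos) auto
      have "(?r * s)\<^sup>2 + N x \<le> 1 \<longleftrightarrow> sqrt ((?r * s)\<^sup>2 + N x) \<le> 1" by simp
      also have "\<dots> \<longleftrightarrow> ?r \<le> cos_of_tan s"
        unfolding 2 cos_of_tan_def using one_plus_square_pos[of s] by (simp add: pos_le_divide_eq)
      finally have 4: "(?r * s)\<^sup>2 + N x \<le> 1 \<longleftrightarrow> ?r \<le> cos_of_tan s" .
      have 5: "?r * s / sqrt ((?r * s)\<^sup>2 + N x) = s * cos_of_tan s"
        unfolding 2 cos_of_tan_def using r by simp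
      show "ennreal ?r * f (?r * s) (N x) = F (s * cos_of_tan s) * (ennreal ?r * indicator {..cos_of_tan s} ?r)"
        unfolding f_def 5 using 3 4 by (auto simp: mult.commute split: split_indicator)
    qed
    finally show "(\<integral>\<^sup>+y. f y (N x) \<partial>lborel)
      = (\<integral>\<^sup>+s. F (s * cos_of_tan s) * (ennreal ?r * indicator {..cos_of_tan s} ?r) \<partial>lborel)" .
  qed
  also have "\<dots> = (\<integral>\<^sup>+s. \<integral>\<^sup>+x. F (s * cos_of_tan s) * (ennreal (sqrt (N x)) * indicator {..cos_of_tan s} (sqrt (N x))) \<partial>?LJ \<partial>lborel)"
  proof (rule pair_sigma_finite.Fubini')
    show "pair_sigma_finite lborel ?LJ"
      using lborel_prod.sigma_finite[OF J(1)] by (simp add: pair_sigma_finite.intro lborel.sigma_finite_measure_axioms)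
    have [measurable]: "Measurable.pred (lborel \<Otimes>\<^sub>M ?LJ) (\<lambda>x. sqrt (N (snd x)) \<le> cos_of_tan (fst x))" by measurable
    have "(\<lambda>x. F (fst x * cos_of_tan (fst x)) * (ennreal (sqrt (N (snd x))) * indicator {x. sqrt (N (snd x)) \<le> cos_of_tan (fst x)} x))
      \<in> borel_measurable (lborel \<Otimes>\<^sub>M ?LJ)" by measurable
    then show "(\<lambda>(x, y). F (x * cos_of_tan x) * (ennreal (sqrt (N y)) * indicator {..cos_of_tan x} (sqrt (N y))))
      \<in> borel_measurable (lborel \<Otimes>\<^sub>M ?LJ)" by (simp add: case_prod_beta' indicator_def)
  qed
  also have "\<dots> = (\<integral>\<^sup>+s. H 1 * (F (s * cos_of_tan s) * ennreal (cos_of_tan s ^ p)) \<partial>lborel)"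
  proof (intro nn_integral_cong)
    fix s :: real
    have "(\<integral>\<^sup>+x. F (s * cos_of_tan s) * (ennreal (sqrt (N x)) * indicator {..cos_of_tan s} (sqrt (N x))) \<partial>?LJ)
      = F (s * cos_of_tan s) * H (cos_of_tan s)"
      unfolding H_def by (rule nn_integral_cmult) measurable
    then show "(\<integral>\<^sup>+x. F (s * cos_of_tan s) * (ennreal (sqrt (N x)) * indicator {..cos_of_tan s} (sqrt (N x))) \<partial>?LJ)
      = H 1 * (F (s * cos_of_tan s) * ennreal (cos_of_tan s ^ p))"
      by (simp add: H[OF cos_of_tan_pos] ac_simps)
  qed
  also have "\<dots> = H 1 * (\<integral>\<^sup>+s. F (s * cos_of_tan s) * ennreal (cos_of_tan s ^ p) \<partial>lborel)"
    by (rule nn_integral_cmult) measurable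
  \<comment> \<open>The schematic constant is instantiated here, so it is spelled out with the
    definitions of \<open>J\<close>, \<open>N\<close> and \<open>H\<close> expanded.\<close>
  finally show "(\<integral>\<^sup>+z. F (z 0) \<partial>uniform_sphere p)
      = ((\<integral>\<^sup>+x. ennreal (sqrt (\<Sum>i\<in>{1..<p}. (x i)\<^sup>2)) * indicator {..1} (sqrt (\<Sum>i\<in>{1..<p}. (x i)\<^sup>2)) \<partial>lebesgue_on_coords {1..<p})
          / emeasure ?L (unit_ball p))
        * (\<integral>\<^sup>+s. F (s * cos_of_tan s) * ennreal (cos_of_tan s ^ p) \<partial>lborel)"
    by (subst nn_integral_uniform_sphere[OF measurable_compose[OF z0 F]])
       (simp add: H_def N_def J_def divide_ennreal_def ac_simps)
qed


text \<open>For \<open>p \<ge> 2\<close> this is the value of the Beta function at 1 / 2 and (p - 1)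
  / 2, the normalising constant in the tangent coordinate. Positivity and asymptotics are enough; no
  closed form enters.\<close>

definition tan_mass :: "nat \<Rightarrow> real" where
  "tan_mass p = (LINT s|lborel. cos_of_tan s ^ p)"

section \<open>Calculus and moments in the tangent coordinate\<close>

lemma DERIV_cos_of_tan: "(cos_of_tan has_real_derivative - s * cos_of_tan s ^ 3) (at s)"
proof -
  have "sqrt (1 + s\<^sup>2) ^ 2 = 1 + s\<^sup>2" "sqrt (1 + s\<^sup>2) > 0" using one_plus_square_pos[of s] by auto
  then have "sqrt (1 + s\<^sup>2) ^ 3 = (1 + s\<^sup>2) * sqrt (1 + s\<^sup>2)"
    by (simp add: power3_eq_cube power2_eq_square[of "sqrt _"])
  then show ?thesis unfolding cos_of_tan_def
    using one_plus_square_pos[of s]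
    by (auto intro!: derivative_eq_intros simp: power_divide field_simps)
qed

lemma DERIV_sin_of_tan: "((\<lambda>s. s * cos_of_tan s) has_real_derivative cos_of_tan s ^ 3) (at s)"
proof -
  have "((\<lambda>s. s * cos_of_tan s) has_real_derivative 1 * cos_of_tan s + (- s * cos_of_tan s ^ 3) * s) (at s)"
    by (rule DERIV_mult[OF DERIV_ident DERIV_cos_of_tan])
  moreover have "1 * cos_of_tan s + (- s * cos_of_tan s ^ 3) * s = cos_of_tan s * (1 - (s * cos_of_tan s)\<^sup>2)"
    by (simp add: power2_eq_square power3_eq_cube algebra_simps)
  moreover have "\<dots> = cos_of_tan s ^ 3"
    unfolding sin_of_tan_square by (simp add: power2_eq_square power3_eq_cube)
  ultimately show ?thesis by simp
qed

lemma isCont_cos_of_tan: "isCont cos_of_tan s"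
  using DERIV_cos_of_tan by (rule DERIV_isCont)

lemma sin_of_tan_less_iff: "s * cos_of_tan s < t * cos_of_tan t \<longleftrightarrow> s < t"
proof -
  have "strict_mono (\<lambda>s. s * cos_of_tan s)"
  proof (rule strict_monoI)
    fix x y :: real assume "x < y"
    then show "x * cos_of_tan x < y * cos_of_tan y"
      using DERIV_sin_of_tan cos_of_tan_pos
      by (intro DERIV_pos_imp_increasing[of x y "\<lambda>s. s * cos_of_tan s"]) (auto intro!: exI zero_less_power)
  qed
  then show ?thesis by (rule strict_mono_less)
qed

lemma abs_sin_of_tan_less_1: "\<bar>s * cos_of_tan s\<bar> < 1"
  using sin_of_tan_square[of s] cos_of_tan_pos[of s] by (simp add: abs_square_less_1[symmetric])

text \<open>The witness t / sqrt (1 - t^2) is the tangent of the angle whose sine is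
  \<open>t\<close>.\<close>

lemma sin_of_tan_surj:
  assumes t: "\<bar>t\<bar> < 1"
  shows "\<exists>s. s * cos_of_tan s = t \<and> cos_of_tan s = sqrt (1 - t\<^sup>2)"
proof -
  have t2: "t\<^sup>2 < 1" using t by (simp add: abs_square_less_1)
  define r where "r = sqrt (1 - t\<^sup>2)"
  have r: "0 < r" "r\<^sup>2 = 1 - t\<^sup>2" using t2 by (auto simp: r_def)
  have "1 + (t / r)\<^sup>2 = (1 / r)\<^sup>2"
    using t2 unfolding power_divide r(2) by (simp add: field_simps)
  then have "cos_of_tan (t / r) = r" unfolding cos_of_tan_def using r(1) by simp
  then show ?thesis using r(1) by (intro exI[of _ "t / r"]) (auto simp: r_def)
qed

lemma tendsto_cos_of_tan_at_top: "(cos_of_tan \<longlongrightarrow> 0) at_top"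
  and tendsto_cos_of_tan_at_bot: "(cos_of_tan \<longlongrightarrow> 0) at_bot"
  unfolding cos_of_tan_def by real_asymp+

text \<open>With W = \<open>s * cos_of_tan s\<close> the primitive is W^(2m+1) (1 - W^2)^((p-1)/2),
  and its derivative carries the unnormalised density as a factor. For \<open>m = 0\<close> the
  other factor is 1 - p W^2, the centred quadratic term of the likelihood ratio up to scale; in
  general the formula links consecutive even moments.\<close>

lemma DERIV_moment_primitive:
  assumes "1 \<le> p"
  shows "((\<lambda>s. (s * cos_of_tan s) ^ (2 * m + 1) * cos_of_tan s ^ (p - 1)) has_real_derivative
      (real (2 * m + 1) * (s * cos_of_tan s) ^ (2 * m) - real (p + 2 * m) * (s * cos_of_tan s) ^ (2 * m + 2))
        * cos_of_tan s ^ p) (at s)"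
proof -
  obtain q where q: "p = Suc q" using assms by (cases p) auto
  let ?W = "s * cos_of_tan s" and ?c = "cos_of_tan s"
  have "((\<lambda>s. (s * cos_of_tan s) ^ (2 * m + 1) * cos_of_tan s ^ q) has_real_derivative
      (real (2 * m + 1) * (?c ^ 3 * ?W ^ (2 * m))) * ?c ^ q
      + (real q * ((- s * ?c ^ 3) * ?c ^ (q - Suc 0))) * ?W ^ (2 * m + 1)) (at s)"
    using DERIV_mult[OF DERIV_power[OF DERIV_sin_of_tan, of "2 * m + 1" s] DERIV_power[OF DERIV_cos_of_tan, of q s]]
    by simp
  moreover have "(a * (?c ^ 3 * w)) * ?c ^ q + (real q * ((- s * ?c ^ 3) * ?c ^ (q - Suc 0))) * (w * ?W)
      = ?c ^ Suc q * w * (a * ?c\<^sup>2 - real q * ?W\<^sup>2)" for a w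
    by (cases q) (simp_all add: power2_eq_square power3_eq_cube algebra_simps)
  moreover have "real (2 * m + 1) * ?c\<^sup>2 - real q * ?W\<^sup>2 = real (2 * m + 1) - real (p + 2 * m) * ?W\<^sup>2"
    unfolding sin_of_tan_square q by (simp add: algebra_simps)
  moreover have "?c ^ Suc q * w * (a - b * ?W\<^sup>2) = (a * w - b * (w * ?W\<^sup>2)) * ?c ^ Suc q" for a b w
    by (simp only: algebra_simps)
  moreover have "?W ^ (2 * m + 1) = ?W ^ (2 * m) * ?W" "?W ^ (2 * m + 2) = ?W ^ (2 * m) * ?W\<^sup>2"
    by (simp_all only: power_add power_one_right)
  ultimately show ?thesis unfolding q by (simp only: diff_Suc_1)
qed

context sphere_dim
begin

lemma tan_mass_pos: "0 < tan_mass p"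
  and integrable_cos_of_tan_power: "integrable lborel (\<lambda>s. cos_of_tan s ^ p)"
  and distr_coord: "distr \<sigma> borel (\<lambda>z. z 0)
    = distr (density lborel (\<lambda>s. ennreal (cos_of_tan s ^ p / tan_mass p))) borel (\<lambda>s. s * cos_of_tan s)"
proof -
  obtain K where K: "\<And>F. F \<in> borel_measurable borel \<Longrightarrow> (\<integral>\<^sup>+z. F (z 0) \<partial>\<sigma>)
        = K * (\<integral>\<^sup>+s. F (s * cos_of_tan s) * ennreal (cos_of_tan s ^ p) \<partial>lborel)"
    using nn_integral_sphere_slice[OF p_ge_2] by blast
  let ?I = "\<integral>\<^sup>+s. ennreal (cos_of_tan s ^ p) \<partial>lborel"
  \<comment> \<open>Total mass one both rules out that the integral is zero or infinite and
    identifies \<open>K\<close> with the inverse of \<open>tan_mass p\<close>.\<close>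
  have KI: "K * ?I = 1" using K[of "\<lambda>_. 1"] by (simp add: emeasure_space_1)
  have fin: "?I \<noteq> \<infinity>" and nz: "?I \<noteq> 0"
    using KI by (auto simp: ennreal_mult_top split: if_splits)
  show int: "integrable lborel (\<lambda>s. cos_of_tan s ^ p)"
    using fin by (intro integrableI_nonneg AE_I2) (auto simp: less_top less_imp_le cos_of_tan_pos)
  have I: "?I = ennreal (tan_mass p)"
    unfolding tan_mass_def using int
    by (intro nn_integral_eq_integral AE_I2) (auto simp: less_imp_le cos_of_tan_pos)
  show pos: "0 < tan_mass p" using nz unfolding I by (simp add: ennreal_eq_0_iff not_le)
  have "K = K * ?I * inverse (ennreal (tan_mass p))"
    unfolding I using pos by (simp add: mult.assoc ennreal_inverse_mult ennreal_mult[symmetric] inverse_ennreal)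
  then have K_eq: "K = ennreal (inverse (tan_mass p))" unfolding KI using pos by (simp add: inverse_ennreal)
  show "distr \<sigma> borel (\<lambda>z. z 0)
    = distr (density lborel (\<lambda>s. ennreal (cos_of_tan s ^ p / tan_mass p))) borel (\<lambda>s. s * cos_of_tan s)"
    (is "?M = ?N")
  proof (rule measure_eqI)
    fix A assume "A \<in> sets ?M"
    then have [measurable]: "A \<in> sets borel" by simp
    have "emeasure ?M A = (\<integral>\<^sup>+z. indicator A (z 0) \<partial>\<sigma>)"
      by (subst nn_integral_indicator[symmetric], simp, subst nn_integral_distr) auto
    also have "\<dots> = (\<integral>\<^sup>+s. ennreal (cos_of_tan s ^ p / tan_mass p) * indicator A (s * cos_of_tan s) \<partial>lborel)"
      unfolding K[OF borel_measurable_indicator[OF \<open>A \<in> sets borel\<close>]] K_eq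
      using pos less_imp_le[OF cos_of_tan_pos]
      by (subst nn_integral_cmult[symmetric])
         (auto intro!: nn_integral_cong simp: divide_inverse ennreal_mult ac_simps)
    also have "\<dots> = emeasure ?N A"
      by (subst nn_integral_indicator[symmetric], simp, subst nn_integral_distr) (auto simp: nn_integral_density)
    finally show "emeasure ?M A = emeasure ?N A" .
  qed simp
qed

lemma integral_coord:
  assumes [measurable]: "f \<in> borel_measurable borel"
  shows "(LINT z|\<sigma>. f (z 0)) = (LINT s|lborel. f (s * cos_of_tan s) * cos_of_tan s ^ p) / (tan_mass p :: real)"
proof -
  have "(LINT z|\<sigma>. f (z 0)) = (LINT x|distr \<sigma> borel (\<lambda>z. z 0). f x)"
    by (subst integral_distr) auto
  also have "\<dots> = (LINT s|lborel. (cos_of_tan s ^ p / tan_mass p) * f (s * cos_of_tan s))"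
    unfolding distr_coord using tan_mass_pos less_imp_le[OF cos_of_tan_pos]
    by (subst integral_distr) (auto simp: integral_real_density)
  also have "\<dots> = (LINT s|lborel. f (s * cos_of_tan s) * cos_of_tan s ^ p / tan_mass p)"
    by (intro Bochner_Integration.integral_cong) auto
  finally show ?thesis by simp
qed

lemma integrable_bounded_coord:
  fixes f :: "real \<Rightarrow> real"
  assumes [measurable]: "f \<in> borel_measurable borel" and f: "\<And>x. \<bar>x\<bar> \<le> 1 \<Longrightarrow> \<bar>f x\<bar> \<le> B"
  shows "integrable \<sigma> (\<lambda>z. f (z 0))"
  by (rule integrable_const_bound[where B=B]) (use f abs_coord_le_1 in \<open>auto intro!: AE_I2\<close>)

text \<open>The integrand times the density is an exact derivative in the tangent coordinate, with a
  primitive vanishing at both ends of the line, so only the boundary value at the truncation point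
  survives.\<close>

lemma truncated_moment:
  assumes t: "\<bar>t\<bar> \<le> 1"
  shows "(LINT z|\<sigma>. indicator {..t} (z 0) *
      (real (2 * m + 1) * z 0 ^ (2 * m) - real (p + 2 * m) * z 0 ^ (2 * m + 2)))
    = t ^ (2 * m + 1) * sqrt (1 - t\<^sup>2) ^ (p - 1) / tan_mass p"
proof -
  define W where "W s = s * cos_of_tan s" for s
  define F where "F s = W s ^ (2 * m + 1) * cos_of_tan s ^ (p - 1)" for s
  define f where "f s = (real (2 * m + 1) * W s ^ (2 * m) - real (p + 2 * m) * W s ^ (2 * m + 2)) * cos_of_tan s ^ p" for s
  have [measurable]: "W \<in> borel_measurable borel" unfolding W_def by measurable
  have W1: "\<bar>W s\<bar> \<le> 1" for s using abs_sin_of_tan_less_1[of s] by (simp add: W_def)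
  have Wpow: "\<bar>W s ^ k\<bar> \<le> 1" for s k using W1[of s] by (simp add: power_abs power_le_one)
  have f_int: "integrable lborel f"
  proof (rule Bochner_Integration.integrable_bound[OF integrable_mult_right[OF integrable_cos_of_tan_power]])
    show "AE s in lborel. norm (f s) \<le> norm ((real (2 * m + 1) + real (p + 2 * m)) * cos_of_tan s ^ p)"
    proof (intro AE_I2)
      fix s
      have "\<bar>real (2 * m + 1) * W s ^ (2 * m) - real (p + 2 * m) * W s ^ (2 * m + 2)\<bar>
          \<le> \<bar>real (2 * m + 1) * W s ^ (2 * m)\<bar> + \<bar>real (p + 2 * m) * W s ^ (2 * m + 2)\<bar>" by (rule abs_triangle_ineq4)
      also have "\<dots> \<le> real (2 * m + 1) + real (p + 2 * m)"
        unfolding abs_mult abs_of_nat by (intro add_mono mult_left_le Wpow of_nat_0_le_iff)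
      finally show "norm (f s) \<le> norm ((real (2 * m + 1) + real (p + 2 * m)) * cos_of_tan s ^ p)"
        unfolding f_def using cos_of_tan_pos[of s] by (auto simp: abs_mult intro!: mult_right_mono)
    qed
    show "f \<in> borel_measurable lborel" unfolding f_def
      by (intro borel_measurable_times borel_measurable_diff borel_measurable_power borel_measurable_const) simp_all
  qed
  have deriv: "(F has_vector_derivative f s) (at s)" for s
    using DERIV_moment_primitive[of p m s] p_ge_2
    unfolding F_def W_def f_def has_real_derivative_iff_has_vector_derivative by simp
  have cont: "isCont f s" for s
    unfolding f_def W_def by (intro continuous_intros isCont_cos_of_tan)
  have lim: "(F \<longlongrightarrow> 0) G" if "(cos_of_tan \<longlongrightarrow> 0) G" for G
  proof (rule Lim_null_comparison[OF _ that], intro always_eventually allI)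
    fix s
    have "norm (F s) \<le> 1 * cos_of_tan s ^ (p - 1)"
      unfolding F_def real_norm_def abs_mult using cos_of_tan_pos[of s] by (intro mult_mono Wpow) auto
    also have "\<dots> \<le> cos_of_tan s"
      using power_decreasing[of 1 "p - 1" "cos_of_tan s"] cos_of_tan_pos[of s] cos_of_tan_le_1[of s] p_ge_2 by simp
    finally show "norm (F s) \<le> cos_of_tan s" .
  qed
  have FTC: "(LINT s|lborel. indicator (einterval (-\<infinity>) b) s * f s) = B"
    if b: "-\<infinity> < b" and B: "((F \<circ> real_of_ereal) \<longlongrightarrow> B) (at_left b)" for b B
  proof -
    have "(LBINT s=-\<infinity>..b. f s) = B - 0"
    proof (rule interval_integral_FTC_integrable[OF b deriv cont])
      show "set_integrable lborel (einterval (-\<infinity>) b) f"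
        unfolding set_integrable_def by (intro integrable_mult_indicator f_int) simp
      show "((F \<circ> real_of_ereal) \<longlongrightarrow> 0) (at_right (- \<infinity>))"
        using lim[OF tendsto_cos_of_tan_at_bot] by (simp add: ereal_tendsto_simps)
    qed fact
    then show ?thesis using b
      by (simp add: interval_lebesgue_integral_def set_lebesgue_integral_def less_imp_le)
  qed
  have "(LINT z|\<sigma>. indicator {..t} (z 0) *
      (real (2 * m + 1) * z 0 ^ (2 * m) - real (p + 2 * m) * z 0 ^ (2 * m + 2)))
    = (LINT s|lborel. indicator {..t} (W s) * f s) / tan_mass p"
    by (subst integral_coord) (auto simp: W_def f_def mult.assoc)
  also have "(LINT s|lborel. indicator {..t} (W s) * f s) = t ^ (2 * m + 1) * sqrt (1 - t\<^sup>2) ^ (p - 1)"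
  proof -
    \<comment> \<open>The values 1 and -1 are not attained by \<open>s * cos_of_tan s\<close>; they
      correspond to the two ends of the line.\<close>
    consider "t = 1" | "t = -1" | "\<bar>t\<bar> < 1" using t by linarith
    then show ?thesis
    proof cases
      case 1
      have "(LINT s|lborel. indicator {..t} (W s) * f s) = (LINT s|lborel. indicator (einterval (-\<infinity>) \<infinity>) s * f s)"
        using W1 1 by (intro Bochner_Integration.integral_cong) (auto simp: abs_le_iff)
      also have "\<dots> = 0"
        using lim[OF tendsto_cos_of_tan_at_top] by (intro FTC) (simp_all add: ereal_tendsto_simps)
      finally show ?thesis using 1 p_ge_2 by simp
    next
      case 2
      have "W s > -1" for s using abs_sin_of_tan_less_1[of s] by (simp add: W_def abs_less_iff)
      then have "indicator {..t} (W s) = (0::real)" for s using 2 by (simp add: not_le)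
      then show ?thesis using 2 p_ge_2 by simp
    next
      case 3
      then obtain s0 where s0: "W s0 = t" "cos_of_tan s0 = sqrt (1 - t\<^sup>2)"
        using sin_of_tan_surj[OF 3] unfolding W_def by blast
      have iff: "W s \<le> t \<longleftrightarrow> s \<le> s0" for s
        using sin_of_tan_less_iff[of s0 s] unfolding s0(1)[symmetric] W_def by linarith
      have "(LINT s|lborel. indicator {..t} (W s) * f s) = (LINT s|lborel. indicator (einterval (-\<infinity>) (ereal s0)) s * f s)"
      proof (rule integral_cong_AE)
        show "AE s in lborel. indicator {..t} (W s) * f s = indicator (einterval (-\<infinity>) (ereal s0)) s * f s"
          using AE_lborel_singleton[of s0]
          by eventually_elim (auto simp: iff einterval_iff split: split_indicator)
      qed (use f_int in \<open>auto intro!: borel_measurable_times\<close>)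
      also have "\<dots> = F s0"
      proof (rule FTC)
        have "isCont F s0" using deriv by (rule has_vector_derivative_continuous)
        then show "((F \<circ> real_of_ereal) \<longlongrightarrow> F s0) (at_left (ereal s0))"
          by (simp add: ereal_tendsto_simps isCont_def filterlim_at_split)
      qed simp
      also have "\<dots> = t ^ (2 * m + 1) * sqrt (1 - t\<^sup>2) ^ (p - 1)"
        unfolding F_def s0 ..
      finally show ?thesis .
    qed
  qed
  finally show ?thesis .
qed

lemma integrable_coord_power: "integrable \<sigma> (\<lambda>z. z 0 ^ k)"
  by (rule integrable_bounded_coord[where B=1]) (auto simp: power_abs power_le_one)

text \<open>Truncating at \<open>t = 1\<close> removes nothing, and the boundary term is zero
  because \<open>p \<ge> 2\<close>.\<close>

lemma moment_Suc:
  "real (p + 2 * m) * (LINT z|\<sigma>. z 0 ^ (2 * m + 2)) = real (2 * m + 1) * (LINT z|\<sigma>. z 0 ^ (2 * m))"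
proof -
  have "(LINT z|\<sigma>. (real (2 * m + 1) * z 0 ^ (2 * m) - real (p + 2 * m) * z 0 ^ (2 * m + 2)))
      = (LINT z|\<sigma>. indicator {..1} (z 0) *
      (real (2 * m + 1) * z 0 ^ (2 * m) - real (p + 2 * m) * z 0 ^ (2 * m + 2)))"
    using abs_coord_le_1 by (intro Bochner_Integration.integral_cong) (auto simp: abs_le_iff)
  also have "\<dots> = 0" using truncated_moment[of 1 m] p_ge_2 by simp
  finally show ?thesis
    by (simp add: integrable_coord_power Bochner_Integration.integral_diff[of \<sigma> "\<lambda>z. _ * z 0 ^ (2 * m)"] del: power_Suc)
qed

lemma second_moment: "(LINT z|\<sigma>. (z 0)\<^sup>2) = 1 / real p"
  using moment_Suc[of 0] p_ge_2 by (simp add: prob_space field_simps power2_eq_square)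

text \<open>The right side is the even moment of a normal variable with variance
  \<open>1 / p\<close>, whose recursion has \<open>p\<close> where \<open>moment_Suc\<close> has the
  larger \<open>p + 2 * m\<close>.\<close>

lemma moment_le: "(LINT z|\<sigma>. z 0 ^ (2 * m)) \<le> fact (2 * m) / (2 ^ m * fact m * real p ^ m)"
proof (induction m)
  case 0
  then show ?case by (simp add: prob_space)
next
  case (Suc m)
  have p: "0 < real p" using p_ge_2 by simp
  have Suc_m: "2 * Suc m = 2 * m + 2" by simp
  have nn: "0 \<le> (LINT z|\<sigma>. z 0 ^ (2 * m + 2))"
    by (intro Bochner_Integration.integral_nonneg zero_le_even_power) simp
  have "real p * (LINT z|\<sigma>. z 0 ^ (2 * m + 2)) \<le> real (p + 2 * m) * (LINT z|\<sigma>. z 0 ^ (2 * m + 2))"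
    by (intro mult_right_mono nn) simp
  also have "\<dots> \<le> real (2 * m + 1) * (fact (2 * m) / (2 ^ m * fact m * real p ^ m))"
    unfolding moment_Suc by (intro mult_left_mono Suc) simp
  also have "\<dots> = real p * (fact (2 * Suc m) / (2 ^ Suc m * fact (Suc m) * real p ^ Suc m))"
  proof -
    have "(fact (2 * Suc m) :: real) = 2 * real (Suc m) * (real (2 * m + 1) * fact (2 * m))"
      by (simp add: algebra_simps)
    moreover have "(2::real) ^ Suc m * fact (Suc m) * real p ^ Suc m
        = (2 * real (Suc m)) * (real p * (2 ^ m * fact m * real p ^ m))" by simp
    ultimately have "fact (2 * Suc m) / (2 ^ Suc m * fact (Suc m) * real p ^ Suc m)
        = real (2 * m + 1) * fact (2 * m) / (real p * (2 ^ m * fact m * real p ^ m))"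
      by (simp only: mult_divide_mult_cancel_left_if) simp
    then show ?thesis using p by (simp only: times_divide_eq_right) simp
  qed
  finally show ?case unfolding mult_le_cancel_left_pos[OF p] unfolding Suc_m .
qed

end

section \<open>The law of two coordinates\<close>

lemma sum_squares_scale: "(\<Sum>i\<in>I. ((\<lambda>j\<in>I. c * x j) i)\<^sup>2) = c\<^sup>2 * (\<Sum>i\<in>I. (x i :: real)\<^sup>2)"
  by (simp add: sum_distrib_left power_mult_distrib)

lemma measurable_sum_squares:
  "J \<subseteq> I \<Longrightarrow> (\<lambda>x. \<Sum>i\<in>J. (x i)\<^sup>2) \<in> borel_measurable (lebesgue_on_coords I)"
proof (intro borel_measurable_sum borel_measurable_power)
  fix i assume "J \<subseteq> I" "i \<in> J"
  then show "(\<lambda>x. x i) \<in> borel_measurable (lebesgue_on_coords I)"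
    using measurable_component_singleton[of i I "\<lambda>_. lborel"] by auto
qed

text \<open>Discs have area proportional to the squared radius by scaling alone, and an annulus is a
  difference of two discs. The area of the unit disc is carried along unevaluated.\<close>

lemma nn_integral_annulus:
  fixes A B :: real
  defines "S \<equiv> \<lambda>x::nat \<Rightarrow> real. \<Sum>i<2. (x i)\<^sup>2"
  assumes A: "0 \<le> A"
  shows "(\<integral>\<^sup>+x. indicator {A..B} (S x) \<partial>lebesgue_on_coords {..<2})
       = ennreal (max 0 (B - A)) * emeasure (lebesgue_on_coords {..<2}) (unit_ball 2)"
proof -
  let ?L = "lebesgue_on_coords {..<2}"
  have S_m [measurable]: "S \<in> borel_measurable ?L" unfolding S_def by (rule measurable_sum_squares) simp
  have S_nn: "0 \<le> S x" for x unfolding S_def by (intro sum_nonneg) auto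
  have scale: "emeasure ?L {x \<in> space ?L. S x \<in> T} = ennreal a * emeasure ?L {x \<in> space ?L. a * S x \<in> T}"
    if a: "0 < a" and T [measurable]: "T \<in> sets borel" for a T
  proof -
    have "emeasure ?L {x \<in> space ?L. S x \<in> T} = (\<integral>\<^sup>+x. indicator T (S x) \<partial>?L)"
      by (rule emeasure_Collect_eq_nn_integral) measurable
    also have "\<dots> = ennreal (sqrt a ^ card {..<2::nat}) * (\<integral>\<^sup>+x. indicator T (S (\<lambda>j\<in>{..<2}. sqrt a * x j)) \<partial>?L)"
      using a by (intro nn_integral_scale_all) auto
    also have "\<dots> = ennreal a * (\<integral>\<^sup>+x. indicator T (a * S x) \<partial>?L)"
      using a unfolding S_def sum_squares_scale by simp
    also have "(\<integral>\<^sup>+x. indicator T (a * S x) \<partial>?L) = emeasure ?L {x \<in> space ?L. a * S x \<in> T}"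
      by (rule emeasure_Collect_eq_nn_integral[symmetric]) measurable
    finally show ?thesis .
  qed
  define v where "v = emeasure ?L (unit_ball 2)"
  have ball: "unit_ball 2 = {x \<in> space ?L. S x \<in> {..1}}"
    by (auto simp: unit_ball_def S_def L2_set_def space_PiM)
  define u where "u = emeasure ?L {x \<in> space ?L. S x \<in> {..<1}}"
  have v_fin: "v \<noteq> \<infinity>" unfolding v_def by (rule emeasure_unit_ball_finite)
  have disc: "emeasure ?L {x \<in> space ?L. S x \<in> {..a}} = ennreal a * v" if a: "0 < a" for a
  proof -
    have "{x \<in> space ?L. a * S x \<in> {..a}} = unit_ball 2" unfolding ball using a by auto
    then show ?thesis using scale[OF a, of "{..a}"] by (simp add: v_def)
  qed
  have open_disc: "emeasure ?L {x \<in> space ?L. S x \<in> {..<a}} = ennreal a * u" if a: "0 < a" for a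
  proof -
    have "{x \<in> space ?L. a * S x \<in> {..<a}} = {x \<in> space ?L. S x \<in> {..<1}}" using a by auto
    then show ?thesis using scale[OF a, of "{..<a}"] by (simp add: u_def)
  qed
  have "u \<le> v" unfolding u_def v_def ball by (intro emeasure_mono) auto
  then have u_fin: "u \<noteq> \<infinity>" using v_fin by (auto simp: top_unique)
  \<comment> \<open>For \<open>a < 1\<close> the closed disc lies inside the open unit disc. Letting
    \<open>a\<close> tend to 1 shows that the bounding circle has no area, so the open disc removed
    below may be measured like a closed one.\<close>
  have "enn2real v \<le> enn2real u"
  proof (rule field_le_mult_one_interval)
    fix a :: real assume a: "0 < a" "a < 1"
    have "ennreal a * v \<le> u"
      unfolding disc[OF a(1), symmetric] u_def using a by (intro emeasure_mono) auto
    then show "a * enn2real v \<le> enn2real u"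
      using a v_fin u_fin enn2real_mono[of "ennreal a * v" u] by (simp add: enn2real_mult less_top)
  qed
  then have "v \<le> u" using v_fin u_fin by (metis ennreal_enn2real ennreal_leI less_top infinity_ennreal_def)
  with \<open>u \<le> v\<close> have uv: "u = v" by simp
  have "(\<integral>\<^sup>+x. indicator {A..B} (S x) \<partial>?L) = emeasure ?L {x \<in> space ?L. S x \<in> {A..B}}"
    by (rule emeasure_Collect_eq_nn_integral[symmetric]) measurable
  also have "\<dots> = ennreal (max 0 (B - A)) * v"
  proof -
    consider "B < A" | "B = 0" "A = 0" | "A = 0" "0 < B" | "0 < A" "A \<le> B" using A by linarith
    then show ?thesis
    proof cases
      case 1
      then have "{x \<in> space ?L. S x \<in> {A..B}} = {}" by auto
      then show ?thesis using 1 by simp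
    next
      case 2
      have "AE x in ?L. 0 < S x"
        using AE_sum_squares_pos[of "{..<2::nat}"] by (simp add: S_def lessThan_empty_iff)
      then have "AE x in ?L. S x \<notin> {A..B}" by (rule AE_mp) (auto simp: 2)
      then have "emeasure ?L {x \<in> space ?L. S x \<in> {A..B}} = 0"
        by (intro emeasure_eq_0_AE) auto
      then show ?thesis using 2 by simp
    next
      case 3
      then have "{x \<in> space ?L. S x \<in> {A..B}} = {x \<in> space ?L. S x \<in> {..B}}" using S_nn by auto
      then show ?thesis using 3 disc[of B] by simp
    next
      case 4
      have "{x \<in> space ?L. S x \<in> {A..B}} = {x \<in> space ?L. S x \<in> {..B}} - {x \<in> space ?L. S x \<in> {..<A}}" by auto
      also have "emeasure ?L \<dots> = emeasure ?L {x \<in> space ?L. S x \<in> {..B}} - emeasure ?L {x \<in> space ?L. S x \<in> {..<A}}"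
        using 4 open_disc[of A] u_fin by (intro emeasure_Diff) (auto simp: ennreal_mult_eq_top_iff)
      also have "\<dots> = ennreal B * v - ennreal A * v" using 4 disc[of B] open_disc[of A] uv by simp
      also have "\<dots> = ennreal (B - A) * v"
        using 4 v_fin by (cases v) (auto simp: ennreal_mult[symmetric] ennreal_minus algebra_simps)
      finally show ?thesis using 4 by simp
    qed
  qed
  finally show ?thesis by (simp add: v_def)
qed

context sphere_dim
begin

text \<open>On the sphere this is the Euclidean norm of the remaining \<open>p - 2\<close>
  coordinates.\<close>

definition codisc :: "(nat \<Rightarrow> real) \<Rightarrow> real" where
  "codisc z = sqrt (1 - (z 0)\<^sup>2 - (z 1)\<^sup>2)"

lemma measurable_codisc [measurable]: "codisc \<in> borel_measurable \<sigma>"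
  unfolding codisc_def One_nat_def by measurable

lemma codisc_bounds: "z \<in> space \<sigma> \<Longrightarrow> 0 \<le> codisc z \<and> codisc z \<le> 1"
  using coords_in_disc[of z] unfolding codisc_def by simp

lemma codisc_square: "z \<in> space \<sigma> \<Longrightarrow> (codisc z)\<^sup>2 = 1 - ((z 0)\<^sup>2 + (z 1)\<^sup>2)"
  using coords_in_disc[of z] unfolding codisc_def by simp

text \<open>Slicing the unit ball over the last \<open>p - 2\<close> coordinates \<open>x\<close>, the event is an annulus in the
  first two whose area is proportional to \<open>max 0 (1 - N x / c\<^sup>2)\<close>; hence the probability scales
  like a volume in dimension \<open>p - 2\<close>.\<close>

lemma emeasure_codisc_le:
  assumes p3: "3 \<le> p" and c: "0 < c" "c \<le> 1"
  shows "emeasure \<sigma> {z \<in> space \<sigma>. codisc z \<le> c} = ennreal (c ^ (p - 2))"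
proof -
  define J where "J = {2..<p}"
  have J: "finite J" "{..<p} = J \<union> {..<2}" "J \<inter> {..<2} = {}" "J \<noteq> {}" "card J = p - 2"
    using p3 by (auto simp: J_def)
  let ?L = "lebesgue_on_coords {..<p}" and ?LJ = "lebesgue_on_coords J" and ?L2 = "lebesgue_on_coords {..<2}"
  define N where "N x = (\<Sum>i\<in>J. (x i)\<^sup>2)" for x :: "nat \<Rightarrow> real"
  define S where "S x = (\<Sum>i<2. (x i)\<^sup>2)" for x :: "nat \<Rightarrow> real"
  have N_m: "N \<in> borel_measurable (lebesgue_on_coords I)" if "J \<subseteq> I" for I
    unfolding N_def using that by (rule measurable_sum_squares)
  have S_m: "S \<in> borel_measurable (lebesgue_on_coords I)" if "{..<2} \<subseteq> I" for I
    unfolding S_def using that by (rule measurable_sum_squares)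
  note [measurable] = N_m[OF subset_refl] S_m[OF subset_refl] N_m[OF Un_upper1[of J "{..<2}"]] S_m[OF Un_upper2[of "{..<2}" J]]
  have N_nn: "0 \<le> N x" and S_nn: "0 \<le> S x" for x by (auto simp: N_def S_def intro!: sum_nonneg)
  have sum_split: "(\<Sum>i<p. (x i)\<^sup>2) = S x + N x" for x :: "nat \<Rightarrow> real"
    unfolding N_def S_def J(2) using J by (subst sum.union_disjoint) auto
  define v where "v = emeasure ?L2 (unit_ball 2)"
  define V where "V = emeasure ?L (unit_ball p)"
  define T where "T c = (\<integral>\<^sup>+x. ennreal (max 0 (1 - N x / c\<^sup>2)) * v \<partial>?LJ)" for c
  have main: "emeasure \<sigma> {z \<in> space \<sigma>. codisc z \<le> c} = T c / V" if c: "0 < c" "c \<le> 1" for c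
  proof -
    have c2: "0 < c\<^sup>2" "c\<^sup>2 \<le> 1" using c by (auto simp: power_le_one)
    have m [measurable]: "{z. codisc z \<le> c} \<inter> space (\<Pi>\<^sub>M i\<in>{..<p}. borel) \<in> sets (\<Pi>\<^sub>M i\<in>{..<p}. borel)"
    proof -
      have "(\<lambda>z. z i) \<in> borel_measurable (\<Pi>\<^sub>M i\<in>{..<p}. borel)" if "i < p" for i using that by simp
      from this[of 0] this[of 1] p3
      have [measurable]: "(\<lambda>z. z 0) \<in> borel_measurable (\<Pi>\<^sub>M i\<in>{..<p}. borel)"
        "(\<lambda>z. z 1) \<in> borel_measurable (\<Pi>\<^sub>M i\<in>{..<p}. borel)" by auto
      have "codisc \<in> borel_measurable (\<Pi>\<^sub>M i\<in>{..<p}. borel)"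
        unfolding codisc_def by measurable
      from measurable_sets[OF this, of "{..c}"] show ?thesis by (simp add: vimage_def)
    qed
    define E where "E = {z. codisc z \<le> c} \<inter> space (\<Pi>\<^sub>M i\<in>{..<p}. borel :: real measure)"
    have "emeasure \<sigma> {z \<in> space \<sigma>. codisc z \<le> c} = (\<integral>\<^sup>+z. indicator {z \<in> space \<sigma>. codisc z \<le> c} z \<partial>\<sigma>)"
      by simp
    also have "\<dots> = (\<integral>\<^sup>+z. indicator E z \<partial>\<sigma>)"
      by (intro nn_integral_cong)
         (auto simp: E_def space_uniform_sphere unit_sphere_iff space_PiM PiE_def split: split_indicator)
    also have "\<dots> = (\<integral>\<^sup>+x. indicator E (normalise p x) * indicator (unit_sphere p) (normalise p x)
        * indicator (unit_ball p) x \<partial>?L) / V"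
      unfolding V_def by (rule nn_integral_uniform_sphere) (use m in \<open>simp add: E_def\<close>)
    also have "(\<integral>\<^sup>+x. indicator E (normalise p x) * indicator (unit_sphere p) (normalise p x)
        * indicator (unit_ball p) x \<partial>?L)
        = (\<integral>\<^sup>+x. indicator {0<..1} (S x + N x) * indicator {..c\<^sup>2 * (S x + N x)} (N x) \<partial>?L)"
    proof (intro nn_integral_cong)
      fix x assume "x \<in> space ?L"
      then have ball: "x \<in> unit_ball p \<longleftrightarrow> S x + N x \<le> 1"
        by (simp add: unit_ball_def PiE_def L2_set_def sum_split space_PiM)
      have sphere: "normalise p x \<in> unit_sphere p \<longleftrightarrow> 0 < S x + N x"
        by (simp add: normalise_in_unit_sphere sum_split)
      have E: "normalise p x \<in> E \<longleftrightarrow> N x \<le> c\<^sup>2 * (S x + N x)" if pos: "0 < S x + N x"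
      proof -
        have "codisc (normalise p x) = sqrt (1 - S x / (S x + N x))"
        proof -
          have "normalise p x 0 = x 0 / sqrt (S x + N x)" "normalise p x 1 = x 1 / sqrt (S x + N x)"
            using p3 by (simp_all add: normalise_def L2_set_def sum_split)
          moreover have "S x = (x 0)\<^sup>2 + (x 1)\<^sup>2" by (simp add: S_def numeral_2_eq_2)
          ultimately show ?thesis using pos by (simp add: codisc_def power_divide add_divide_distrib)
        qed
        also have "1 - S x / (S x + N x) = N x / (S x + N x)" using pos by (simp add: field_simps)
        finally have "codisc (normalise p x) \<le> c \<longleftrightarrow> sqrt (N x / (S x + N x)) \<le> sqrt (c\<^sup>2)"
          using c by simp
        also have "\<dots> \<longleftrightarrow> N x / (S x + N x) \<le> c\<^sup>2" by (rule real_sqrt_le_iff)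
        finally have "codisc (normalise p x) \<le> c \<longleftrightarrow> N x / (S x + N x) \<le> c\<^sup>2" .
        then show ?thesis using pos
          by (simp add: E_def normalise_def space_PiM pos_divide_le_eq)
      qed
      show "indicator E (normalise p x) * indicator (unit_sphere p) (normalise p x) * indicator (unit_ball p) x
        = (indicator {0<..1} (S x + N x) * indicator {..c\<^sup>2 * (S x + N x)} (N x) :: ennreal)"
        using ball sphere E by (auto split: split_indicator)
    qed
    also have "\<dots> = (\<integral>\<^sup>+x. \<integral>\<^sup>+y. indicator {0<..1} (S y + N x) * indicator {..c\<^sup>2 * (S y + N x)} (N x) \<partial>?L2 \<partial>?LJ)"
    proof -
      have SN: "S (merge J {..<2} (x, y)) = S y" "N (merge J {..<2} (x, y)) = N x" for x y
        unfolding S_def N_def using J(3) by (auto intro!: sum.cong simp: merge_def)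
      have "(\<lambda>x. indicator {0<..1} (fst x + snd x) * indicator {x. snd x \<le> c\<^sup>2 * (fst x + snd x)} x :: ennreal)
          \<in> borel_measurable (borel \<Otimes>\<^sub>M borel)" by measurable
      from measurable_compose[OF measurable_Pair[OF S_m[OF Un_upper2] N_m[OF Un_upper1]] this]
      have "(\<lambda>x. indicator {0<..1} (S x + N x) * indicator {..c\<^sup>2 * (S x + N x)} (N x) :: ennreal)
          \<in> borel_measurable (lebesgue_on_coords (J \<union> {..<2}))"
        by (simp add: indicator_def)
      then show ?thesis unfolding J(2)
        by (subst lborel_prod.product_nn_integral_fold[OF J(3,1)]) (auto simp: SN)
    qed
    also have "\<dots> = T c"
      unfolding T_def
    proof (rule nn_integral_cong_AE, use AE_sum_squares_pos[OF J(1,4)] in eventually_elim)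
      fix x :: "nat \<Rightarrow> real" assume "0 < (\<Sum>i\<in>J. (x i)\<^sup>2)"
      then have N: "0 < N x" by (simp add: N_def)
      \<comment> \<open>For fixed \<open>x\<close> the value \<open>S y\<close> is bounded below by
        \<open>?A\<close>, from the event, and above by \<open>1 - N x\<close>, from the ball. Only
        the difference \<open>1 - N x / c\<^sup>2\<close> of the two enters the area.\<close>
      let ?A = "N x / c\<^sup>2 - N x"
      have "indicator {0<..1} (S y + N x) * indicator {..c\<^sup>2 * (S y + N x)} (N x) = (indicator {?A..1 - N x} (S y) :: ennreal)" for y
      proof -
        have "N x \<le> c\<^sup>2 * (S y + N x) \<longleftrightarrow> ?A \<le> S y" using c2 by (simp add: field_simps)
        moreover have "0 < S y + N x" using N S_nn[of y] by simp
        ultimately show ?thesis by (auto split: split_indicator)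
      qed
      then have "(\<integral>\<^sup>+y. indicator {0<..1} (S y + N x) * indicator {..c\<^sup>2 * (S y + N x)} (N x) \<partial>?L2)
          = (\<integral>\<^sup>+y. indicator {?A..1 - N x} (S y) \<partial>?L2)" by simp
      also have "\<dots> = ennreal (max 0 (1 - N x / c\<^sup>2)) * v"
      proof -
        have "N x * c\<^sup>2 \<le> N x * 1" using c2 N by (intro mult_left_mono) auto
        then have "0 \<le> ?A" using c2 by (simp add: field_simps)
        from nn_integral_annulus[OF this, of "1 - N x"] show ?thesis
          by (simp add: S_def v_def)
      qed
      finally show "(\<integral>\<^sup>+y. indicator {0<..1} (S y + N x) * indicator {..c\<^sup>2 * (S y + N x)} (N x) \<partial>?L2)
          = ennreal (max 0 (1 - N x / c\<^sup>2)) * v" .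
    qed
    finally show ?thesis .
  qed
  have T_scale: "T c = ennreal (c ^ (p - 2)) * T 1" if c: "0 < c" for c
  proof -
    have "N (\<lambda>j\<in>J. c * x j) = c\<^sup>2 * N x" for x unfolding N_def by (rule sum_squares_scale)
    then show ?thesis unfolding T_def using c
      by (subst nn_integral_scale_all[OF J(1) c]) (auto simp: J(5))
  qed
  \<comment> \<open>At \<open>c = 1\<close> the event is the whole sphere; this fixes the constant
    of proportionality without computing either volume.\<close>
  have "{z \<in> space \<sigma>. codisc z \<le> 1} = space \<sigma>" using codisc_bounds by auto
  then have "T 1 / V = 1" using main[of 1] by (simp add: emeasure_space_1)
  then show ?thesis
    unfolding main[OF c] T_scale[OF c(1)] by (simp add: divide_ennreal_def mult.assoc)
qed


lemma distr_codisc: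
  assumes p3: "3 \<le> p"
  shows "distr \<sigma> borel codisc = density lborel (\<lambda>c. ennreal (indicator {0..1} c * (real (p - 2) * c ^ (p - 3))))"
proof -
  define f where "f c = indicator {0..1} c * (real (p - 2) * c ^ (p - 3))" for c :: real
  define g where "g a = (max 0 (min 1 a)) ^ (p - 2)" for a :: real
  have [measurable]: "f \<in> borel_measurable borel" unfolding f_def by measurable
  have p2: "p - 2 = Suc (p - 3)" using p3 by simp
  have "distributed \<sigma> lborel codisc f"
  proof (rule distributedI_borel_atMost[where g=g])
    show "AE x in lborel. 0 \<le> f x" by (auto simp: f_def intro!: AE_I2 split: split_indicator)
    fix a :: real
    let ?b = "max 0 (min 1 a)"
    have "(\<integral>\<^sup>+x. f x * indicator {..a} x \<partial>lborel)
        = (\<integral>\<^sup>+x. ennreal (real (p - 2) * x ^ (p - 3)) * indicator {0..?b} x \<partial>lborel)"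
      \<comment> \<open>For \<open>a < 0\<close> the interval on the right still contains the point
        0, a null set.\<close>
      by (rule nn_integral_cong_AE, use AE_lborel_singleton[of 0] in eventually_elim)
         (auto simp: f_def split: split_indicator)
    also have "\<dots> = ennreal (?b ^ (p - 2) - 0 ^ (p - 2))"
    proof (intro nn_integral_FTC_Icc)
      show "((\<lambda>x. x ^ (p - 2)) has_real_derivative real (p - 2) * x ^ (p - 3)) (at x)" for x
        using DERIV_pow[of "p - 2" x UNIV] p2 by simp
    qed auto
    finally show "(\<integral>\<^sup>+x. f x * indicator {..a} x \<partial>lborel) = ennreal (g a)" by (simp add: g_def p2)
    show "emeasure \<sigma> {x \<in> space \<sigma>. codisc x \<le> a} = ennreal (g a)"
    proof -
      consider "a \<le> 0" | "0 < a" "a \<le> 1" | "1 < a" by linarith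
      then show ?thesis
      proof cases
        case 1
        \<comment> \<open>\<open>emeasure_codisc_le\<close> does not cover the radius 0, so the
          event is enclosed in those with a small positive radius.\<close>
        have small: "emeasure \<sigma> {x \<in> space \<sigma>. codisc x \<le> a} \<le> ennreal e" if e: "0 < e" for e
        proof -
          let ?c = "min e 1"
          have "emeasure \<sigma> {x \<in> space \<sigma>. codisc x \<le> a} \<le> emeasure \<sigma> {x \<in> space \<sigma>. codisc x \<le> ?c}"
            using 1 e by (intro emeasure_mono) auto
          also have "\<dots> = ennreal (?c ^ (p - 2))" using e by (intro emeasure_codisc_le p3) auto
          also have "\<dots> \<le> ennreal e"
            using power_decreasing[of 1 "p - 2" ?c] p3 e by (intro ennreal_leI) auto
          finally show ?thesis .
        qed
        have "emeasure \<sigma> {x \<in> space \<sigma>. codisc x \<le> a} \<le> 0"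
          by (rule ennreal_le_epsilon) (simp add: small)
        then show ?thesis using 1 by (simp add: g_def p2)
      next
        case 2
        then show ?thesis using emeasure_codisc_le[OF p3 2] by (simp add: g_def)
      next
        case 3
        have "codisc z \<le> a" if "z \<in> space \<sigma>" for z using codisc_bounds[OF that] 3 by linarith
        then have "{x \<in> space \<sigma>. codisc x \<le> a} = space \<sigma>" by auto
        then show ?thesis using 3 by (simp add: g_def emeasure_space_1)
      qed
    qed
  qed measurable
  moreover have "distr \<sigma> borel codisc = distr \<sigma> lborel codisc" by (intro distr_cong) auto
  ultimately show ?thesis unfolding distributed_def f_def by simp
qed

end

section \<open>The likelihood ratio of the inner product\<close>

text \<open>Only even powers from the fourth on remain. Their non-negativity gives
  \<open>cosh_tail_nonneg\<close> and permits integration term by term.\<close>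

lemma cosh_tail_sums:
  fixes x :: real
  shows "(\<lambda>m. x ^ (2 * m + 4) / fact (2 * m + 4)) sums (cosh x - 1 - x\<^sup>2 / 2)"
proof -
  let ?f = "\<lambda>n. if even n then x ^ n /\<^sub>R fact n else 0"
  have "(\<lambda>m. ?f (2 * m)) sums cosh x"
    using cosh_converges[of x]
    by (subst sums_mono_reindex) (auto simp: strict_mono_def elim!: evenE)
  then have "(\<lambda>m. ?f (2 * (m + 2))) sums (cosh x - (\<Sum>m<2. ?f (2 * m)))"
    by (rule sums_split_initial_segment)
  also have "(\<Sum>m<2. ?f (2 * m)) = 1 + x\<^sup>2 / 2"
    by (simp add: numeral_2_eq_2 lessThan_Suc fact_numeral)
  also have "(\<lambda>m. ?f (2 * (m + 2))) = (\<lambda>m. x ^ (2 * m + 4) / fact (2 * m + 4))"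
  proof
    fix m :: nat
    have e: "2 * (m + 2) = 2 * m + 4" and ev: "even (2 * m + 4)" by simp_all
    show "?f (2 * (m + 2)) = x ^ (2 * m + 4) / fact (2 * m + 4)"
      unfolding e by (simp only: ev if_True real_scaleR_def divide_inverse_commute)
  qed
  finally show ?thesis by (simp only: diff_diff_eq)
qed

lemma cosh_tail_nonneg: "0 \<le> cosh x - 1 - x\<^sup>2 / 2" for x :: real
proof -
  have "0 \<le> x ^ (2 * m + 4) / fact (2 * m + 4)" for m by (intro divide_nonneg_pos zero_le_even_power) auto
  then show ?thesis using sums_le[OF _ sums_zero cosh_tail_sums[of x]] by blast
qed

context sphere_dim
begin

text \<open>For a normal variable with variance \<open>1 / p\<close> the integral of cosh would be
  exp u. Term by term, the moment bounds cancel \<open>fact (2 * m + 4)\<close> and leave the series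
  of exp u without its first two terms; \<open>fact (m + 2) \<ge> 2 * fact m\<close> then splits off
  the factor \<open>u\<^sup>2 / 2\<close>.\<close>

lemma nn_integral_cosh_tail:
  fixes y :: real
  defines "u \<equiv> y\<^sup>2 / (2 * real p)"
  shows "(\<integral>\<^sup>+z. ennreal (cosh (y * z 0) - 1 - (y * z 0)\<^sup>2 / 2) \<partial>\<sigma>) \<le> ennreal (u\<^sup>2 / 2 * exp u)"
proof -
  have p: "0 < real p" using p_ge_2 by simp
  have u: "0 \<le> u" using p by (simp add: u_def)
  have even_nn: "0 \<le> (x::real) ^ (2 * m + 4)" for x m by (intro zero_le_even_power) auto
  have "(\<integral>\<^sup>+z. ennreal (cosh (y * z 0) - 1 - (y * z 0)\<^sup>2 / 2) \<partial>\<sigma>)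
      = (\<integral>\<^sup>+z. (\<Sum>m. ennreal ((y * z 0) ^ (2 * m + 4) / fact (2 * m + 4))) \<partial>\<sigma>)"
    by (intro nn_integral_cong suminf_ennreal_eq[symmetric] cosh_tail_sums divide_nonneg_pos even_nn) simp
  also have "\<dots> = (\<Sum>m. \<integral>\<^sup>+z. ennreal ((y * z 0) ^ (2 * m + 4) / fact (2 * m + 4)) \<partial>\<sigma>)"
    by (rule nn_integral_suminf) measurable
  also have "\<dots> \<le> (\<Sum>m. ennreal (u\<^sup>2 / 2 * (u ^ m / fact m)))"
  proof (intro suminf_le summableI)
    fix m
    have "(\<integral>\<^sup>+z. ennreal ((y * z 0) ^ (2 * m + 4) / fact (2 * m + 4)) \<partial>\<sigma>)
        = ennreal (LINT z|\<sigma>. (y * z 0) ^ (2 * m + 4) / fact (2 * m + 4))"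
      by (intro nn_integral_eq_integral)
         (auto simp: power_mult_distrib intro!: integrable_mult_right integrable_divide integrable_coord_power
            AE_I2 divide_nonneg_pos mult_nonneg_nonneg even_nn)
    also have "(LINT z|\<sigma>. (y * z 0) ^ (2 * m + 4) / fact (2 * m + 4))
        = y ^ (2 * m + 4) * (LINT z|\<sigma>. z 0 ^ (2 * m + 4)) / fact (2 * m + 4)"
      by (simp only: power_mult_distrib integral_divide_zero integral_mult_right_zero)
    also have "\<dots> \<le> y ^ (2 * m + 4) * (fact (2 * m + 4) / (2 ^ (m + 2) * fact (m + 2) * real p ^ (m + 2))) / fact (2 * m + 4)"
    proof (intro divide_right_mono mult_left_mono even_nn)
      have "2 * (m + 2) = 2 * m + 4" by simp
      then show "(LINT z|\<sigma>. z 0 ^ (2 * m + 4)) \<le> fact (2 * m + 4) / (2 ^ (m + 2) * fact (m + 2) * real p ^ (m + 2))"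
        using moment_le[of "m + 2"] by (simp only:)
    qed simp
    also have "\<dots> = u ^ (m + 2) / fact (m + 2)"
    proof -
      have "2 * (m + 2) = 2 * m + 4" by simp
      then have "y ^ (2 * m + 4) = (y\<^sup>2) ^ (m + 2)" by (simp only: power_mult[symmetric])
      then show ?thesis unfolding u_def power_divide power_mult_distrib
        by simp
    qed
    also have "\<dots> = u\<^sup>2 * u ^ m / fact (m + 2)" by (simp only: power_add mult.commute)
    also have "\<dots> \<le> u\<^sup>2 * u ^ m / (2 * fact m)"
    proof -
      have "1 * 1 \<le> real (m + 1) * (real m / 2 + 1)" by (intro mult_mono) auto
      then have "2 * fact m * 1 \<le> 2 * fact m * (real (m + 1) * (real m / 2 + 1))"
        by (intro mult_left_mono) auto
      also have "\<dots> = fact (m + 2)" by (simp add: algebra_simps)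
      finally show ?thesis using u by (intro divide_left_mono) auto
    qed
    also have "\<dots> = u\<^sup>2 / 2 * (u ^ m / fact m)" by simp
    finally show "(\<integral>\<^sup>+z. ennreal ((y * z 0) ^ (2 * m + 4) / fact (2 * m + 4)) \<partial>\<sigma>)
        \<le> ennreal (u\<^sup>2 / 2 * (u ^ m / fact m))" by (simp add: ennreal_leI)
  qed
  also have "\<dots> = ennreal (u\<^sup>2 / 2 * exp u)"
  proof (rule suminf_ennreal_eq)
    show "(\<lambda>m. u\<^sup>2 / 2 * (u ^ m / fact m)) sums (u\<^sup>2 / 2 * exp u)"
      using exp_converges[of u] by (intro sums_mult) (simp add: divide_inverse mult.commute)
  qed (use u in auto)
  finally show ?thesis .
qed

lemma integrable_continuous_coords:
  fixes f :: "real \<Rightarrow> real \<Rightarrow> real"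
  assumes f: "continuous_on UNIV (\<lambda>x. f (fst x) (snd x))"
  shows "integrable \<sigma> (\<lambda>z. f (z 0) (z 1))"
proof -
  let ?g = "\<lambda>x. f (fst x) (snd x)"
  have "bounded (?g ` ({-1..1} \<times> {-1..1}))"
    by (intro compact_imp_bounded compact_continuous_image compact_Times compact_Icc continuous_on_subset[OF f]) auto
  then obtain B where B: "\<forall>v \<in> ?g ` ({-1..1} \<times> {-1..1}). norm v \<le> B"
    unfolding bounded_iff by blast
  have [measurable]: "?g \<in> borel_measurable (borel \<Otimes>\<^sub>M borel)"
    unfolding borel_prod by (rule borel_measurable_continuous_onI[OF f])
  show ?thesis
  proof (rule integrable_const_bound[where B=B])
    show "AE z in \<sigma>. norm (f (z 0) (z 1)) \<le> B"
    proof (intro AE_I2)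
      fix z assume "z \<in> space \<sigma>"
      then have "(z 0)\<^sup>2 \<le> 1" "(z 1)\<^sup>2 \<le> 1"
        using coords_in_disc[of z] zero_le_power2[of "z 0"] zero_le_power2[of "z 1"] by linarith+
      then have "\<bar>z 0\<bar> \<le> 1" "\<bar>z 1\<bar> \<le> 1" by (simp_all add: abs_square_le_1)
      then have "(z 0, z 1) \<in> {-1..1} \<times> {-1..1}" by (auto simp: abs_le_iff)
      from B[rule_format, OF imageI[OF this]] show "norm (f (z 0) (z 1)) \<le> B" by simp
    qed
    have "(\<lambda>z. ?g (z 0, z 1)) \<in> borel_measurable \<sigma>" unfolding One_nat_def by measurable
    then show "(\<lambda>z. f (z 0) (z 1)) \<in> borel_measurable \<sigma>" by simp
  qed
qed

lemma integral_disc: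
  fixes f :: "real \<Rightarrow> real"
  assumes p3: "3 \<le> p" and [measurable]: "f \<in> borel_measurable borel"
  shows "(LINT z|\<sigma>. f ((z 0)\<^sup>2 + (z 1)\<^sup>2))
       = real (p - 2) * (LINT c|lborel. f (1 - c\<^sup>2) * c ^ (p - 3) * indicator {0..1} c)"
proof -
  have "(LINT z|\<sigma>. f ((z 0)\<^sup>2 + (z 1)\<^sup>2)) = (LINT z|\<sigma>. f (1 - (codisc z)\<^sup>2))"
    using codisc_square by (intro Bochner_Integration.integral_cong) auto
  also have "\<dots> = (LINT c|distr \<sigma> borel codisc. f (1 - c\<^sup>2))"
    by (subst integral_distr) auto
  also have "\<dots> = (LINT c|lborel. (indicator {0..1} c * (real (p - 2) * c ^ (p - 3))) * f (1 - c\<^sup>2))"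
    unfolding distr_codisc[OF p3]
    by (subst integral_real_density) (auto split: split_indicator)
  also have "\<dots> = (LINT c|lborel. real (p - 2) * (f (1 - c\<^sup>2) * c ^ (p - 3) * indicator {0..1} c))"
    by (intro Bochner_Integration.integral_cong) auto
  finally show ?thesis by simp
qed

lemma tilt_decomposition:
  fixes \<kappa> :: real
  defines "R \<equiv> \<lambda>z::nat \<Rightarrow> real. (z 0)\<^sup>2 + (z 1)\<^sup>2" and "D \<equiv> \<lambda>z::nat \<Rightarrow> real. (z 0)\<^sup>2 - (z 1)\<^sup>2"
  shows "tilt \<kappa> w = (LINT z|\<sigma>. exp (\<kappa> * R z)) + \<kappa>\<^sup>2 / 4 * (LINT z|\<sigma>. exp (\<kappa> * R z) * (R z)\<^sup>2) * w\<^sup>2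
      + (LINT z|\<sigma>. exp (\<kappa> * R z) * (cosh (\<kappa> * w * D z) - 1 - (\<kappa> * w * D z)\<^sup>2 / 2))"
proof -
  let ?E = "\<lambda>f. LINT z|\<sigma>. f (z 0) (z 1)"
  \<comment> \<open>Turning the coordinates by 45 degrees replaces D by \<open>2 * s * t\<close>,
    and D^2 + (2 s t)^2 = R^2. So D^2 has half the integral of R^2 against the radial weight, which
    explains the 1 / 4 in the coefficient of \<open>w\<^sup>2\<close>.\<close>
  have D2: "?E (\<lambda>s t. exp (\<kappa> * (s\<^sup>2 + t\<^sup>2)) * (s\<^sup>2 - t\<^sup>2)\<^sup>2) = ?E (\<lambda>s t. exp (\<kappa> * (s\<^sup>2 + t\<^sup>2)) * (2 * s * t)\<^sup>2)"
  proof -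
    let ?h = "1 / sqrt 2 :: real"
    have h: "?h\<^sup>2 = 1 / 2" by (simp add: power_divide)
    have *: "(?h * s + ?h * t)\<^sup>2 + (?h * s - ?h * t)\<^sup>2 = s\<^sup>2 + t\<^sup>2"
      "(?h * s + ?h * t)\<^sup>2 - (?h * s - ?h * t)\<^sup>2 = 2 * s * t" for s t
    proof -
      have "(?h * s + ?h * t)\<^sup>2 = ?h\<^sup>2 * (s + t)\<^sup>2" "(?h * s - ?h * t)\<^sup>2 = ?h\<^sup>2 * (s - t)\<^sup>2"
        by (simp_all add: power2_eq_square algebra_simps)
      then show "(?h * s + ?h * t)\<^sup>2 + (?h * s - ?h * t)\<^sup>2 = s\<^sup>2 + t\<^sup>2"
        "(?h * s + ?h * t)\<^sup>2 - (?h * s - ?h * t)\<^sup>2 = 2 * s * t"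
        unfolding h by (simp_all add: power2_eq_square algebra_simps)
    qed
    show ?thesis
      by (subst integral_rotate_coords[of ?h ?h "\<lambda>s t. exp (\<kappa> * (s\<^sup>2 + t\<^sup>2)) * (s\<^sup>2 - t\<^sup>2)\<^sup>2"])
         (use h in \<open>simp_all only: * , simp_all\<close>)
  qed
  have "?E (\<lambda>s t. exp (\<kappa> * (s\<^sup>2 + t\<^sup>2)) * (s\<^sup>2 - t\<^sup>2)\<^sup>2) + ?E (\<lambda>s t. exp (\<kappa> * (s\<^sup>2 + t\<^sup>2)) * (2 * s * t)\<^sup>2)
      = ?E (\<lambda>s t. exp (\<kappa> * (s\<^sup>2 + t\<^sup>2)) * (s\<^sup>2 - t\<^sup>2)\<^sup>2 + exp (\<kappa> * (s\<^sup>2 + t\<^sup>2)) * (2 * s * t)\<^sup>2)"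
    by (intro Bochner_Integration.integral_add[symmetric] integrable_continuous_coords continuous_intros)
  also have "\<dots> = ?E (\<lambda>s t. exp (\<kappa> * (s\<^sup>2 + t\<^sup>2)) * (s\<^sup>2 + t\<^sup>2)\<^sup>2)"
    by (intro Bochner_Integration.integral_cong refl) (simp add: power2_eq_square algebra_simps)
  finally have half: "(LINT z|\<sigma>. exp (\<kappa> * R z) * (D z)\<^sup>2) = (LINT z|\<sigma>. exp (\<kappa> * R z) * (R z)\<^sup>2) / 2"
    unfolding D2[symmetric] R_def D_def by simp
  have int: "integrable \<sigma> (\<lambda>z. exp (\<kappa> * R z))"
    "integrable \<sigma> (\<lambda>z. exp (\<kappa> * R z) * (D z)\<^sup>2)"
    "integrable \<sigma> (\<lambda>z. exp (\<kappa> * R z) * (cosh (\<kappa> * w * D z) - 1 - (\<kappa> * w * D z)\<^sup>2 / 2))"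
    unfolding R_def D_def
    by (rule integrable_continuous_coords[of "\<lambda>s t. exp (\<kappa> * (s\<^sup>2 + t\<^sup>2))"], intro continuous_intros)
       (rule integrable_continuous_coords[of "\<lambda>s t. exp (\<kappa> * (s\<^sup>2 + t\<^sup>2)) * (s\<^sup>2 - t\<^sup>2)\<^sup>2"], intro continuous_intros,
        rule integrable_continuous_coords[of "\<lambda>s t. exp (\<kappa> * (s\<^sup>2 + t\<^sup>2)) *
          (cosh (\<kappa> * w * (s\<^sup>2 - t\<^sup>2)) - 1 - (\<kappa> * w * (s\<^sup>2 - t\<^sup>2))\<^sup>2 / 2)"], intro continuous_intros, simp_all)
  have "tilt \<kappa> w = (LINT z|\<sigma>. exp (\<kappa> * R z) + (\<kappa> * w)\<^sup>2 / 2 * (exp (\<kappa> * R z) * (D z)\<^sup>2)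
      + exp (\<kappa> * R z) * (cosh (\<kappa> * w * D z) - 1 - (\<kappa> * w * D z)\<^sup>2 / 2))"
  proof -
    have "E * C = E + k / 2 * (E * d) + E * (C - 1 - (k * d) / 2)" for E C k d :: real
      by (simp add: algebra_simps)
    then show ?thesis
      unfolding tilt_def R_def D_def power_mult_distrib[of "\<kappa> * w"]
      by (intro Bochner_Integration.integral_cong refl)
  qed
  also have "\<dots> = (LINT z|\<sigma>. exp (\<kappa> * R z)) + (\<kappa> * w)\<^sup>2 / 2 * (LINT z|\<sigma>. exp (\<kappa> * R z) * (D z)\<^sup>2)
      + (LINT z|\<sigma>. exp (\<kappa> * R z) * (cosh (\<kappa> * w * D z) - 1 - (\<kappa> * w * D z)\<^sup>2 / 2))"
    using int by (subst Bochner_Integration.integral_add, simp, simp, subst Bochner_Integration.integral_add) auto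
  finally show ?thesis by (simp add: half power_mult_distrib mult.commute mult.left_commute)
qed

end

section \<open>Exponential moments of two coordinates\<close>

text \<open>Up to the factor \<open>p - 2\<close> this is the expectation of \<open>exp (\<kappa> R) R\<^sup>k\<close> for \<open>R = (z 0)\<^sup>2 + (z 1)\<^sup>2\<close>, in terms
  of \<open>c = sqrt (1 - R)\<close>.\<close>

definition gap_integral :: "nat \<Rightarrow> real \<Rightarrow> nat \<Rightarrow> real" where
  "gap_integral p \<kappa> k = (LINT c|lborel. exp (\<kappa> * (1 - c\<^sup>2)) * (1 - c\<^sup>2) ^ k * c ^ (p - 3) * indicator {0..1} c)"

text \<open>Integrates the derivative of exp (\<kappa> r) r^k c^(p-2), with r = 1 - c^2, over
  [0, 1]. The boundary value at c = 1 is \<open>0 ^ k\<close>, which is 1 for \<open>k = 0\<close>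
  only, and c = 0 contributes nothing since \<open>p \<ge> 3\<close>. For \<open>k = 0\<close> the
  truncated \<open>k - 1\<close> is harmless, as its term has the factor
  \<open>real k\<close>.\<close>

lemma gap_integral_recursion:
  assumes p: "3 \<le> p"
  shows "real (p - 2) * gap_integral p \<kappa> k - 2 * \<kappa> * (gap_integral p \<kappa> k - gap_integral p \<kappa> (Suc k))
      - 2 * real k * (gap_integral p \<kappa> (k - 1) - gap_integral p \<kappa> k) = 0 ^ k"
proof -
  define m where "m = p - 3"
  have m: "p - 2 = Suc m" "p - 3 = m" using p by (auto simp: m_def)
  define j where "j k c = exp (\<kappa> * (1 - c\<^sup>2)) * (1 - c\<^sup>2) ^ k * c ^ m" for k and c :: real
  define f where "f c = real (Suc m) * j k c - 2 * \<kappa> * (j k c - j (Suc k) c) - 2 * real k * (j (k - 1) c - j k c)" for c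
  define F where "F c = exp (\<kappa> * (1 - c\<^sup>2)) * (1 - c\<^sup>2) ^ k * c ^ Suc m" for c :: real
  have cont: "isCont (j k) c" for k c unfolding j_def by (intro continuous_intros)
  have int: "integrable lborel (\<lambda>c. j k c * indicator {0..1} c)" for k
    by (rule borel_integrable_atLeastAtMost) (rule cont)
  have J: "gap_integral p \<kappa> k = (LINT c|lborel. j k c * indicator {0..1} c)" for k
    by (simp add: gap_integral_def j_def m)
  have deriv: "(F has_real_derivative f c) (at c)" for c
  proof -
    let ?e = "exp (\<kappa> * (1 - c\<^sup>2))" and ?r = "1 - c\<^sup>2"
    have "(F has_real_derivative
       (?e * (\<kappa> * (- 2 * c)) * ?r ^ k + real k * ?r ^ (k - 1) * (- 2 * c) * ?e) * c ^ Suc m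
         + real (Suc m) * c ^ m * (?e * ?r ^ k)) (at c)"
      unfolding F_def by (rule derivative_eq_intros | simp)+
    moreover have "(?e * (\<kappa> * (- 2 * c)) * ?r ^ k + real k * ?r ^ (k - 1) * (- 2 * c) * ?e) * c ^ Suc m
         + real (Suc m) * c ^ m * (?e * ?r ^ k) = f c"
    proof -
      have "real k * ?r ^ (k - 1) * ?r = real k * ?r ^ k" by (cases k) auto
      moreover have "real k * j (k - 1) c * ?r = (real k * ?r ^ (k - 1) * ?r) * (?e * c ^ m)"
        by (simp only: j_def mult_ac)
      ultimately have k1: "real k * j (k - 1) c * ?r = real k * j k c"
        by (simp only: j_def mult_ac)
      have j1: "j (Suc k) c = j k c * ?r" by (simp add: j_def)
      have "(?e * (\<kappa> * (- 2 * c)) * ?r ^ k + real k * ?r ^ (k - 1) * (- 2 * c) * ?e) * c ^ Suc m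
         + real (Suc m) * c ^ m * (?e * ?r ^ k)
         = real (Suc m) * j k c - 2 * \<kappa> * (j k c * c\<^sup>2) - 2 * (real k * j (k - 1) c * c\<^sup>2)"
        unfolding j_def by (simp add: power2_eq_square algebra_simps)
      also have "\<dots> = real (Suc m) * j k c - 2 * \<kappa> * (j k c - j k c * ?r) - 2 * (real k * j (k - 1) c - real k * j (k - 1) c * ?r)"
        by (simp add: algebra_simps)
      also have "\<dots> = f c" unfolding k1 j1[symmetric] f_def by (simp add: algebra_simps)
      finally show ?thesis .
    qed
    ultimately show ?thesis by simp
  qed
  have "(LINT c|lborel. f c * indicator {0..1} c) = F 1 - F 0"
  proof (rule integral_FTC_Icc_real)
    show "isCont f c" for c unfolding f_def by (intro continuous_intros cont)
  qed (simp_all add: deriv)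
  also have "\<dots> = 0 ^ k" by (simp add: F_def)
  finally have "0 ^ k = (LINT c|lborel. f c * indicator {0..1} c)" ..
  also have "\<dots> = (LINT c|lborel. real (Suc m) * (j k c * indicator {0..1} c)
      - 2 * \<kappa> * (j k c * indicator {0..1} c - j (Suc k) c * indicator {0..1} c)
      - 2 * real k * (j (k - 1) c * indicator {0..1} c - j k c * indicator {0..1} c))"
    unfolding f_def by (intro Bochner_Integration.integral_cong refl) (simp add: left_diff_distrib mult.assoc)
  also have "\<dots> = real (Suc m) * gap_integral p \<kappa> k - 2 * \<kappa> * (gap_integral p \<kappa> k - gap_integral p \<kappa> (Suc k))
      - 2 * real k * (gap_integral p \<kappa> (k - 1) - gap_integral p \<kappa> k)"
    unfolding J using int by simp
  finally show ?thesis by (simp add: m)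
qed

lemma gap_integral_nonneg: "0 \<le> gap_integral p \<kappa> k"
proof -
  have "0 \<le> exp (\<kappa> * (1 - c\<^sup>2)) * (1 - c\<^sup>2) ^ k * c ^ (p - 3) * indicator {0..1} c" for c :: real
    by (cases "c \<in> {0..1}") (auto simp: power_le_one)
  then show ?thesis unfolding gap_integral_def by (intro Bochner_Integration.integral_nonneg)
qed

text \<open>The recursion reads (l + k - 1) J_k + \<kappa> J_(k+1) = k J_(k-1) for k \<ge> 1, with 1
  / 2 on the right for k = 0. Dropping the non-negative \<kappa> terms gives upper bounds, and
  inserting these back gives the lower bounds: the 5 is 2 + 3, from the \<kappa> terms for k = 1 and
  k = 2.\<close>

lemma gap_integral_bounds:
  fixes p :: nat and \<kappa> :: real
  defines "l \<equiv> real p / 2 - \<kappa>" and "J \<equiv> gap_integral p \<kappa>"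
  assumes p: "3 \<le> p" and \<kappa>: "0 < \<kappa>" "\<kappa> < real p / 2"
  shows "l * (l + 1) * J 2 \<le> 2 * J 0"
    and "2 * J 0 * (1 - 5 * (\<kappa> / l\<^sup>2)) \<le> l * (l + 1) * J 2"
    and "1 / 2 \<le> J 0 * (l * (1 + \<kappa> / l\<^sup>2))"
proof -
  have l: "0 < l" using \<kappa> by (simp add: l_def)
  have J_nn: "0 \<le> J k" for k by (simp add: J_def gap_integral_nonneg)
  have rec: "(2 * l - 2) * J k + 2 * \<kappa> * J (Suc k) - 2 * real k * (J (k - 1) - J k) = 0 ^ k" for k
  proof -
    have "real (p - 2) = 2 * l - 2 + 2 * \<kappa>" using p by (simp add: l_def)
    from gap_integral_recursion[OF p, of \<kappa> k, unfolded this] show ?thesis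
      by (simp add: J_def algebra_simps)
  qed
  have r0: "(l - 1) * J 0 + \<kappa> * J 1 = 1 / 2" using rec[of 0] by (simp add: algebra_simps)
  have r1: "l * J 1 + \<kappa> * J 2 = J 0" using rec[of 1] by (simp add: algebra_simps numeral_2_eq_2)
  have r2: "(l + 1) * J 2 + \<kappa> * J 3 = 2 * J 1" using rec[of 2] by (simp add: algebra_simps numeral_3_eq_3 numeral_2_eq_2)
  have r3: "(l + 2) * J 3 + \<kappa> * J 4 = 3 * J 2" using rec[of 3] by (simp add: algebra_simps eval_nat_numeral)
  have \<kappa>J: "0 \<le> \<kappa> * J k" for k using \<kappa> J_nn by simp
  have b1: "l * J 1 \<le> J 0" using r1 \<kappa>J[of 2] by linarith
  have b2: "(l + 1) * J 2 \<le> 2 * J 1" using r2 \<kappa>J[of 3] by linarith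
  have "l * ((l + 1) * J 2) \<le> l * (2 * J 1)" using b2 l by (intro mult_left_mono) auto
  with b1 show 1: "l * (l + 1) * J 2 \<le> 2 * J 0" by (simp add: algebra_simps)
  have b2': "l\<^sup>2 * J 2 \<le> 2 * J 0"
  proof -
    have "l * (l + 1) * J 2 = l\<^sup>2 * J 2 + l * J 2" by (simp add: power2_eq_square algebra_simps)
    moreover have "0 \<le> l * J 2" using l J_nn[of 2] by simp
    ultimately show ?thesis using 1 by linarith
  qed
  have b3: "l * J 3 \<le> 3 * J 2" using r3 \<kappa>J[of 4] J_nn[of 3] by (simp add: algebra_simps)
  have J2: "J 2 \<le> 2 * J 0 / l\<^sup>2" using b2' l by (simp add: field_simps)
  have "(l + 1) * J 2 = 2 * J 1 - \<kappa> * J 3" using r2 by linarith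
  then have "l * (l + 1) * J 2 = l * (2 * J 1 - \<kappa> * J 3)" by (simp only: mult.assoc)
  also have "\<dots> = 2 * (J 0 - \<kappa> * J 2) - \<kappa> * (l * J 3)" using r1 by (simp add: algebra_simps)
  also have "\<dots> \<ge> 2 * (J 0 - \<kappa> * J 2) - \<kappa> * (3 * J 2)" using b3 \<kappa> by (intro diff_left_mono mult_left_mono) auto
  finally have lower: "2 * J 0 - 5 * (\<kappa> * J 2) \<le> l * (l + 1) * J 2" by (simp add: algebra_simps)
  have "2 * J 0 * (1 - 5 * (\<kappa> / l\<^sup>2)) = 2 * J 0 - 5 * (\<kappa> * (2 * J 0 / l\<^sup>2))" by (simp add: algebra_simps)
  also have "\<dots> \<le> 2 * J 0 - 5 * (\<kappa> * J 2)"
    using J2 \<kappa> by (intro diff_left_mono mult_left_mono) auto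
  also note lower
  finally show "2 * J 0 * (1 - 5 * (\<kappa> / l\<^sup>2)) \<le> l * (l + 1) * J 2" .
  have "\<kappa> * J 1 \<le> \<kappa> * (J 0 / l)" using b1 l \<kappa> by (intro mult_left_mono) (auto simp: field_simps)
  moreover have "1 / 2 \<le> l * J 0 + \<kappa> * J 1" using r0 J_nn[of 0] by (simp add: left_diff_distrib)
  ultimately have "1 / 2 \<le> l * J 0 + \<kappa> * (J 0 / l)" by (rule order_trans[OF _ add_left_mono, rotated])
  also have "\<dots> = J 0 * (l * (1 + \<kappa> / l\<^sup>2))" using l by (simp add: field_simps power2_eq_square)
  finally show "1 / 2 \<le> J 0 * (l * (1 + \<kappa> / l\<^sup>2))" .
qed

section \<open>A fourth moment with an additional quadratic exponent\<close>

lemma one_minus_le_exp_quadratic: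
  fixes r :: real
  assumes "0 \<le> r" shows "1 - r \<le> exp (- r - r\<^sup>2 / 2)"
proof -
  have "(1 - r) * exp (r + r\<^sup>2 / 2) \<le> (1 - 0) * exp (0 + 0\<^sup>2 / 2)"
  proof (rule DERIV_nonpos_imp_nonincreasing[OF assms])
    fix x :: real
    have "((\<lambda>x. (1 - x) * exp (x + x\<^sup>2 / 2)) has_real_derivative - (x\<^sup>2) * exp (x + x\<^sup>2 / 2)) (at x)"
      by (auto intro!: derivative_eq_intros simp: power2_eq_square algebra_simps)
    moreover have "- (x\<^sup>2) * exp (x + x\<^sup>2 / 2) \<le> 0" by simp
    ultimately show "\<exists>y. ((\<lambda>x. (1 - x) * exp (x + x\<^sup>2 / 2)) has_real_derivative y) (at x) \<and> y \<le> 0" by blast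
  qed
  then have "(1 - r) * exp (r + r\<^sup>2 / 2) * exp (- r - r\<^sup>2 / 2) \<le> 1 * exp (- r - r\<^sup>2 / 2)"
    by (intro mult_right_mono) auto
  then show ?thesis by (simp add: mult.assoc exp_add[symmetric])
qed

lemma power4_le_exp:
  fixes x :: real
  assumes "0 \<le> x" shows "x ^ 4 \<le> 64 * exp x"
proof -
  have "1 + x / 2 + (x / 2)\<^sup>2 / 2 \<le> exp (x / 2)"
    using assms by (intro exp_lower_Taylor_quadratic) simp
  then have "x\<^sup>2 / 8 \<le> exp (x / 2)" using assms by (simp add: power_divide)
  then have "(x\<^sup>2 / 8)\<^sup>2 \<le> (exp (x / 2))\<^sup>2" by (intro power_mono) auto
  also have "(exp (x / 2))\<^sup>2 = exp x" by (simp add: exp_double[symmetric])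
  finally show ?thesis by (simp add: power_divide power_mult[symmetric])
qed

text \<open>With \<open>r = 1 - c\<^sup>2\<close>, the factor \<open>c ^ (p - 4)\<close> is at most \<open>exp (- p r / 2 - p r\<^sup>2 / 4)\<close> up to a
  constant, and the quadratic term absorbs \<open>exp (p r\<^sup>2 / 8)\<close>.\<close>

lemma gap_tail_bound:
  fixes p :: nat and \<kappa> :: real
  defines "l \<equiv> real p / 2 - \<kappa>"
  assumes p: "4 \<le> p" and \<kappa>: "0 < \<kappa>" "\<kappa> < real p / 2"
  shows "(LINT c|lborel. (exp (\<kappa> * (1 - c\<^sup>2)) * exp (real p / 8 * (1 - c\<^sup>2)\<^sup>2) * (1 - c\<^sup>2) ^ 4)
            * c ^ (p - 3) * indicator {0..1} c) \<le> 1024 * exp 3 / l ^ 5"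
proof -
  have l: "0 < l" using \<kappa> by (simp add: l_def)
  let ?f = "\<lambda>c. (exp (\<kappa> * (1 - c\<^sup>2)) * exp (real p / 8 * (1 - c\<^sup>2)\<^sup>2) * (1 - c\<^sup>2) ^ 4) * c ^ (p - 3)"
  let ?g = "\<lambda>c. 1024 * exp 3 / l ^ 4 * (c * exp (- l / 2 * (1 - c\<^sup>2)))"
  have le: "?f c \<le> ?g c" if c: "c \<in> {0..1}" for c
  proof -
    define r where "r = 1 - c\<^sup>2"
    have r: "0 \<le> r" "r \<le> 1" using c by (auto simp: r_def power_le_one)
    have "c\<^sup>2 \<le> exp (- r - r\<^sup>2 / 2)" using one_minus_le_exp_quadratic[OF r(1)] by (simp add: r_def)
    also have "\<dots> = (exp ((- r - r\<^sup>2 / 2) / 2))\<^sup>2" by (simp add: exp_double[symmetric])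
    finally have "c \<le> exp ((- r - r\<^sup>2 / 2) / 2)" by (rule power2_le_imp_le) simp
    then have "c ^ (p - 4) \<le> exp ((- r - r\<^sup>2 / 2) / 2) ^ (p - 4)" using c by (intro power_mono) auto
    also have "\<dots> = exp (real (p - 4) * ((- r - r\<^sup>2 / 2) / 2))" by (simp only: exp_of_nat_mult)
    finally have cp: "c ^ (p - 4) \<le> exp (real (p - 4) * ((- r - r\<^sup>2 / 2) / 2))" .
    \<comment> \<open>Half of the decay rate \<open>l\<close> is spent on the fourth power; 1024 is
      64 * 2^4.\<close>
    have r4: "r ^ 4 \<le> 1024 / l ^ 4 * exp (l / 2 * r)"
    proof -
      have "(l / 2 * r) ^ 4 \<le> 64 * exp (l / 2 * r)" using l r by (intro power4_le_exp) simp
      then show ?thesis using l by (simp add: power_mult_distrib power_divide field_simps)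
    qed
    have "exp (\<kappa> * r) * exp (real p / 8 * r\<^sup>2) * exp (real (p - 4) * ((- r - r\<^sup>2 / 2) / 2))
        = exp (- l * r + 2 * r + r\<^sup>2 - real p / 8 * r\<^sup>2)"
    proof -
      have "real (p - 4) = real p - 4" using p by simp
      then show ?thesis unfolding exp_add[symmetric] l_def
        by (intro arg_cong[where f=exp]) (simp add: field_simps)
    qed
    \<comment> \<open>The surplus \<open>2 * r + r\<^sup>2\<close> stems from the exponent
      \<open>p - 4\<close> in place of \<open>p\<close> and is at most 3. The leftover quadratic
      term is negative and is dropped.\<close>
    also have "\<dots> \<le> exp (3 - l * r)"
    proof -
      have "r\<^sup>2 \<le> 1" using r by (simp add: power_le_one)
      moreover have "0 \<le> real p / 8 * r\<^sup>2" by simp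
      ultimately show ?thesis unfolding exp_le_cancel_iff using r by linarith
    qed
    finally have ex: "exp (\<kappa> * r) * exp (real p / 8 * r\<^sup>2) * exp (real (p - 4) * ((- r - r\<^sup>2 / 2) / 2))
        \<le> exp (3 - l * r)" .
    \<comment> \<open>One factor \<open>c\<close> is kept apart: it makes the majorant
      \<open>?g\<close> an exact derivative.\<close>
    have "p - 3 = Suc (p - 4)" using p by simp
    then have "?f c = exp (\<kappa> * r) * exp (real p / 8 * r\<^sup>2) * c ^ (p - 4) * r ^ 4 * c" by (simp add: r_def)
    also have "\<dots> \<le> exp (\<kappa> * r) * exp (real p / 8 * r\<^sup>2) * exp (real (p - 4) * ((- r - r\<^sup>2 / 2) / 2)) * r ^ 4 * c"
      using c cp r by (intro mult_right_mono mult_left_mono) auto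
    also have "\<dots> \<le> exp (3 - l * r) * (1024 / l ^ 4 * exp (l / 2 * r)) * c"
      using c ex r4 r by (intro mult_right_mono mult_mono) auto
    also have "\<dots> = 1024 / l ^ 4 * (exp (3 - l * r) * exp (l / 2 * r)) * c" by simp
    also have "exp (3 - l * r) * exp (l / 2 * r) = exp 3 * exp (- l / 2 * r)"
      unfolding exp_add[symmetric] by simp
    finally show ?thesis by (simp add: r_def mult_ac)
  qed
  have g_FTC: "(LINT c|lborel. ?g c * indicator {0..1} c)
      = 1024 * exp 3 / l ^ 4 * (exp (- l / 2 * (1 - 1\<^sup>2)) / l) - 1024 * exp 3 / l ^ 4 * (exp (- l / 2 * (1 - 0\<^sup>2)) / l)"
  proof (rule integral_FTC_Icc_real)
    show "((\<lambda>c. 1024 * exp 3 / l ^ 4 * (exp (- l / 2 * (1 - c\<^sup>2)) / l)) has_real_derivative ?g c) (at c)" for c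
      using l by (auto intro!: derivative_eq_intros simp: field_simps)
  qed (use l in \<open>auto intro!: continuous_intros\<close>)
  have "(LINT c|lborel. ?f c * indicator {0..1} c) \<le> (LINT c|lborel. ?g c * indicator {0..1} c)"
    by (intro integral_mono borel_integrable_atLeastAtMost)
       (use l in \<open>auto intro!: continuous_intros le[simplified] split: split_indicator\<close>)
  also have "\<dots> \<le> 1024 * exp 3 / l ^ 4 * (1 / l)"
    unfolding g_FTC using l by (simp add: field_simps)
  finally show ?thesis by (simp add: eval_nat_numeral mult.assoc mult.commute)
qed

section \<open>Expansion of the distribution function\<close>

context sphere_dim
begin

definition tilt_rest :: "real \<Rightarrow> real \<Rightarrow> real" where
  "tilt_rest \<kappa> w = (LINT z|\<sigma>. exp (\<kappa> * ((z 0)\<^sup>2 + (z 1)\<^sup>2)) *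
     (cosh (\<kappa> * w * ((z 0)\<^sup>2 - (z 1)\<^sup>2)) - 1 - (\<kappa> * w * ((z 0)\<^sup>2 - (z 1)\<^sup>2))\<^sup>2 / 2))"

lemma measurable_tilt_rest [measurable]: "tilt_rest \<kappa> \<in> borel_measurable borel"
  unfolding tilt_rest_def cosh_def One_nat_def by measurable

lemma tilt_rest_nonneg: "0 \<le> tilt_rest \<kappa> w"
  unfolding tilt_rest_def by (intro Bochner_Integration.integral_nonneg mult_nonneg_nonneg cosh_tail_nonneg) simp

text \<open>After Fubini the coordinate \<open>x 0\<close> is integrated first, at fixed
  \<open>z\<close>, where the bound for the cosh tail applies. Since |D| \<le> R, what is left
  depends on R alone and is a case of \<open>gap_tail_bound\<close>.\<close>

lemma nn_integral_tilt_rest_le: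
  assumes p4: "4 \<le> p" and \<kappa>: "0 < \<kappa>" "\<kappa> < real p / 2"
  shows "(\<integral>\<^sup>+x. ennreal (tilt_rest \<kappa> (x 0)) \<partial>\<sigma>)
    \<le> ennreal (real (p - 2) * (\<kappa> ^ 4 / (8 * (real p)\<^sup>2) * (1024 * exp 3 / (real p / 2 - \<kappa>) ^ 5)))"
proof -
  define R where "R z = (z 0)\<^sup>2 + (z 1)\<^sup>2" for z :: "nat \<Rightarrow> real"
  define D where "D z = (z 0)\<^sup>2 - (z 1)\<^sup>2" for z :: "nat \<Rightarrow> real"
  define h where "h x = cosh x - 1 - x\<^sup>2 / 2" for x :: real
  have p: "0 < real p" using p4 by simp
  have [measurable]: "R \<in> borel_measurable \<sigma>" "D \<in> borel_measurable \<sigma>"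
    unfolding R_def D_def One_nat_def by measurable
  have [measurable]: "h \<in> borel_measurable borel" unfolding h_def cosh_def by measurable
  have h_nn: "0 \<le> h x" for x unfolding h_def by (rule cosh_tail_nonneg)
  have rest: "ennreal (tilt_rest \<kappa> w) = (\<integral>\<^sup>+z. ennreal (exp (\<kappa> * R z)) * ennreal (h (\<kappa> * D z * w)) \<partial>\<sigma>)" for w
  proof -
    have "integrable \<sigma> (\<lambda>z. exp (\<kappa> * R z) * h (\<kappa> * w * D z))"
      unfolding R_def D_def h_def
      by (rule integrable_continuous_coords[of "\<lambda>s t. exp (\<kappa> * (s\<^sup>2 + t\<^sup>2)) *
          (cosh (\<kappa> * w * (s\<^sup>2 - t\<^sup>2)) - 1 - (\<kappa> * w * (s\<^sup>2 - t\<^sup>2))\<^sup>2 / 2)"]) (intro continuous_intros, simp_all)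
    then have "(\<integral>\<^sup>+z. ennreal (exp (\<kappa> * R z) * h (\<kappa> * w * D z)) \<partial>\<sigma>) = ennreal (tilt_rest \<kappa> w)"
      unfolding tilt_rest_def R_def D_def h_def
      by (intro nn_integral_eq_integral AE_I2 mult_nonneg_nonneg cosh_tail_nonneg) simp_all
    then show ?thesis by (simp add: ennreal_mult h_nn mult_ac)
  qed
  have "(\<integral>\<^sup>+x. ennreal (tilt_rest \<kappa> (x 0)) \<partial>\<sigma>)
      = (\<integral>\<^sup>+z. \<integral>\<^sup>+x. ennreal (exp (\<kappa> * R z)) * ennreal (h (\<kappa> * D z * x 0)) \<partial>\<sigma> \<partial>\<sigma>)"
    unfolding rest by (rule sigma_pair.Fubini') measurable
  also have "\<dots> \<le> (\<integral>\<^sup>+z. ennreal (\<kappa> ^ 4 / (8 * (real p)\<^sup>2) * (exp (\<kappa> * R z) * exp (real p / 8 * (R z)\<^sup>2) * R z ^ 4)) \<partial>\<sigma>)"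
  proof (intro nn_integral_mono)
    fix z assume z: "z \<in> space \<sigma>"
    have R: "0 \<le> R z" by (simp add: R_def)
    let ?u = "(\<kappa> * D z)\<^sup>2 / (2 * real p)" and ?y = "(\<kappa> * R z)\<^sup>2 / (2 * real p)"
    have "\<bar>D z\<bar> \<le> R z" unfolding D_def R_def using zero_le_power2[of "z 0"] zero_le_power2[of "z 1"] by linarith
    then have "(D z)\<^sup>2 \<le> (R z)\<^sup>2" using R by (simp add: abs_le_square_iff[symmetric])
    then have uy: "?u \<le> ?y" using p by (intro divide_right_mono) (auto simp: power_mult_distrib intro!: mult_left_mono)
    have u0: "0 \<le> ?u" using p by simp
    \<comment> \<open>The condition \<kappa> < p / 2 bounds the exponent by p / 8 times R^2, the
      weight that \<open>gap_tail_bound\<close> can absorb.\<close>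
    have "\<kappa>\<^sup>2 \<le> (real p / 2)\<^sup>2" using \<kappa> by (intro power_mono) auto
    then have "\<kappa>\<^sup>2 / (2 * real p) \<le> (real p / 2)\<^sup>2 / (2 * real p)" using p by (intro divide_right_mono) auto
    also have "\<dots> = real p / 8" using p by (simp add: power2_eq_square)
    finally have "\<kappa>\<^sup>2 / (2 * real p) * (R z)\<^sup>2 \<le> real p / 8 * (R z)\<^sup>2" by (rule mult_right_mono) simp
    then have y8: "?y \<le> real p / 8 * (R z)\<^sup>2" by (simp add: power_mult_distrib)
    have "(\<integral>\<^sup>+x. ennreal (exp (\<kappa> * R z)) * ennreal (h (\<kappa> * D z * x 0)) \<partial>\<sigma>)
        = ennreal (exp (\<kappa> * R z)) * (\<integral>\<^sup>+x. ennreal (h (\<kappa> * D z * x 0)) \<partial>\<sigma>)"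
      by (rule nn_integral_cmult) measurable
    also have "\<dots> \<le> ennreal (exp (\<kappa> * R z)) * ennreal (?u\<^sup>2 / 2 * exp ?u)"
      unfolding h_def by (intro mult_left_mono nn_integral_cosh_tail) simp
    also have "\<dots> = ennreal (exp (\<kappa> * R z) * (?u\<^sup>2 / 2 * exp ?u))"
      by (subst ennreal_mult) auto
    also have "\<dots> \<le> ennreal (exp (\<kappa> * R z) * (?y\<^sup>2 / 2 * exp (real p / 8 * (R z)\<^sup>2)))"
    proof (intro ennreal_leI mult_left_mono)
      have "?u\<^sup>2 / 2 \<le> ?y\<^sup>2 / 2" using power_mono[OF uy u0, of 2] by simp
      moreover have "exp ?u \<le> exp (real p / 8 * (R z)\<^sup>2)" using order_trans[OF uy y8] by simp
      ultimately show "?u\<^sup>2 / 2 * exp ?u \<le> ?y\<^sup>2 / 2 * exp (real p / 8 * (R z)\<^sup>2)"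
        by (rule mult_mono) simp_all
    qed simp
    also have "exp (\<kappa> * R z) * (?y\<^sup>2 / 2 * exp (real p / 8 * (R z)\<^sup>2))
        = \<kappa> ^ 4 / (8 * (real p)\<^sup>2) * (exp (\<kappa> * R z) * exp (real p / 8 * (R z)\<^sup>2) * R z ^ 4)"
      using p by (simp add: power_divide power_mult_distrib field_simps flip: power_mult)
    finally show "(\<integral>\<^sup>+x. ennreal (exp (\<kappa> * R z)) * ennreal (h (\<kappa> * D z * x 0)) \<partial>\<sigma>)
      \<le> ennreal (\<kappa> ^ 4 / (8 * (real p)\<^sup>2) * (exp (\<kappa> * R z) * exp (real p / 8 * (R z)\<^sup>2) * R z ^ 4))" .
  qed
  also have "\<dots> = ennreal (LINT z|\<sigma>. \<kappa> ^ 4 / (8 * (real p)\<^sup>2) * (exp (\<kappa> * R z) * exp (real p / 8 * (R z)\<^sup>2) * R z ^ 4))"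
  proof (rule nn_integral_eq_integral)
    show "integrable \<sigma> (\<lambda>z. \<kappa> ^ 4 / (8 * (real p)\<^sup>2) * (exp (\<kappa> * R z) * exp (real p / 8 * (R z)\<^sup>2) * R z ^ 4))"
      unfolding R_def
      by (rule integrable_continuous_coords[of "\<lambda>s t. \<kappa> ^ 4 / (8 * (real p)\<^sup>2) *
        (exp (\<kappa> * (s\<^sup>2 + t\<^sup>2)) * exp (real p / 8 * (s\<^sup>2 + t\<^sup>2)\<^sup>2) * (s\<^sup>2 + t\<^sup>2) ^ 4)"])
         (intro continuous_intros)
  qed (use \<kappa> in \<open>auto simp: R_def\<close>)
  also have "\<dots> \<le> ennreal (real (p - 2) * (\<kappa> ^ 4 / (8 * (real p)\<^sup>2) * (1024 * exp 3 / (real p / 2 - \<kappa>) ^ 5)))"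
  proof (rule ennreal_leI)
    let ?f = "\<lambda>r. exp (\<kappa> * r) * exp (real p / 8 * r\<^sup>2) * r ^ 4"
    have "(LINT z|\<sigma>. \<kappa> ^ 4 / (8 * (real p)\<^sup>2) * ?f (R z)) = \<kappa> ^ 4 / (8 * (real p)\<^sup>2) * (LINT z|\<sigma>. ?f (R z))"
      by simp
    also have "(LINT z|\<sigma>. ?f (R z)) = real (p - 2) * (LINT c|lborel. ?f (1 - c\<^sup>2) * c ^ (p - 3) * indicator {0..1} c)"
      unfolding R_def using p4 by (intro integral_disc) auto
    also have "\<kappa> ^ 4 / (8 * (real p)\<^sup>2) * \<dots> \<le> \<kappa> ^ 4 / (8 * (real p)\<^sup>2) * (real (p - 2) * (1024 * exp 3 / (real p / 2 - \<kappa>) ^ 5))"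
      using gap_tail_bound[OF p4 \<kappa>] \<kappa> by (intro mult_left_mono) auto
    finally show "(LINT z|\<sigma>. \<kappa> ^ 4 / (8 * (real p)\<^sup>2) * ?f (R z))
      \<le> real (p - 2) * (\<kappa> ^ 4 / (8 * (real p)\<^sup>2) * (1024 * exp 3 / (real p / 2 - \<kappa>) ^ 5))"
      by (simp add: mult_ac)
  qed
  finally show ?thesis .
qed

text \<open>\<open>s\<close> is the quantity whose product with n will tend to \<tau>,
  \<open>\<eta>\<close> controls the relative error of treating R as exponential, and
  \<open>\<epsilon>\<close> bounds the integrated rest relative to the constant term. The
  coefficient \<alpha> has no closed form, so it is enclosed between two bounds that agree to first
  order.\<close>

lemma watson_cdf_expansion:
  fixes \<kappa> :: real
  defines "l \<equiv> real p / 2 - \<kappa>"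
  defines "s \<equiv> \<kappa>\<^sup>2 / (real p * l\<^sup>2)" and "\<eta> \<equiv> \<kappa> / l\<^sup>2"
  defines "\<epsilon> \<equiv> 256 * exp 3 * s\<^sup>2 * (1 + \<eta>)"
  assumes p4: "4 \<le> p" and \<kappa>: "0 < \<kappa>" "\<kappa> < real p / 2" and \<theta>: "\<theta> \<in> unit_sphere p"
  shows "\<exists>\<alpha>. 0 \<le> \<alpha> \<and> \<alpha> \<le> s / 2 \<and> s / 2 * (l / (l + 1)) * (1 - 5 * \<eta>) \<le> \<alpha> * (1 + s / 2 + \<epsilon>) \<and>
    (\<forall>t. \<bar>t\<bar> \<le> 1 \<longrightarrow>
      \<bar>\<P>(z in watson p \<kappa> \<theta> \<Otimes>\<^sub>M watson p \<kappa> \<theta>. dot p (fst z) (snd z) \<le> t)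
       - \<P>(z in \<sigma> \<Otimes>\<^sub>M \<sigma>. dot p (fst z) (snd z) \<le> t)
       + \<alpha> * (t * sqrt (1 - t\<^sup>2) ^ (p - 1) / tan_mass p)\<bar> \<le> \<epsilon>)"
proof -
  have p: "0 < real p" and p3: "3 \<le> p" and p2: "0 < real (p - 2)" using p4 by auto
  have l: "0 < l" using \<kappa> by (simp add: l_def)
  have s: "0 \<le> s" and \<eta>: "0 \<le> \<eta>" using p l \<kappa> by (auto simp: s_def \<eta>_def)
  have \<epsilon>: "0 \<le> \<epsilon>" using \<eta> by (simp add: \<epsilon>_def)
  define J where "J = gap_integral p \<kappa>"
  note J = gap_integral_bounds[OF p3 \<kappa>, folded l_def J_def, folded \<eta>_def]
  have "0 < J 0" using J(3) l \<eta> gap_integral_nonneg[of p \<kappa> 0] by (cases "J 0 = 0") (auto simp: J_def)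
  define a0 where "a0 = (LINT z|\<sigma>. exp (\<kappa> * ((z 0)\<^sup>2 + (z 1)\<^sup>2)))"
  define a1 where "a1 = \<kappa>\<^sup>2 / 4 * (LINT z|\<sigma>. exp (\<kappa> * ((z 0)\<^sup>2 + (z 1)\<^sup>2)) * ((z 0)\<^sup>2 + (z 1)\<^sup>2)\<^sup>2)"
  have a0: "a0 = real (p - 2) * J 0"
    using integral_disc[OF p3, of "\<lambda>r. exp (\<kappa> * r)"] by (simp add: a0_def J_def gap_integral_def)
  have a1: "a1 = \<kappa>\<^sup>2 / 4 * (real (p - 2) * J 2)"
    using integral_disc[OF p3, of "\<lambda>r. exp (\<kappa> * r) * r\<^sup>2"] by (simp add: a1_def J_def gap_integral_def)
  have a0_pos: "0 < a0" unfolding a0 using p2 \<open>0 < J 0\<close> by simp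
  have a1_nn: "0 \<le> a1" unfolding a1 using p2 gap_integral_nonneg[of p \<kappa> 2] by (simp add: J_def)
  define rest where "rest z = tilt_rest \<kappa> (z 0)" for z :: "nat \<Rightarrow> real"
  have tilt: "tilt \<kappa> w = a0 + a1 * w\<^sup>2 + tilt_rest \<kappa> w" for w
    unfolding a0_def a1_def tilt_rest_def by (rule tilt_decomposition)
  have rest_nn: "0 \<le> rest z" for z by (simp add: rest_def tilt_rest_nonneg)
  have [measurable]: "rest \<in> borel_measurable \<sigma>" unfolding rest_def by measurable
  note rest_le = nn_integral_tilt_rest_le[OF p4 \<kappa>, folded l_def rest_def]
  have rest_int: "integrable \<sigma> rest"
    using rest_nn rest_le by (intro integrableI_nonneg) (auto intro: le_less_trans)
  define b where "b = (LINT z|\<sigma>. rest z)"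
  have b_nn: "0 \<le> b" unfolding b_def using rest_nn by (intro Bochner_Integration.integral_nonneg)
  have "ennreal b \<le> ennreal (real (p - 2) * (\<kappa> ^ 4 / (8 * (real p)\<^sup>2) * (1024 * exp 3 / l ^ 5)))"
    using rest_le unfolding b_def
    by (subst nn_integral_eq_integral[symmetric]) (use rest_int rest_nn in auto)
  then have "b \<le> real (p - 2) * (\<kappa> ^ 4 / (8 * (real p)\<^sup>2) * (1024 * exp 3 / l ^ 5))"
    using l by (subst (asm) ennreal_le_iff) auto
  \<comment> \<open>Here 1024 / 8 = 128, and the lower bound 1 / (2 l (1 + \<eta>)) for
    \<open>J 0\<close> adds the factor 2: this is the 256 in \<open>\<epsilon>\<close>.\<close>
  also have "\<dots> = \<epsilon> * (real (p - 2) * (1 / (2 * (l * (1 + \<eta>)))))"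
  proof -
    have s2: "s\<^sup>2 = \<kappa> ^ 4 / ((real p)\<^sup>2 * l ^ 4)"
      by (simp add: s_def power_divide power_mult_distrib flip: power_mult)
    have A: "256 * E * S * h * (q * (1 / (2 * (l * h)))) = 128 * E * S * q / l" if "h \<noteq> 0" for E S h q :: real
      using l that by (simp add: field_simps)
    have B: "q * (K / (8 * P) * (1024 * E / l ^ 5)) = 128 * E * (K / (P * l ^ 4)) * q / l" if "P \<noteq> 0" for q K P E :: real
      using l that by (simp add: field_simps eval_nat_numeral)
    show ?thesis unfolding \<epsilon>_def s2 using \<eta> p by (subst A, simp, subst B) simp_all
  qed
  also have "\<dots> \<le> \<epsilon> * a0"
  proof -
    have "0 < 2 * (l * (1 + \<eta>))" using l \<eta> by (simp add: add_pos_nonneg)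
    then have "1 / (2 * (l * (1 + \<eta>))) \<le> J 0"
      using mult_left_mono[OF J(3), of 2] by (simp only: pos_divide_le_eq) (simp add: mult.left_commute)
    then show ?thesis unfolding a0 using \<epsilon> p2 by (intro mult_left_mono) auto
  qed
  finally have b_le: "b \<le> \<epsilon> * a0" .
  define Z where "Z = a0 + a1 / p + b"
  have Z_pos: "0 < Z" and Z_ge: "a0 \<le> Z" using a0_pos a1_nn b_nn p by (auto simp: Z_def add_pos_nonneg)
  have coord2_int: "integrable \<sigma> (\<lambda>z. (z 0)\<^sup>2)" by (rule integrable_coord_power)
  have Z: "(LINT z|\<sigma>. tilt \<kappa> (z 0)) = Z"
    unfolding tilt Z_def b_def rest_def[symmetric] using coord2_int rest_int second_moment
    by (simp add: prob_space)
  \<comment> \<open>With this \<alpha> the term a1 W^2, centred at its mean, is cancelled exactly by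
    the closed form that \<open>truncated_moment\<close> gives for \<open>m = 0\<close>.\<close>
  define \<alpha> where "\<alpha> = a1 / (p * Z)"
  define \<rho> where "\<rho> = a1 / (p * a0)"
  have \<rho>: "\<rho> = \<kappa>\<^sup>2 / (4 * real p) * (J 2 / J 0)" unfolding \<rho>_def a0 a1 using p2 by simp
  have \<rho>_le: "\<rho> \<le> s / 2"
  proof -
    have "l\<^sup>2 * J 2 \<le> l * (l + 1) * J 2"
      using l gap_integral_nonneg[of p \<kappa> 2] by (intro mult_right_mono) (auto simp: J_def power2_eq_square)
    then have "J 2 / J 0 \<le> 2 / l\<^sup>2" using J(1) l \<open>0 < J 0\<close> by (simp add: field_simps)
    then have "\<rho> \<le> \<kappa>\<^sup>2 / (4 * real p) * (2 / l\<^sup>2)" unfolding \<rho> using p by (intro mult_left_mono) auto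
    then show ?thesis by (simp add: s_def)
  qed
  have \<rho>_ge: "s / 2 * (l / (l + 1)) * (1 - 5 * \<eta>) \<le> \<rho>"
  proof -
    have "2 * (1 - 5 * \<eta>) / (l * (l + 1)) = 2 * J 0 * (1 - 5 * \<eta>) / (l * (l + 1) * J 0)"
      using \<open>0 < J 0\<close> by simp
    also have "\<dots> \<le> l * (l + 1) * J 2 / (l * (l + 1) * J 0)"
      using J(2) l \<open>0 < J 0\<close> by (intro divide_right_mono) auto
    also have "\<dots> = J 2 / J 0" using l by simp
    finally have "2 * (1 - 5 * \<eta>) / (l * (l + 1)) \<le> J 2 / J 0" .
    then have "\<kappa>\<^sup>2 / (4 * real p) * (2 * (1 - 5 * \<eta>) / (l * (l + 1))) \<le> \<rho>"
      unfolding \<rho> using p by (intro mult_left_mono) auto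
    moreover have "\<kappa>\<^sup>2 / (4 * real p) * (2 * (1 - 5 * \<eta>) / (l * (l + 1))) = s / 2 * (l / (l + 1)) * (1 - 5 * \<eta>)"
    proof -
      have "K / (4 * P) * (2 * e / (l * h)) = K / (P * l\<^sup>2) / 2 * (l / h) * e" if "h \<noteq> 0" "P \<noteq> 0" for K P e h :: real
        using l that by (simp add: field_simps power2_eq_square)
      note * = this
      show ?thesis unfolding s_def by (rule *) (use l p in auto)
    qed
    ultimately show ?thesis by simp
  qed
  have \<alpha>_nn: "0 \<le> \<alpha>" using a1_nn Z_pos p by (simp add: \<alpha>_def)
  have \<alpha>_le: "\<alpha> \<le> s / 2"
  proof -
    have "\<alpha> \<le> \<rho>" unfolding \<alpha>_def \<rho>_def using a1_nn a0_pos Z_ge p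
      by (intro divide_left_mono mult_left_mono) auto
    then show ?thesis using \<rho>_le by simp
  qed
  have \<alpha>_ge: "s / 2 * (l / (l + 1)) * (1 - 5 * \<eta>) \<le> \<alpha> * (1 + s / 2 + \<epsilon>)"
  proof -
    have "Z = a0 * (1 + \<rho>) + b" using a0_pos p by (simp add: Z_def \<rho>_def field_simps)
    also have "\<dots> \<le> a0 * (1 + s / 2 + \<epsilon>)"
    proof -
      have "a0 * \<rho> \<le> a0 * (s / 2)" using \<rho>_le a0_pos by (intro mult_left_mono) auto
      then show ?thesis using b_le unfolding distrib_left mult.commute[of \<epsilon> a0] by linarith
    qed
    finally have "Z \<le> a0 * (1 + s / 2 + \<epsilon>)" .
    then have "\<alpha> * Z \<le> \<alpha> * (a0 * (1 + s / 2 + \<epsilon>))" using \<alpha>_nn by (rule mult_left_mono)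
    moreover have "\<alpha> * Z = \<rho> * a0" using Z_pos a0_pos p by (simp add: \<alpha>_def \<rho>_def)
    ultimately have "\<rho> \<le> \<alpha> * (1 + s / 2 + \<epsilon>)" using a0_pos by (simp add: mult_ac)
    then show ?thesis using \<rho>_ge by simp
  qed
  have expansion: "\<bar>\<P>(z in watson p \<kappa> \<theta> \<Otimes>\<^sub>M watson p \<kappa> \<theta>. dot p (fst z) (snd z) \<le> t)
       - \<P>(z in \<sigma> \<Otimes>\<^sub>M \<sigma>. dot p (fst z) (snd z) \<le> t)
       + \<alpha> * (t * sqrt (1 - t\<^sup>2) ^ (p - 1) / tan_mass p)\<bar> \<le> \<epsilon>" if t: "\<bar>t\<bar> \<le> 1" for t
  proof -
    let ?I = "\<lambda>z. indicator {..t} (z 0) :: real"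
    define P where "P = (LINT z|\<sigma>. ?I z)"
    define M where "M = (LINT z|\<sigma>. ?I z * (z 0)\<^sup>2)"
    define B where "B = (LINT z|\<sigma>. ?I z * rest z)"
    define T where "T = t * sqrt (1 - t\<^sup>2) ^ (p - 1) / tan_mass p"
    have I_int: "integrable \<sigma> ?I" by (rule integrable_bounded_coord[where B=1]) auto
    have I2_int: "integrable \<sigma> (\<lambda>z. ?I z * (z 0)\<^sup>2)"
      by (rule integrable_bounded_coord[where B=1 and f="\<lambda>x. indicator {..t} x * x\<^sup>2"])
         (auto simp: abs_square_le_1 split: split_indicator)
    have Ir_int: "integrable \<sigma> (\<lambda>z. ?I z * rest z)"
      by (rule Bochner_Integration.integrable_bound[OF rest_int]) (auto intro!: AE_I2 split: split_indicator)
    have P: "\<P>(z in \<sigma>. z 0 \<in> {..t}) = P"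
    proof -
      have "\<P>(z in \<sigma>. z 0 \<in> {..t}) = (LINT z|\<sigma>. indicator {z \<in> space \<sigma>. z 0 \<in> {..t}} z)" by simp
      also have "\<dots> = P" unfolding P_def
        by (intro Bochner_Integration.integral_cong) (auto split: split_indicator)
      finally show ?thesis .
    qed
    have P_bounds: "0 \<le> P" "P \<le> 1" unfolding P[symmetric] by (rule measure_nonneg, rule prob_le_1)
    have uniform: "\<P>(z in \<sigma> \<Otimes>\<^sub>M \<sigma>. dot p (fst z) (snd z) \<le> t) = P"
      using prob_uniform_dot[of "{..t}"] by (simp add: P[symmetric])
    have watson: "\<P>(z in watson p \<kappa> \<theta> \<Otimes>\<^sub>M watson p \<kappa> \<theta>. dot p (fst z) (snd z) \<le> t) = (a0 * P + a1 * M + B) / Z"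
    proof -
      have "(LINT z|\<sigma>. ?I z * tilt \<kappa> (z 0)) = (LINT z|\<sigma>. a0 * ?I z + a1 * (?I z * (z 0)\<^sup>2) + ?I z * rest z)"
        unfolding tilt rest_def by (intro Bochner_Integration.integral_cong) (auto simp: algebra_simps)
      also have "\<dots> = a0 * P + a1 * M + B"
        unfolding P_def M_def B_def using I_int I2_int Ir_int by simp
      finally show ?thesis using prob_watson_dot[OF _ \<theta>, of \<kappa> "{..t}"] \<kappa> Z by simp
    qed
    have T: "T = P - real p * M"
    proof -
      have "T = (LINT z|\<sigma>. ?I z * (1 - real p * (z 0)\<^sup>2))"
        using truncated_moment[OF t, of 0] by (simp add: T_def numeral_2_eq_2)
      also have "\<dots> = (LINT z|\<sigma>. ?I z - real p * (?I z * (z 0)\<^sup>2))"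
        by (intro Bochner_Integration.integral_cong) (auto simp: algebra_simps)
      also have "\<dots> = P - real p * M" unfolding P_def M_def using I_int I2_int by simp
      finally show ?thesis .
    qed
    have B_bounds: "0 \<le> B" "B \<le> b"
      unfolding B_def b_def using rest_nn Ir_int rest_int
      by (auto intro!: Bochner_Integration.integral_nonneg integral_mono split: split_indicator)
    \<comment> \<open>Only the rest survives: \<open>B\<close> from the numerator and
      \<open>P * b\<close> from the normalising constant. Both lie between 0 and \<open>b\<close>,
      which makes the error bound uniform in \<open>t\<close>.\<close>
    have "(a0 * P + a1 * M + B) / Z - P + \<alpha> * T = (B - P * b) / Z"
    proof -
      have "\<alpha> * T = (a1 / p * T) / Z" by (simp add: \<alpha>_def)
      moreover have "a1 / p * T = a1 / p * P - a1 * M" unfolding T using p by (simp add: field_simps)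
      moreover have "P = P * Z / Z" using Z_pos by simp
      ultimately have "(a0 * P + a1 * M + B) / Z - P + \<alpha> * T
          = (a0 * P + a1 * M + B - P * Z + (a1 / p * P - a1 * M)) / Z"
        by (metis add_divide_distrib diff_divide_distrib)
      also have "a0 * P + a1 * M + B - P * Z + (a1 / p * P - a1 * M) = B - P * b"
        by (simp add: Z_def algebra_simps)
      finally show ?thesis .
    qed
    moreover have "\<bar>B - P * b\<bar> \<le> b"
    proof -
      have "P * b \<le> b" "0 \<le> P * b" using P_bounds b_nn by (auto simp: mult_left_le_one_le)
      then show ?thesis using B_bounds by linarith
    qed
    moreover have "b / Z \<le> \<epsilon>"
    proof -
      have "b \<le> \<epsilon> * Z" using b_le mult_left_mono[OF Z_ge \<epsilon>] by linarith
      then show ?thesis using Z_pos by (simp add: field_simps)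
    qed
    ultimately have "\<bar>(a0 * P + a1 * M + B) / Z - P + \<alpha> * T\<bar> \<le> \<epsilon>"
      using Z_pos divide_right_mono[of "\<bar>B - P * b\<bar>" b Z] by (simp add: abs_divide)
    then show ?thesis unfolding watson uniform T_def .
  qed
  show ?thesis by (intro exI[of _ \<alpha>] conjI allI impI \<alpha>_nn \<alpha>_le \<alpha>_ge expansion)
qed

end

section \<open>Limits\<close>

lemma power_ge_quadratic:
  fixes y :: real
  assumes "0 \<le> y"
  shows "1 + real m * y + real m * (real m - 1) / 2 * y\<^sup>2 \<le> (1 + y) ^ m"
proof (induction m)
  case (Suc m)
  have "0 \<le> real m * (real m - 1) / 2 * y ^ 3"
    using assms by (cases m) (auto intro!: mult_nonneg_nonneg)
  then have "1 + real (Suc m) * y + real (Suc m) * (real (Suc m) - 1) / 2 * y\<^sup>2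
      \<le> (1 + y) * (1 + real m * y + real m * (real m - 1) / 2 * y\<^sup>2)"
    by (simp add: power2_eq_square power3_eq_cube field_simps)
  also have "\<dots> \<le> (1 + y) * (1 + y) ^ m" using assms Suc by (intro mult_left_mono) auto
  finally show ?case by simp
qed simp

text \<open>An integrable majorant free of \<open>m\<close>, for dominated convergence. It amounts
  to (1 + x^2 / 2)^2 \<le> (1 + x^2 / m)^m, where the binomial expansion up to the quadratic term
  suffices; \<open>2 \<le> m\<close> enters as m / 4 \<le> (m - 1) / 2.\<close>

lemma cos_of_tan_power_scaled_le:
  assumes m: "2 \<le> m"
  shows "cos_of_tan (x / sqrt (real m)) ^ m \<le> 1 / (1 + x\<^sup>2 / 2)"
proof -
  define y where "y = x\<^sup>2 / real m"
  have y: "0 \<le> y" "real m * y = x\<^sup>2" using m by (auto simp: y_def)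
  have "(1 + x\<^sup>2 / 2)\<^sup>2 = 1 + real m * y + real m * (real m / 4) * y\<^sup>2"
    unfolding y(2)[symmetric] by (simp add: power2_eq_square field_simps)
  also have "\<dots> \<le> 1 + real m * y + real m * (real m - 1) / 2 * y\<^sup>2"
  proof -
    have "real m * (real m / 4) \<le> real m * ((real m - 1) / 2)" using m by (intro mult_left_mono) auto
    then show ?thesis by (intro add_left_mono mult_right_mono) auto
  qed
  also have "\<dots> \<le> (1 + y) ^ m" by (rule power_ge_quadratic[OF y(1)])
  finally have "1 + x\<^sup>2 / 2 \<le> sqrt ((1 + y) ^ m)" by (rule real_le_rsqrt)
  moreover have "0 < 1 + x\<^sup>2 / 2" by (rule add_pos_nonneg) auto
  moreover have "cos_of_tan (x / sqrt (real m)) ^ m = 1 / sqrt ((1 + y) ^ m)"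
    by (simp add: cos_of_tan_def y_def power_divide real_sqrt_power)
  ultimately show ?thesis by (simp add: frac_le)
qed

lemma tendsto_sqrt_power:
  fixes u :: real
  shows "(\<lambda>m. sqrt (1 - u\<^sup>2 / real m) ^ (m - 1)) \<longlonglongrightarrow> exp (- (u\<^sup>2) / 2)"
proof -
  have "(\<lambda>m. (1 + (- (u\<^sup>2)) / real m) ^ m) \<longlonglongrightarrow> exp (- (u\<^sup>2))" by (rule tendsto_exp_limit_sequentially)
  moreover have "(\<lambda>m. 1 - u\<^sup>2 / real m) \<longlonglongrightarrow> 1 - 0"
    by (intro tendsto_diff tendsto_const lim_const_over_n)
  \<comment> \<open>Dividing by one factor, which tends to 1, lowers the exponent from
    \<open>m\<close> to \<open>m - 1\<close>.\<close>
  ultimately have lim: "(\<lambda>m. sqrt ((1 - u\<^sup>2 / real m) ^ m / (1 - u\<^sup>2 / real m))) \<longlonglongrightarrow> sqrt (exp (- (u\<^sup>2)) / (1 - 0))"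
    by (intro tendsto_real_sqrt tendsto_divide) auto
  have lim_eq: "sqrt (exp (- (u\<^sup>2)) / (1 - 0)) = exp (- (u\<^sup>2) / 2)"
    by (rule real_sqrt_unique) (simp_all add: exp_double[symmetric])
  have "eventually (\<lambda>m. sqrt ((1 - u\<^sup>2 / real m) ^ m / (1 - u\<^sup>2 / real m)) = sqrt (1 - u\<^sup>2 / real m) ^ (m - 1)) sequentially"
    using eventually_gt_at_top[of "nat \<lceil>u\<^sup>2\<rceil>"]
  proof eventually_elim
    case (elim m)
    then have "u\<^sup>2 < real m" by linarith
    moreover from this have "0 < real m" using zero_le_power2[of u] by linarith
    ultimately have "1 - u\<^sup>2 / real m \<noteq> 0" by simp
    moreover obtain k where "m = Suc k" using \<open>0 < real m\<close> by (cases m) auto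
    ultimately show ?case by (simp add: real_sqrt_power)
  qed
  with lim[unfolded lim_eq] show ?thesis by (rule Lim_transform_eventually)
qed

text \<open>Rescaling s = x / sqrt m makes the integrand tend to exp (- x^2 / 2). The dimension is
  shifted by 2 so that the majorant is valid from the first index on.\<close>

lemma tendsto_tan_mass: "(\<lambda>m. sqrt (real m) * tan_mass m) \<longlonglongrightarrow> sqrt (2 * pi)"
proof -
  let ?s = "\<lambda>m x. cos_of_tan (x / sqrt (real (m + 2))) ^ (m + 2)"
  have "(\<lambda>m. LINT x|lborel. ?s m x) \<longlonglongrightarrow> (LINT x|lborel. exp (- (x\<^sup>2) / 2))"
  proof (rule integral_dominated_convergence[where w="\<lambda>x. 1 / (1 + x\<^sup>2 / 2)"])
    \<comment> \<open>The majorant is a rescaled square of \<open>cos_of_tan\<close>, so its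
      integrability is the case \<open>p = 2\<close> of the coordinate density.\<close>
    have "integrable lborel (\<lambda>x. cos_of_tan (0 + 1 / sqrt 2 * x) ^ 2)"
      by (intro lborel_integrable_real_affine sphere_dim.integrable_cos_of_tan_power sphere_dim.intro) simp_all
    then show "integrable lborel (\<lambda>x::real. 1 / (1 + x\<^sup>2 / 2))"
      by (simp add: cos_of_tan_square power_divide)
    show "AE x in lborel. norm (?s m x) \<le> 1 / (1 + x\<^sup>2 / 2)" for m
      using cos_of_tan_power_scaled_le[of "m + 2"] less_imp_le[OF cos_of_tan_pos]
      by (intro AE_I2) (simp del: power_Suc add_2_eq_Suc')
    show "AE x in lborel. (\<lambda>m. ?s m x) \<longlonglongrightarrow> exp (- (x\<^sup>2) / 2)"
    proof (intro AE_I2)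
      fix x :: real
      have "(\<lambda>m. (1 + x\<^sup>2 / real m) ^ m) \<longlonglongrightarrow> exp (x\<^sup>2)" by (rule tendsto_exp_limit_sequentially)
      then have "(\<lambda>m. 1 / sqrt ((1 + x\<^sup>2 / real m) ^ m)) \<longlonglongrightarrow> 1 / sqrt (exp (x\<^sup>2))"
        by (intro tendsto_divide tendsto_const tendsto_real_sqrt) auto
      moreover have "sqrt (exp (x\<^sup>2)) = exp (x\<^sup>2 / 2)"
        by (rule real_sqrt_unique) (simp_all add: exp_double[symmetric])
      moreover have "cos_of_tan (x / sqrt (real m)) ^ m = 1 / sqrt ((1 + x\<^sup>2 / real m) ^ m)" for m
        by (simp add: cos_of_tan_def power_divide real_sqrt_power)
      ultimately have "(\<lambda>m. cos_of_tan (x / sqrt (real m)) ^ m) \<longlonglongrightarrow> exp (- (x\<^sup>2) / 2)"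
        by (simp add: exp_minus inverse_eq_divide)
      then show "(\<lambda>m. ?s m x) \<longlonglongrightarrow> exp (- (x\<^sup>2) / 2)" by (rule LIMSEQ_ignore_initial_segment)
    qed
  qed measurable
  moreover have "(LINT x|lborel. exp (- (x\<^sup>2) / 2)) = sqrt (2 * pi)"
  proof -
    have "(LINT x|lborel. 1 / sqrt (2 * pi) * exp (- (x\<^sup>2) / 2)) = 1"
      using integral_normal_density[of 1 0, OF zero_less_one] unfolding std_normal_density_def .
    then have *: "1 / sqrt (2 * pi) * (LINT x|lborel. exp (- (x\<^sup>2) / 2)) = 1"
      by (simp only: integral_mult_right_zero)
    have "(LINT x|lborel. exp (- (x\<^sup>2) / 2))
        = sqrt (2 * pi) * (1 / sqrt (2 * pi) * (LINT x|lborel. exp (- (x\<^sup>2) / 2)))"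
      by simp
    then show ?thesis unfolding * by simp
  qed
  moreover have "sqrt (real (m + 2)) * tan_mass (m + 2) = (LINT x|lborel. ?s m x)" for m
  proof -
    have "0 < sqrt (real (m + 2))" by simp
    then show ?thesis unfolding tan_mass_def
      by (subst lborel_integral_real_affine[where t=0 and c="1 / sqrt (real (m + 2))"]) (simp_all add: field_simps)
  qed
  ultimately have "(\<lambda>m. sqrt (real (m + 2)) * tan_mass (m + 2)) \<longlonglongrightarrow> sqrt (2 * pi)" by simp
  then show ?thesis by (rule LIMSEQ_offset)
qed

text \<open>By \<open>y \<le> exp (y - 1)\<close>, applied to \<open>p t\<^sup>2\<close> and to the \<open>p - 1\<close> equal factors
  \<open>(1 - t\<^sup>2) p / (p - 1)\<close>, whose sum is \<open>p\<close>.\<close>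

lemma abs_mult_sqrt_power_le:
  assumes p: "2 \<le> p" and t: "\<bar>t\<bar> \<le> 1"
  shows "\<bar>t\<bar> * sqrt (1 - t\<^sup>2) ^ (p - 1) \<le> (1 / sqrt (real p)) * sqrt (1 - 1 / real p) ^ (p - 1)"
proof -
  define x where "x = t\<^sup>2"
  define q where "q = real (p - 1)"
  have q: "0 < q" "real p = q + 1" using p by (auto simp: q_def)
  have x: "0 \<le> x" "x \<le> 1" using t by (auto simp: x_def abs_square_le_1)
  have ge: "y \<le> exp (y - 1)" for y :: real using exp_ge_add_one_self[of "y - 1"] by simp
  have "(real p * x) * ((1 - x) * real p / q) ^ (p - 1) \<le> exp (real p * x - 1) * exp ((1 - x) * real p / q - 1) ^ (p - 1)"
    using x q p by (intro mult_mono power_mono ge) auto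
  also have "\<dots> = exp (real p * x - 1 + q * ((1 - x) * real p / q - 1))"
    by (simp only: exp_add q_def exp_of_nat_mult)
  also have "real p * x - 1 + q * ((1 - x) * real p / q - 1) = 0"
    using q by (simp add: field_simps)
  finally have *: "(real p * x) * ((1 - x) * real p / q) ^ (p - 1) \<le> 1" by simp
  have f: "real p / q = 1 / (1 - 1 / real p)" "0 < 1 - 1 / real p" using q by (auto simp: field_simps)
  have "(real p * x) * ((1 - x) * real p / q) ^ (p - 1) = real p * (x * (1 - x) ^ (p - 1)) / (1 - 1 / real p) ^ (p - 1)"
    unfolding times_divide_eq_right[symmetric] f(1) by (simp add: power_mult_distrib power_divide)
  with * have "real p * (x * (1 - x) ^ (p - 1)) \<le> (1 - 1 / real p) ^ (p - 1)"
    using f(2) by (simp add: pos_divide_le_eq)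
  then have "x * (1 - x) ^ (p - 1) \<le> (1 / real p) * (1 - 1 / real p) ^ (p - 1)"
  proof -
    have "X \<le> (1 / P) * Y" if "P * X \<le> Y" "0 < P" for P X Y :: real using that by (simp add: field_simps)
    from this[OF \<open>real p * (x * (1 - x) ^ (p - 1)) \<le> (1 - 1 / real p) ^ (p - 1)\<close>] show ?thesis using q by simp
  qed
  then have "sqrt (x * (1 - x) ^ (p - 1)) \<le> sqrt ((1 / real p) * (1 - 1 / real p) ^ (p - 1))" by simp
  moreover have "sqrt x = \<bar>t\<bar>" by (simp add: x_def)
  ultimately show ?thesis
    unfolding real_sqrt_mult real_sqrt_power by (simp add: x_def real_sqrt_divide)
qed

text \<open>If \<kappa> \<ge> p / 4, factors 4 \<kappa> / p \<ge> 1 can be inserted on the left;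
  otherwise \<open>l\<close> exceeds both p / 4 and \<kappa>, and the terms in p alone suffice. This
  is what makes the error terms vanish in every regime of \<kappa>.\<close>

lemma concentration_ratio_bounds:
  fixes \<kappa> p :: real
  defines "l \<equiv> p / 2 - \<kappa>"
  assumes \<kappa>: "0 < \<kappa>" "\<kappa> < p / 2"
  shows "\<kappa> / l\<^sup>2 \<le> 4 * (\<kappa>\<^sup>2 / (p * l\<^sup>2)) + 4 / p" "1 / l\<^sup>2 \<le> 16 * (\<kappa>\<^sup>2 / (p * l\<^sup>2)) / p + 16 / p\<^sup>2"
proof -
  have p: "0 < p" and l: "0 < l" using \<kappa> by (auto simp: l_def)
  have nn: "0 \<le> \<kappa>\<^sup>2 / (p * l\<^sup>2)" using p by simp
  have "\<kappa> / l\<^sup>2 \<le> 4 * (\<kappa>\<^sup>2 / (p * l\<^sup>2)) + 4 / p \<and> 1 / l\<^sup>2 \<le> 16 * (\<kappa>\<^sup>2 / (p * l\<^sup>2)) / p + 16 / p\<^sup>2"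
  proof (cases "p / 4 \<le> \<kappa>")
    case True
    have "\<kappa> * 1 \<le> \<kappa> * (4 * \<kappa> / p)" using True p \<kappa> by (intro mult_left_mono) (auto simp: field_simps)
    then have "\<kappa> / l\<^sup>2 \<le> \<kappa> * (4 * \<kappa> / p) / l\<^sup>2" by (intro divide_right_mono) auto
    also have "\<dots> = 4 * (\<kappa>\<^sup>2 / (p * l\<^sup>2))" by (simp add: power2_eq_square)
    finally have 1: "\<kappa> / l\<^sup>2 \<le> 4 * (\<kappa>\<^sup>2 / (p * l\<^sup>2))" .
    have "(p / 4)\<^sup>2 \<le> \<kappa>\<^sup>2" using True p by (intro power_mono) auto
    then have "1 \<le> 16 * \<kappa>\<^sup>2 / p\<^sup>2" using p by (simp add: power_divide field_simps)
    then have "1 / l\<^sup>2 \<le> 16 * \<kappa>\<^sup>2 / p\<^sup>2 / l\<^sup>2" by (intro divide_right_mono) auto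
    also have "\<dots> = 16 * (\<kappa>\<^sup>2 / (p * l\<^sup>2)) / p" by (simp add: power2_eq_square)
    finally show ?thesis using 1 p by (auto intro: add_increasing2)
  next
    case False
    then have l4: "p / 4 \<le> l" "\<kappa> \<le> l" by (auto simp: l_def)
    have "1 / l \<le> 4 / p" using l4(1) p l by (simp add: field_simps)
    then have "(1 / l)\<^sup>2 \<le> (4 / p)\<^sup>2" using l by (intro power_mono) auto
    moreover have "\<kappa> / l\<^sup>2 \<le> l / l\<^sup>2" using l4(2) by (intro divide_right_mono) auto
    moreover have "l / l\<^sup>2 = 1 / l" by (simp add: power2_eq_square)
    ultimately show ?thesis using \<open>1 / l \<le> 4 / p\<close> nn p by (auto simp: power_divide intro: add_increasing)
  qed
  then show "\<kappa> / l\<^sup>2 \<le> 4 * (\<kappa>\<^sup>2 / (p * l\<^sup>2)) + 4 / p" "1 / l\<^sup>2 \<le> 16 * (\<kappa>\<^sup>2 / (p * l\<^sup>2)) / p + 16 / p\<^sup>2" by auto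
qed

text \<open>Of the two factors \<open>s\<close> in \<open>\<epsilon>\<close>, one absorbs n, because
  n s converges, and the other tends to 0. The two bounds for \<alpha>, times n, have a common limit
  because \<open>s\<close>, \<open>\<eta>\<close>, \<open>\<epsilon>\<close> and 1 / l all tend to
  0.\<close>

lemma cdf_expansion_limits:
  fixes p :: "nat \<Rightarrow> nat" and \<kappa> \<alpha> :: "nat \<Rightarrow> real" and \<tau> :: real
  defines "l \<equiv> \<lambda>n. real (p n) / 2 - \<kappa> n"
  defines "s \<equiv> \<lambda>n. (\<kappa> n)\<^sup>2 / (real (p n) * (l n)\<^sup>2)" and "\<eta> \<equiv> \<lambda>n. \<kappa> n / (l n)\<^sup>2"
  defines "\<epsilon> \<equiv> \<lambda>n. 256 * exp 3 * (s n)\<^sup>2 * (1 + \<eta> n)"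
  assumes \<kappa>: "\<And>n. n \<ge> 1 \<Longrightarrow> 0 < \<kappa> n" "\<And>n. n \<ge> 1 \<Longrightarrow> \<kappa> n < real (p n) / 2"
    and p: "filterlim (\<lambda>n. real (p n)) at_top sequentially"
    and lim: "(\<lambda>n. real n * s n) \<longlonglongrightarrow> \<tau>"
  shows "(\<lambda>n. real n * \<epsilon> n) \<longlonglongrightarrow> 0"
    and "(\<forall>\<^sub>F n in sequentially. \<alpha> n \<le> s n / 2 \<and>
        s n / 2 * (l n / (l n + 1)) * (1 - 5 * \<eta> n) \<le> \<alpha> n * (1 + s n / 2 + \<epsilon> n))
      \<Longrightarrow> (\<lambda>n. real n * \<alpha> n) \<longlonglongrightarrow> \<tau> / 2"
proof -
  have ev1: "eventually (\<lambda>n. 1 \<le> n) sequentially" by (rule eventually_ge_at_top)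
  have l_pos: "0 < l n" if "n \<ge> 1" for n using \<kappa>(2)[OF that] by (simp add: l_def)
  have inv_n: "(\<lambda>n. 1 / real n) \<longlonglongrightarrow> 0" by (rule lim_1_over_n)
  have inv_p: "(\<lambda>n. 1 / real (p n)) \<longlonglongrightarrow> 0"
    using tendsto_inverse_0_at_top[OF p] by (simp add: inverse_eq_divide)
  have s0: "s \<longlonglongrightarrow> 0"
  proof (rule Lim_transform_eventually)
    show "(\<lambda>n. real n * s n * (1 / real n)) \<longlonglongrightarrow> 0" using tendsto_mult[OF lim inv_n] by simp
    show "\<forall>\<^sub>F n in sequentially. real n * s n * (1 / real n) = s n" using ev1 by eventually_elim simp
  qed
  have \<eta>0: "\<eta> \<longlonglongrightarrow> 0"
  proof (rule tendsto_sandwich)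
    show "\<forall>\<^sub>F n in sequentially. 0 \<le> \<eta> n"
      using ev1 by eventually_elim (simp add: \<eta>_def \<kappa> less_imp_le)
    show "\<forall>\<^sub>F n in sequentially. \<eta> n \<le> 4 * s n + 4 * (1 / real (p n))"
      using ev1
    proof eventually_elim
      case (elim n)
      then show ?case
        using concentration_ratio_bounds(1)[OF \<kappa>(1)[OF elim] \<kappa>(2)[OF elim]] by (simp add: \<eta>_def s_def l_def)
    qed
    show "(\<lambda>n. 4 * s n + 4 * (1 / real (p n))) \<longlonglongrightarrow> 0"
      using tendsto_add[OF tendsto_mult[OF tendsto_const s0] tendsto_mult[OF tendsto_const inv_p], of 4 4] by simp
  qed simp
  have inv_l2: "(\<lambda>n. 1 / (l n)\<^sup>2) \<longlonglongrightarrow> 0"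
  proof (rule tendsto_sandwich[of "\<lambda>_. 0"])
    show "\<forall>\<^sub>F n in sequentially. 1 / (l n)\<^sup>2 \<le> 16 * s n * (1 / real (p n)) + 16 * (1 / real (p n) * (1 / real (p n)))"
      using ev1
    proof eventually_elim
      case (elim n)
      then show ?case
        using concentration_ratio_bounds(2)[OF \<kappa>(1)[OF elim] \<kappa>(2)[OF elim]]
        by (simp add: s_def l_def power2_eq_square)
    qed
    show "(\<lambda>n. 16 * s n * (1 / real (p n)) + 16 * (1 / real (p n) * (1 / real (p n)))) \<longlonglongrightarrow> 0"
      using tendsto_add[OF tendsto_mult[OF tendsto_mult[OF tendsto_const s0] inv_p]
        tendsto_mult[OF tendsto_const tendsto_mult[OF inv_p inv_p]], of 16 16] by simp
  qed simp_all
  have inv_l: "(\<lambda>n. 1 / l n) \<longlonglongrightarrow> 0"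
  proof (rule Lim_transform_eventually)
    show "(\<lambda>n. sqrt (1 / (l n)\<^sup>2)) \<longlonglongrightarrow> 0" using tendsto_real_sqrt[OF inv_l2] by simp
    show "\<forall>\<^sub>F n in sequentially. sqrt (1 / (l n)\<^sup>2) = 1 / l n"
      using ev1 by eventually_elim (simp add: real_sqrt_divide less_imp_le l_pos)
  qed
  have l_ratio: "(\<lambda>n. l n / (l n + 1)) \<longlonglongrightarrow> 1"
  proof (rule Lim_transform_eventually)
    show "(\<lambda>n. 1 / (1 + 1 / l n)) \<longlonglongrightarrow> 1"
      using tendsto_divide[OF tendsto_const tendsto_add[OF tendsto_const inv_l], of 1 1] by simp
    show "\<forall>\<^sub>F n in sequentially. 1 / (1 + 1 / l n) = l n / (l n + 1)"
      using ev1 by eventually_elim (use l_pos in \<open>fastforce simp: field_simps\<close>)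
  qed
  have "(\<lambda>n. 256 * exp 3 * ((real n * s n) * s n) * (1 + \<eta> n)) \<longlonglongrightarrow> 256 * exp 3 * (\<tau> * 0) * (1 + 0)"
    by (intro tendsto_intros lim s0 \<eta>0)
  then show n\<epsilon>: "(\<lambda>n. real n * \<epsilon> n) \<longlonglongrightarrow> 0" by (simp add: \<epsilon>_def power2_eq_square mult_ac)
  have \<epsilon>0: "\<epsilon> \<longlonglongrightarrow> 0"
  proof -
    have "(\<lambda>n. 256 * exp 3 * (s n)\<^sup>2 * (1 + \<eta> n)) \<longlonglongrightarrow> 256 * exp 3 * 0\<^sup>2 * (1 + 0)"
      by (intro tendsto_intros s0 \<eta>0)
    then show ?thesis by (simp add: \<epsilon>_def)
  qed
  show "(\<lambda>n. real n * \<alpha> n) \<longlonglongrightarrow> \<tau> / 2"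
    if \<alpha>: "\<forall>\<^sub>F n in sequentially. \<alpha> n \<le> s n / 2 \<and>
        s n / 2 * (l n / (l n + 1)) * (1 - 5 * \<eta> n) \<le> \<alpha> n * (1 + s n / 2 + \<epsilon> n)"
  proof (rule tendsto_sandwich)
    show "\<forall>\<^sub>F n in sequentially. real n * \<alpha> n \<le> (real n * s n) / 2"
      using \<alpha>
    proof eventually_elim
      case (elim n)
      then have "real n * \<alpha> n \<le> real n * (s n / 2)" by (intro mult_left_mono) auto
      then show ?case by simp
    qed
    show "\<forall>\<^sub>F n in sequentially.
        (real n * s n) / 2 * (l n / (l n + 1)) * (1 - 5 * \<eta> n) / (1 + s n / 2 + \<epsilon> n) \<le> real n * \<alpha> n"
      using \<alpha> ev1
    proof eventually_elim
      case (elim n)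
      have "0 \<le> s n" by (simp add: s_def)
      moreover have "0 \<le> \<epsilon> n" using \<kappa>(1)[OF elim(2)] by (simp add: \<epsilon>_def \<eta>_def)
      ultimately have pos: "0 < 1 + s n / 2 + \<epsilon> n" by simp
      have "real n * (s n / 2 * (l n / (l n + 1)) * (1 - 5 * \<eta> n)) \<le> real n * (\<alpha> n * (1 + s n / 2 + \<epsilon> n))"
        using elim by (intro mult_left_mono) auto
      moreover have "(N * S) / 2 * L * E = N * (S / 2 * L * E)" for N S L E :: real by simp
      ultimately show ?case unfolding pos_divide_le_eq[OF pos] by (simp only: mult.assoc)
    qed
    have "(\<lambda>n. (real n * s n) / 2 * (l n / (l n + 1)) * (1 - 5 * \<eta> n) / (1 + s n / 2 + \<epsilon> n))
        \<longlonglongrightarrow> \<tau> / 2 * 1 * (1 - 5 * 0) / (1 + 0 / 2 + 0)"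
      by (intro tendsto_intros lim l_ratio \<eta>0 s0 \<epsilon>0) simp_all
    then show "(\<lambda>n. (real n * s n) / 2 * (l n / (l n + 1)) * (1 - 5 * \<eta> n) / (1 + s n / 2 + \<epsilon> n)) \<longlonglongrightarrow> \<tau> / 2"
      by simp
    show "(\<lambda>n. (real n * s n) / 2) \<longlonglongrightarrow> \<tau> / 2" by (intro tendsto_intros lim) simp
  qed
qed

lemma filterlim_dimension:
  fixes p :: "nat \<Rightarrow> nat"
  assumes "filterlim (\<lambda>n. real (p n) / real n powr (2 / 3)) at_top sequentially"
  shows "filterlim p at_top sequentially"
proof -
  have "filterlim (\<lambda>n. real (p n)) at_top sequentially"
  proof (rule filterlim_at_top_mono[OF assms])
    show "\<forall>\<^sub>F n in sequentially. real (p n) / real n powr (2 / 3) \<le> real (p n)"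
      using eventually_ge_at_top[of 1]
    proof eventually_elim
      case (elim n)
      then have "1 \<le> real n powr (2 / 3)" by (intro ge_one_powr_ge_zero) auto
      then show ?case by (simp add: divide_le_eq mult_left_le field_simps) (metis mult.right_neutral mult_left_mono of_nat_0_le_iff)
    qed
  qed
  then show ?thesis
    unfolding filterlim_at_top by (metis (mono_tags, lifting) eventually_mono of_nat_le_iff)
qed

text \<open>The profile multiplying \<alpha> has its largest absolute value at t = 1 / sqrt p, by
  \<open>abs_mult_sqrt_power_le\<close>. This bounds the supremum from above, and evaluation at that
  point bounds it from below.\<close>

lemma dot_dist_bounds:
  assumes p: "2 \<le> p" and \<alpha>: "0 \<le> \<alpha>" and m: "0 < m"
    and exp: "\<And>t. \<bar>t\<bar> \<le> 1 \<Longrightarrow>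
      \<bar>\<P>(z in M \<Otimes>\<^sub>M M. dot p (fst z) (snd z) \<le> t) - \<P>(z in N \<Otimes>\<^sub>M N. dot p (fst z) (snd z) \<le> t)
       + \<alpha> * (t * sqrt (1 - t\<^sup>2) ^ (p - 1) / m)\<bar> \<le> \<epsilon>"
  shows "\<bar>dot_dist p M N - \<alpha> * (1 / sqrt (real p) * sqrt (1 - 1 / real p) ^ (p - 1) / m)\<bar> \<le> \<epsilon>"
proof -
  let ?v = "1 / sqrt (real p) * sqrt (1 - 1 / real p) ^ (p - 1)"
  define d where "d t = \<P>(z in M \<Otimes>\<^sub>M M. dot p (fst z) (snd z) \<le> t) - \<P>(z in N \<Otimes>\<^sub>M N. dot p (fst z) (snd z) \<le> t)" for t
  define T where "T t = t * sqrt (1 - t\<^sup>2) ^ (p - 1) / m" for t :: real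
  have dT: "\<bar>d t + \<alpha> * T t\<bar> \<le> \<epsilon>" if "\<bar>t\<bar> \<le> 1" for t using exp[OF that] by (simp add: d_def T_def)
  have le: "\<bar>d t\<bar> \<le> \<alpha> * (?v / m) + \<epsilon>" if t: "t \<in> {-1..1}" for t
  proof -
    have t1: "\<bar>t\<bar> \<le> 1" using t by auto
    have "\<bar>T t\<bar> = \<bar>t\<bar> * sqrt (1 - t\<^sup>2) ^ (p - 1) / m"
      using m t1 by (simp add: T_def abs_mult abs_square_le_1)
    also have "\<dots> \<le> ?v / m" using abs_mult_sqrt_power_le[OF p t1] m by (intro divide_right_mono) auto
    finally have "\<alpha> * \<bar>T t\<bar> \<le> \<alpha> * (?v / m)" using \<alpha> by (rule mult_left_mono)
    moreover have "\<bar>\<alpha> * T t\<bar> = \<alpha> * \<bar>T t\<bar>" using \<alpha> by (simp add: abs_mult)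
    ultimately show ?thesis using dT[OF t1] by linarith
  qed
  have dd: "dot_dist p M N = (SUP t\<in>{-1..1}. \<bar>d t\<bar>)" by (simp add: dot_dist_def d_def)
  have upper: "dot_dist p M N \<le> \<alpha> * (?v / m) + \<epsilon>"
    unfolding dd using le by (intro cSUP_least) auto
  have t0: "1 / sqrt (real p) \<in> {-1..1}" "\<bar>1 / sqrt (real p)\<bar> \<le> 1"
  proof -
    have "0 \<le> 1 / sqrt (real p)" "1 / sqrt (real p) \<le> 1" using p by auto
    then show "1 / sqrt (real p) \<in> {-1..1}" "\<bar>1 / sqrt (real p)\<bar> \<le> 1"
      unfolding atLeastAtMost_iff by linarith+
  qed
  have "bdd_above ((\<lambda>t. \<bar>d t\<bar>) ` {-1..1})" using le by (rule bdd_aboveI2)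
  then have "\<bar>d (1 / sqrt (real p))\<bar> \<le> dot_dist p M N"
    unfolding dd by (intro cSUP_upper t0(1))
  moreover have "T (1 / sqrt (real p)) = ?v / m" by (simp add: T_def power_divide)
  ultimately have lower: "\<alpha> * (?v / m) - \<epsilon> \<le> dot_dist p M N" using dT[OF t0(2)] by simp
  from upper lower show ?thesis by (simp add: abs_le_iff)
qed

theorem proposition3:
  fixes p :: "nat \<Rightarrow> nat" and \<kappa> :: "nat \<Rightarrow> real"
    and \<theta> :: "nat \<Rightarrow> nat \<Rightarrow> real" and \<tau> :: real
  assumes "\<And>n. n \<ge> 1 \<Longrightarrow> 0 < \<kappa> n"
    and "\<And>n. n \<ge> 1 \<Longrightarrow> \<kappa> n < real (p n) / 2"
    and "\<And>n. n \<ge> 1 \<Longrightarrow> \<theta> n \<in> unit_sphere (p n)"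
    and "filterlim (\<lambda>n. real (p n) / real n powr (2 / 3)) at_top sequentially"
    and "0 < \<tau>"
    and "(\<lambda>n. real n * (\<kappa> n)\<^sup>2 / (real (p n) * (real (p n) / 2 - \<kappa> n)\<^sup>2)) \<longlonglongrightarrow> \<tau>"
  defines "\<mu> \<equiv> \<lambda>n. watson (p n) (\<kappa> n) (\<theta> n)"
    and "\<mu>0 \<equiv> \<lambda>n. uniform_sphere (p n)"
  shows "(\<forall>u::real.
           (\<lambda>n. real n *
              (\<P>(z in \<mu> n \<Otimes>\<^sub>M \<mu> n. sqrt (real (p n)) * dot (p n) (fst z) (snd z) \<le> u)
             - \<P>(z in \<mu>0 n \<Otimes>\<^sub>M \<mu>0 n. sqrt (real (p n)) * dot (p n) (fst z) (snd z) \<le> u)))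
           \<longlonglongrightarrow> - \<tau> / (2 * sqrt (2 * pi)) * u * exp (- (u\<^sup>2) / 2)) \<and>
         (\<lambda>n. real n * dot_dist (p n) (\<mu> n) (\<mu>0 n))
           \<longlonglongrightarrow> \<tau> / (2 * sqrt (2 * exp 1 * pi))"
proof -
  define l where "l n = real (p n) / 2 - \<kappa> n" for n
  define s where "s n = (\<kappa> n)\<^sup>2 / (real (p n) * (l n)\<^sup>2)" for n
  define \<eta> where "\<eta> n = \<kappa> n / (l n)\<^sup>2" for n
  define \<epsilon> where "\<epsilon> n = 256 * exp 3 * (s n)\<^sup>2 * (1 + \<eta> n)" for n
  define d where "d n t = \<P>(z in \<mu> n \<Otimes>\<^sub>M \<mu> n. dot (p n) (fst z) (snd z) \<le> t)
      - \<P>(z in \<mu>0 n \<Otimes>\<^sub>M \<mu>0 n. dot (p n) (fst z) (snd z) \<le> t)" for n t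
  define Q where "Q n a \<longleftrightarrow> 0 \<le> a \<and> a \<le> s n / 2 \<and>
      s n / 2 * (l n / (l n + 1)) * (1 - 5 * \<eta> n) \<le> a * (1 + s n / 2 + \<epsilon> n) \<and>
      (\<forall>t. \<bar>t\<bar> \<le> 1 \<longrightarrow> \<bar>d n t + a * (t * sqrt (1 - t\<^sup>2) ^ (p n - 1) / tan_mass (p n))\<bar> \<le> \<epsilon> n)" for n a
  have p_lim: "filterlim p at_top sequentially" by (rule filterlim_dimension) fact
  have ev: "eventually (\<lambda>n. 1 \<le> n \<and> 4 \<le> p n) sequentially"
    using eventually_ge_at_top[of 1] p_lim[unfolded filterlim_at_top, rule_format, of 4]
    by (rule eventually_conj)
  have "\<forall>n\<in>{n. 1 \<le> n \<and> 4 \<le> p n}. \<exists>a. Q n a"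
  proof
    fix n assume n: "n \<in> {n. 1 \<le> n \<and> 4 \<le> p n}"
    then interpret sphere_dim "p n" by unfold_locales simp
    have n1: "1 \<le> n" and p4: "4 \<le> p n" using n by auto
    show "\<exists>a. Q n a"
      using watson_cdf_expansion[OF p4 assms(1)[OF n1] assms(2)[OF n1] assms(3)[OF n1]]
      unfolding Q_def d_def \<mu>_def \<mu>0_def \<epsilon>_def \<eta>_def s_def l_def .
  qed
  \<comment> \<open>The coefficient depends on neither \<open>t\<close> nor \<open>u\<close>, so one
    sequence is chosen here and serves both limits.\<close>
  from bchoice[OF this] obtain \<alpha> where \<alpha>: "\<forall>n\<in>{n. 1 \<le> n \<and> 4 \<le> p n}. Q n (\<alpha> n)" by blast
  have ev_Q: "eventually (\<lambda>n. Q n (\<alpha> n)) sequentially" using ev by eventually_elim (simp add: \<alpha>)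
  have lim_s: "(\<lambda>n. real n * s n) \<longlonglongrightarrow> \<tau>" using assms(6) by (simp add: s_def l_def)
  have p_real: "filterlim (\<lambda>n. real (p n)) at_top sequentially"
    by (rule filterlim_compose[OF filterlim_real_sequentially p_lim])
  have n\<epsilon>: "(\<lambda>n. real n * \<epsilon> n) \<longlonglongrightarrow> 0"
    unfolding \<epsilon>_def \<eta>_def s_def l_def
    by (rule cdf_expansion_limits(1)[OF assms(1,2) p_real lim_s[unfolded s_def l_def]])
  have "\<forall>\<^sub>F n in sequentially. \<alpha> n \<le> s n / 2 \<and>
      s n / 2 * (l n / (l n + 1)) * (1 - 5 * \<eta> n) \<le> \<alpha> n * (1 + s n / 2 + \<epsilon> n)"
    using ev_Q by eventually_elim (simp add: Q_def)
  note n\<alpha> = cdf_expansion_limits(2)[OF assms(1,2) p_real lim_s[unfolded s_def l_def] this[unfolded \<epsilon>_def \<eta>_def s_def l_def]]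
  have mass: "(\<lambda>n. sqrt (real (p n)) * tan_mass (p n)) \<longlonglongrightarrow> sqrt (2 * pi)"
    by (rule filterlim_compose[OF tendsto_tan_mass p_lim])
  have profile: "(\<lambda>n. sqrt (1 - u\<^sup>2 / real (p n)) ^ (p n - 1)) \<longlonglongrightarrow> exp (- (u\<^sup>2) / 2)" for u
    by (rule filterlim_compose[OF tendsto_sqrt_power p_lim])
  have close: "f \<longlonglongrightarrow> L"
    if g: "g \<longlonglongrightarrow> L" and fg: "\<forall>\<^sub>F n in sequentially. \<bar>f n - g n\<bar> \<le> real n * \<epsilon> n" for f g :: "nat \<Rightarrow> real" and L
  proof -
    have "(\<lambda>n. f n - g n) \<longlonglongrightarrow> 0"
      by (rule Lim_null_comparison[OF _ n\<epsilon>]) (use fg in simp)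
    from tendsto_add[OF this g] show ?thesis by simp
  qed
  have main: "(\<lambda>n. real n * \<alpha> n * (u * sqrt (1 - u\<^sup>2 / real (p n)) ^ (p n - 1) / (sqrt (real (p n)) * tan_mass (p n))))
      \<longlonglongrightarrow> \<tau> / 2 * (u * exp (- (u\<^sup>2) / 2) / sqrt (2 * pi))" for u
  proof -
    have pi0: "sqrt (2 * pi) \<noteq> 0" by (rule less_imp_neq[symmetric]) (simp add: pi_gt_zero)
    show ?thesis
      by (rule tendsto_mult[OF n\<alpha> tendsto_divide[OF tendsto_mult[OF tendsto_const profile] mass pi0]])
  qed
  show ?thesis
  proof (intro conjI allI)
    fix u :: real
    define t where "t n = u / sqrt (real (p n))" for n
    have "(\<lambda>n. real n * d n (t n)) \<longlonglongrightarrow> - (\<tau> / 2 * (u * exp (- (u\<^sup>2) / 2) / sqrt (2 * pi)))"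
    proof (rule close[OF tendsto_minus[OF main]])
      show "\<forall>\<^sub>F n in sequentially. \<bar>real n * d n (t n) - - (real n * \<alpha> n *
          (u * sqrt (1 - u\<^sup>2 / real (p n)) ^ (p n - 1) / (sqrt (real (p n)) * tan_mass (p n))))\<bar> \<le> real n * \<epsilon> n"
        \<comment> \<open>Eventually \<open>u\<^sup>2 \<le> p n\<close>, so that \<open>t n\<close>
          lies in the range of the expansion.\<close>
        using ev_Q ev p_real[unfolded filterlim_at_top, rule_format, of "u\<^sup>2"]
      proof eventually_elim
        case (elim n)
        then have p: "0 < real (p n)" by simp
        have t2: "(t n)\<^sup>2 = u\<^sup>2 / real (p n)" by (simp add: t_def power_divide)
        also have "\<dots> \<le> 1" using elim(3) p by simp
        finally have "\<bar>t n\<bar> \<le> 1" by (simp add: abs_square_le_1)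
        with elim(1) have "\<bar>d n (t n) + \<alpha> n * (t n * sqrt (1 - (t n)\<^sup>2) ^ (p n - 1) / tan_mass (p n))\<bar> \<le> \<epsilon> n"
          unfolding Q_def by blast
        then have "real n * \<bar>d n (t n) + \<alpha> n * (t n * sqrt (1 - (t n)\<^sup>2) ^ (p n - 1) / tan_mass (p n))\<bar> \<le> real n * \<epsilon> n"
          by (rule mult_left_mono) simp
        also have "real n * \<bar>d n (t n) + \<alpha> n * (t n * sqrt (1 - (t n)\<^sup>2) ^ (p n - 1) / tan_mass (p n))\<bar>
          = \<bar>real n * (d n (t n) + \<alpha> n * (t n * sqrt (1 - (t n)\<^sup>2) ^ (p n - 1) / tan_mass (p n)))\<bar>"
          by (simp add: abs_mult)
        finally show ?case unfolding t2 by (simp add: t_def distrib_left mult.assoc)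
      qed
    qed
    moreover have "- (\<tau> / 2 * (u * exp (- (u\<^sup>2) / 2) / sqrt (2 * pi))) = - \<tau> / (2 * sqrt (2 * pi)) * u * exp (- (u\<^sup>2) / 2)"
      by simp
    ultimately have lim: "(\<lambda>n. real n * d n (t n)) \<longlonglongrightarrow> - \<tau> / (2 * sqrt (2 * pi)) * u * exp (- (u\<^sup>2) / 2)"
      by (simp only:)
    show "(\<lambda>n. real n *
              (\<P>(z in \<mu> n \<Otimes>\<^sub>M \<mu> n. sqrt (real (p n)) * dot (p n) (fst z) (snd z) \<le> u)
             - \<P>(z in \<mu>0 n \<Otimes>\<^sub>M \<mu>0 n. sqrt (real (p n)) * dot (p n) (fst z) (snd z) \<le> u)))
           \<longlonglongrightarrow> - \<tau> / (2 * sqrt (2 * pi)) * u * exp (- (u\<^sup>2) / 2)"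
    proof (rule Lim_transform_eventually[OF lim], use ev in eventually_elim)
      fix n assume n: "1 \<le> n \<and> 4 \<le> p n"
      then have "sqrt (real (p n)) * x \<le> u \<longleftrightarrow> x \<le> t n" for x
        by (simp add: t_def pos_le_divide_eq mult.commute)
      then show "real n * d n (t n) = real n *
              (\<P>(z in \<mu> n \<Otimes>\<^sub>M \<mu> n. sqrt (real (p n)) * dot (p n) (fst z) (snd z) \<le> u)
             - \<P>(z in \<mu>0 n \<Otimes>\<^sub>M \<mu>0 n. sqrt (real (p n)) * dot (p n) (fst z) (snd z) \<le> u))"
        by (simp add: d_def)
    qed
  next
    \<comment> \<open>The maximiser t = 1 / sqrt p is \<open>u = 1\<close> on the scale of the first
      limit, so \<open>main\<close> is reused with this value.\<close>
    have "(\<lambda>n. real n * dot_dist (p n) (\<mu> n) (\<mu>0 n)) \<longlonglongrightarrow> \<tau> / 2 * (1 * exp (- (1\<^sup>2) / 2) / sqrt (2 * pi))"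
    proof (rule close[OF main])
      show "\<forall>\<^sub>F n in sequentially. \<bar>real n * dot_dist (p n) (\<mu> n) (\<mu>0 n) - real n * \<alpha> n *
          (1 * sqrt (1 - 1\<^sup>2 / real (p n)) ^ (p n - 1) / (sqrt (real (p n)) * tan_mass (p n)))\<bar> \<le> real n * \<epsilon> n"
        using ev_Q ev
      proof eventually_elim
        case (elim n)
        then have Q: "0 \<le> \<alpha> n" "\<And>t. \<bar>t\<bar> \<le> 1 \<Longrightarrow>
            \<bar>d n t + \<alpha> n * (t * sqrt (1 - t\<^sup>2) ^ (p n - 1) / tan_mass (p n))\<bar> \<le> \<epsilon> n"
          by (auto simp: Q_def)
        have p2: "2 \<le> p n" using elim by simp
        let ?v = "1 / sqrt (real (p n)) * sqrt (1 - 1 / real (p n)) ^ (p n - 1) / tan_mass (p n)"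
        have "\<bar>dot_dist (p n) (\<mu> n) (\<mu>0 n) - \<alpha> n * ?v\<bar> \<le> \<epsilon> n"
          by (rule dot_dist_bounds[OF p2 Q(1) sphere_dim.tan_mass_pos[OF sphere_dim.intro[OF p2]] Q(2)[unfolded d_def]])
        then have "real n * \<bar>dot_dist (p n) (\<mu> n) (\<mu>0 n) - \<alpha> n * ?v\<bar> \<le> real n * \<epsilon> n"
          by (rule mult_left_mono) simp
        also have "real n * \<bar>dot_dist (p n) (\<mu> n) (\<mu>0 n) - \<alpha> n * ?v\<bar> = \<bar>real n * (dot_dist (p n) (\<mu> n) (\<mu>0 n) - \<alpha> n * ?v)\<bar>"
          by (simp add: abs_mult)
        finally show ?case by (simp add: right_diff_distrib mult.assoc)
      qed
    qed
    moreover have "\<tau> / 2 * (1 * exp (- (1\<^sup>2) / 2) / sqrt (2 * pi)) = \<tau> / (2 * sqrt (2 * exp 1 * pi))"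
    proof -
      have "sqrt (exp 1) = exp (1 / 2 :: real)"
        by (rule real_sqrt_unique) (simp_all add: exp_double[symmetric])
      then show ?thesis by (simp add: real_sqrt_mult exp_minus field_simps)
    qed
    ultimately show "(\<lambda>n. real n * dot_dist (p n) (\<mu> n) (\<mu>0 n)) \<longlonglongrightarrow> \<tau> / (2 * sqrt (2 * exp 1 * pi))"
      by (simp only:)
  qed
qed

end
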